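(* Let $n\in\{2,3,4,\dots\}\cup\{\infty\}$. A category $\mathcal C$ is a $\mathfrak K^{(n)}$-algebra if and only if it is an $A_n$-monoidal category.
   Context: **The posets $\mathfrak K_m$.** A parenthesized word $(W,P)$ is a finite linear order $W$ with a (possibly empty) set $P$ of closed intervals $p=[a,b]\subset W$ such that each $p\in P$ has cardinality at least $2$ and strictly smaller than that of $W$, and any two $p,p'\in P$ satisfy $p\subset p'$, $p'\subset p$ or $p\cap p'=\varnothing$. Let $W_m=\{x_1<\dots<x_m\}$. $\mathfrak K_m$ is the poset of parenthesized words on $W_m$ with $(W_m,P_2)\le (W_m,P_1)$ iff $P_1\subset P_2$ (a poset is regarded as a category with one arrow $x\to y$ when $x\le y$). $\mathfrak K_1=\{id\}$ and $\mathfrak K_0=\{0\}$ are one-point posets. Equivalently, elements of $\mathfrak K_m$ are stable planar rooted trees with $m$ leaves (every node has at least two incoming edges): leaves are labelled $x_1,\dots,x_m$ from left to right, and the non-root nodes correspond to the intervals in $P$ (the set of leaf labels above the node). $id\in\mathfrak K_1$ is the tree with one edge and no nodes, $0\in\mathfrak K_0$ is the empty tree. $T<T'$ iff $T'$ is obtained from $T$ by shrinking some internal edges. **Operad structure.** All operads are non-symmetric. $\mathfrak K=\{\mathfrak K_i\}_{i\ge0}$ is an operad in the category $CAT$ of small categories: the composition $\mathfrak K_m\times\prod_{i=1}^m\mathfrak K_{k_i}\to\mathfrak K_{k_1+\dots+k_m}$ sends $(S;T_1,\dots,T_m)$ to the tree obtained by grafting the root of $T_i$ onto the $i$-th leaf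 of $S$. If $S=id$ the result is $T_1$. If $T_i=id$ the $i$-th leaf is unchanged. If $T_i=0$ the $i$-th leaf is deleted; then, recursively, a node left with exactly one incoming edge is deleted (its incoming and outgoing edges are merged) and a node left with no incoming edges is deleted together with the edge below it. If $\sum k_i=1$ or $0$ the result is $id$ or $0$ respectively. The operad unit is $id$. **Filtration.** $\mathfrak K^{(n)}_i\subset\mathfrak K_i$ is the subposet of trees all of whose nodes have at most $n$ incoming edges; $\mathfrak K^{(\infty)}=\mathfrak K$. Each $\mathfrak K^{(n)}=\{\mathfrak K^{(n)}_i\}_{i\ge 0}$ is a suboperad. A $\mathfrak K^{(n)}$-algebra is a category $\mathcal C$ equipped with functors $\theta_i:\mathfrak K^{(n)}_i\times\mathcal C^i\to\mathcal C$, $i\ge0$, satisfying the usual associativity and unit axioms of an action of an operad. **$A_n$-monoidal categories.** An $A_n$-monoidal category is a category $\mathcal C$ with functors $\mu_k:\mathcal C^k\to\mathcal C$ for all integers $0\le k<n+1$ such that (1) $\mu_1$ is the identity functor; (2) $\mu_0:*\to\mathcal C$ is an object $0$ of $\mathcal C$ which is a strict unit: $\mu_k(Id_{\mathcal C}^{\,i}\times 0\times Id_{\mathcal C}^{\,j})=\mu_{k-1}$ whenever $i+j=k-1$; together with natural transformations (associators) $\alpha^{i,j,k}:\mu_{i+1+k}\circ(Id_{\mathcal C}^{\,i}\times\mu_j\times Id_{\mathcal C}^{\,k})\to\mu_{i+j+k}$ for $i,j,k\ge 0$ with $i+j+k<n+1$ and $i+1+k<n+1$, such that the following hold whenever all the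 indices of the $\mu$'s involved are $<n+1$. Here $\overline A,\overline B,\overline C,\overline D,\overline E$ are objects of $\mathcal C^a,\mathcal C^b,\mathcal C^c,\mathcal C^d,\mathcal C^e$, and $\alpha^{i,j,k}_{\overline X,\overline Y,\overline Z}$ is the component at $(\overline X,\overline Y,\overline Z)\in\mathcal C^i\times\mathcal C^j\times\mathcal C^k$. (i) $\alpha^{i,0,k}$, $\alpha^{i,1,k}$ and $\alpha^{0,j,0}$ are identities. (ii) $\alpha^{a+b+1,c,d}_{(\overline A,0,\overline B),\overline C,\overline D}=\alpha^{a+b,c,d}_{(\overline A,\overline B),\overline C,\overline D}$. (iii) $\alpha^{a,b,c+d+1}_{\overline A,\overline B,(\overline C,0,\overline D)}=\alpha^{a,b,c+d}_{\overline A,\overline B,(\overline C,\overline D)}$. (iv) $\alpha^{a,b+c+1,d}_{\overline A,(\overline B,0,\overline C),\overline D}=\alpha^{a,b+c,d}_{\overline A,(\overline B,\overline C),\overline D}$. (v) $\alpha^{a+b+c,d,e}_{(\overline A,\overline B,\overline C),\overline D,\overline E}\circ\alpha^{a,b,c+e+1}_{\overline A,\overline B,(\overline C,\mu_d(\overline D),\overline E)}=\alpha^{a,b,c+d+e}_{\overline A,\overline B,(\overline C,\overline D,\overline E)}\circ\alpha^{a+c+1,d,e}_{(\overline A,\mu_b(\overline B),\overline C),\overline D,\overline E}$. (vi) $\alpha^{a,b+c+d,e}_{\overline A,(\overline B,\overline C,\overline D),\overline E}\circ\mu_{a+e+1}(id_{\overline A},\alpha^{b,c,d}_{\overline B,\overline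 C,\overline D},id_{\overline E})=\alpha^{a+b,c,d+e}_{(\overline A,\overline B),\overline C,(\overline D,\overline E)}\circ\alpha^{a,b+d+1,e}_{\overline A,(\overline B,\mu_c(\overline C),\overline D),\overline E}$. In the claim, being a $\mathfrak K^{(n)}$-algebra, respectively an $A_n$-monoidal category, means being equipped with the corresponding structure. *)

theory Defs
  imports Main "HOL-Library.Extended_Nat"
begin

section \<open>Categories\<close>

record ('o, 'm) cat =
  Obj :: "'o set"
  Arr :: "'m set"
  Src :: "'m \<Rightarrow> 'o"
  Tgt :: "'m \<Rightarrow> 'o"
  Idt :: "'o \<Rightarrow> 'm"
  Cmp :: "'m \<Rightarrow> 'm \<Rightarrow> 'm"  \<comment> \<open>\<open>Cmp C g f\<close> is \<open>g \<circ> f\<close>, meaningful if \<open>Tgt C f = Src C g\<close>\<close>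

locale category =
  fixes C :: "('o, 'm) cat"
  assumes Src_Obj: "f \<in> Arr C \<Longrightarrow> Src C f \<in> Obj C"
    and Tgt_Obj: "f \<in> Arr C \<Longrightarrow> Tgt C f \<in> Obj C"
    and Idt_Arr: "x \<in> Obj C \<Longrightarrow> Idt C x \<in> Arr C"
    and Src_Idt: "x \<in> Obj C \<Longrightarrow> Src C (Idt C x) = x"
    and Tgt_Idt: "x \<in> Obj C \<Longrightarrow> Tgt C (Idt C x) = x"
    and Cmp_Arr: "\<lbrakk>f \<in> Arr C; g \<in> Arr C; Tgt C f = Src C g\<rbrakk> \<Longrightarrow> Cmp C g f \<in> Arr C"
    and Src_Cmp: "\<lbrakk>f \<in> Arr C; g \<in> Arr C; Tgt C f = Src C g\<rbrakk> \<Longrightarrow> Src C (Cmp C g f) = Src C f"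
    and Tgt_Cmp: "\<lbrakk>f \<in> Arr C; g \<in> Arr C; Tgt C f = Src C g\<rbrakk> \<Longrightarrow> Tgt C (Cmp C g f) = Tgt C g"
    and Cmp_Idt_right: "f \<in> Arr C \<Longrightarrow> Cmp C f (Idt C (Src C f)) = f"
    and Cmp_Idt_left: "f \<in> Arr C \<Longrightarrow> Cmp C (Idt C (Tgt C f)) f = f"
    and Cmp_assoc: "\<lbrakk>f \<in> Arr C; g \<in> Arr C; h \<in> Arr C; Tgt C f = Src C g; Tgt C g = Src C h\<rbrakk>
      \<Longrightarrow> Cmp C h (Cmp C g f) = Cmp C (Cmp C h g) f"

definition prod_cat :: "('o, 'm) cat \<Rightarrow> ('p, 'q) cat \<Rightarrow> ('o \<times> 'p, 'm \<times> 'q) cat" where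
  "prod_cat A B = \<lparr> Obj = Obj A \<times> Obj B, Arr = Arr A \<times> Arr B,
     Src = map_prod (Src A) (Src B), Tgt = map_prod (Tgt A) (Tgt B),
     Idt = map_prod (Idt A) (Idt B),
     Cmp = (\<lambda>(g, g') (f, f'). (Cmp A g f, Cmp B g' f')) \<rparr>"

definition power_cat :: "('o, 'm) cat \<Rightarrow> nat \<Rightarrow> ('o list, 'm list) cat" where
  "power_cat C k = \<lparr> Obj = {xs. length xs = k \<and> set xs \<subseteq> Obj C},
     Arr = {fs. length fs = k \<and> set fs \<subseteq> Arr C},
     Src = map (Src C), Tgt = map (Tgt C), Idt = map (Idt C), Cmp = map2 (Cmp C) \<rparr>"

text \<open>The arrow \<open>x \<rightarrow> y\<close> of the category of a poset is the pair \<open>(x, y)\<close>.\<close>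

definition poset_cat :: "'p set \<Rightarrow> ('p \<Rightarrow> 'p \<Rightarrow> bool) \<Rightarrow> ('p, 'p \<times> 'p) cat" where
  "poset_cat S le = \<lparr> Obj = S, Arr = {(x, y). x \<in> S \<and> y \<in> S \<and> le x y},
     Src = fst, Tgt = snd, Idt = (\<lambda>x. (x, x)), Cmp = (\<lambda>g f. (fst f, snd g)) \<rparr>"

record ('o, 'm, 'p, 'q) ftor =
  omap :: "'o \<Rightarrow> 'p"
  amap :: "'m \<Rightarrow> 'q"

locale is_functor =
  fixes A :: "('o, 'm) cat" and B :: "('p, 'q) cat" and F :: "('o, 'm, 'p, 'q) ftor"
  assumes omap_Obj: "x \<in> Obj A \<Longrightarrow> omap F x \<in> Obj B"
    and amap_Arr: "f \<in> Arr A \<Longrightarrow> amap F f \<in> Arr B"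
    and Src_amap: "f \<in> Arr A \<Longrightarrow> Src B (amap F f) = omap F (Src A f)"
    and Tgt_amap: "f \<in> Arr A \<Longrightarrow> Tgt B (amap F f) = omap F (Tgt A f)"
    and amap_Idt: "x \<in> Obj A \<Longrightarrow> amap F (Idt A x) = Idt B (omap F x)"
    and amap_Cmp: "\<lbrakk>f \<in> Arr A; g \<in> Arr A; Tgt A f = Src A g\<rbrakk>
      \<Longrightarrow> amap F (Cmp A g f) = Cmp B (amap F g) (amap F f)"

definition functor_comp ::
  "('p, 'q, 'r, 's) ftor \<Rightarrow> ('o, 'm, 'p, 'q) ftor \<Rightarrow> ('o, 'm, 'r, 's) ftor" where
  "functor_comp G F = \<lparr> omap = omap G \<circ> omap F, amap = amap G \<circ> amap F \<rparr>"

text \<open>HOL functions have values outside the category as well; two functors on \<open>A\<close> are equal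
  if they agree on \<open>A\<close>.\<close>

definition functor_eq :: "('o, 'm) cat \<Rightarrow> ('o, 'm, 'p, 'q) ftor \<Rightarrow> ('o, 'm, 'p, 'q) ftor \<Rightarrow> bool" where
  "functor_eq A F G \<longleftrightarrow>
     (\<forall>x\<in>Obj A. omap F x = omap G x) \<and> (\<forall>f\<in>Arr A. amap F f = amap G f)"

locale nat_transf =
  fixes A :: "('o, 'm) cat" and B :: "('p, 'q) cat"
    and F G :: "('o, 'm, 'p, 'q) ftor" and \<eta> :: "'o \<Rightarrow> 'q"
  assumes component_Arr: "x \<in> Obj A \<Longrightarrow> \<eta> x \<in> Arr B"
    and Src_component: "x \<in> Obj A \<Longrightarrow> Src B (\<eta> x) = omap F x"
    and Tgt_component: "x \<in> Obj A \<Longrightarrow> Tgt B (\<eta> x) = omap G x"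
    and naturality: "f \<in> Arr A \<Longrightarrow>
      Cmp B (\<eta> (Tgt A f)) (amap F f) = Cmp B (amap G f) (\<eta> (Src A f))"


section \<open>The posets of trees and their operad structure\<close>

text \<open>
  \<open>Zero\<close> is the empty tree, \<open>Leaf\<close> the tree with one edge and no nodes (the operad unit), and
  \<open>Node ts\<close> has a root node whose incoming edges carry the subtrees \<open>ts\<close>, from left to right.
  A nonempty stable tree encodes the parenthesized word whose letters are the leaves and whose
  parentheses are the non-root nodes, so that shrinking an edge removes a pair of parentheses.
\<close>

datatype tree = Zero | Leaf | Node "tree list"

fun leaves :: "tree \<Rightarrow> nat" where
  "leaves Zero = 0"
| "leaves Leaf = 1"
| "leaves (Node ts) = sum_list (map leaves ts)"

text \<open>Nonempty stable trees all of whose nodes have at most \<open>n\<close> incoming edges.\<close>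

inductive stable :: "enat \<Rightarrow> tree \<Rightarrow> bool" for n where
  stable_Leaf: "stable n Leaf"
| stable_Node: "\<lbrakk>2 \<le> length ts; enat (length ts) \<le> n; \<forall>t\<in>set ts. stable n t\<rbrakk>
    \<Longrightarrow> stable n (Node ts)"

definition K :: "enat \<Rightarrow> nat \<Rightarrow> tree set" where
  "K n m = {T. (T = Zero \<or> stable n T) \<and> leaves T = m}"

text \<open>Shrinking a single internal edge, at the root or further up.\<close>

inductive shrink :: "tree \<Rightarrow> tree \<Rightarrow> bool" where
  shrink_root: "shrink (Node (us @ Node ts # vs)) (Node (us @ ts @ vs))"
| shrink_above: "shrink t t' \<Longrightarrow> shrink (Node (us @ t # vs)) (Node (us @ t' # vs))"

text \<open>\<open>tree_le T T'\<close>: the parentheses of \<open>T'\<close> are among those of \<open>T\<close>.\<close>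

definition tree_le :: "tree \<Rightarrow> tree \<Rightarrow> bool" where
  "tree_le = shrink\<^sup>*\<^sup>*"

definition K_cat :: "enat \<Rightarrow> nat \<Rightarrow> (tree, tree \<times> tree) cat" where
  "K_cat n m = poset_cat (K n m) tree_le"

text \<open>
  \<open>mk_node\<close> forms a node over possibly empty trees: edges carrying the empty tree are deleted,
  and then the node itself if it has fewer than two incoming edges left.
\<close>

definition mk_node :: "tree list \<Rightarrow> tree" where
  "mk_node ts = (case filter (\<lambda>t. t \<noteq> Zero) ts of [] \<Rightarrow> Zero | [t] \<Rightarrow> t | us \<Rightarrow> Node us)"

text \<open>\<open>graft S Ts\<close> is the operad composite \<open>(S; T\<^sub>1, \<dots>, T\<^sub>m)\<close> for \<open>m = leaves S = length Ts\<close>.\<close>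

fun graft :: "tree \<Rightarrow> tree list \<Rightarrow> tree" and graft_list :: "tree list \<Rightarrow> tree list \<Rightarrow> tree list" where
  "graft Zero Ts = Zero"
| "graft Leaf Ts = hd Ts"
| "graft (Node ss) Ts = mk_node (graft_list ss Ts)"
| "graft_list [] Ts = []"
| "graft_list (s # ss) Ts = graft s (take (leaves s) Ts) # graft_list ss (drop (leaves s) Ts)"


section \<open>Algebras over the operads \<open>K n\<close>\<close>

text \<open>
  The associativity axiom is an equality of functors
  \<open>K\<^sub>m \<times> (\<Prod>i. K\<^sub>k\<^sub>i) \<times> C\<^sup>k\<^sup>1 \<times> \<dots> \<times> C\<^sup>k\<^sup>m \<rightarrow> C\<close>, spelled out on objects and on arrows; \<open>Xs\<close> and \<open>Fs\<close>
  consist of \<open>m\<close> lists of lengths \<open>k\<^sub>1, \<dots>, k\<^sub>m\<close>.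
\<close>

locale K_algebra =
  fixes n :: enat and C :: "('o, 'm) cat"
    and \<theta> :: "nat \<Rightarrow> (tree \<times> 'o list, (tree \<times> tree) \<times> 'm list, 'o, 'm) ftor"
  assumes action_functor: "is_functor (prod_cat (K_cat n i) (power_cat C i)) C (\<theta> i)"
    and unit_obj: "x \<in> Obj C \<Longrightarrow> omap (\<theta> 1) (Leaf, [x]) = x"
    and unit_arr: "f \<in> Arr C \<Longrightarrow> amap (\<theta> 1) ((Leaf, Leaf), [f]) = f"
    and assoc_obj: "\<lbrakk>S \<in> Obj (K_cat n (length Ts));
        list_all2 (\<lambda>T xs. T \<in> Obj (K_cat n (length xs)) \<and> set xs \<subseteq> Obj C) Ts Xs\<rbrakk> \<Longrightarrow>
      omap (\<theta> (length (concat Xs))) (graft S Ts, concat Xs) =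
      omap (\<theta> (length Ts)) (S, map2 (\<lambda>T xs. omap (\<theta> (length xs)) (T, xs)) Ts Xs)"
    and assoc_arr: "\<lbrakk>(S, S') \<in> Arr (K_cat n (length ts));
        list_all2 (\<lambda>t fs. t \<in> Arr (K_cat n (length fs)) \<and> set fs \<subseteq> Arr C) ts Fs\<rbrakk> \<Longrightarrow>
      amap (\<theta> (length (concat Fs)))
        ((graft S (map fst ts), graft S' (map snd ts)), concat Fs) =
      amap (\<theta> (length ts)) ((S, S'), map2 (\<lambda>t fs. amap (\<theta> (length fs)) (t, fs)) ts Fs)"


section \<open>\<open>A\<^sub>n\<close>-monoidal categories\<close>

text \<open>The functor \<open>Id\<^sup>i \<times> F \<times> Id\<^sup>k : C\<^sup>i\<^sup>+\<^sup>j\<^sup>+\<^sup>k \<rightarrow> C\<^sup>i\<^sup>+\<^sup>1\<^sup>+\<^sup>k\<close> for \<open>F : C\<^sup>j \<rightarrow> C\<close>; the number \<open>k\<close> is determined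
  by the length of the argument list.\<close>

definition whisker :: "nat \<Rightarrow> nat \<Rightarrow> ('o list, 'm list, 'o, 'm) ftor
    \<Rightarrow> ('o list, 'm list, 'o list, 'm list) ftor" where
  "whisker i j F = \<lparr>
     omap = (\<lambda>xs. take i xs @ [omap F (take j (drop i xs))] @ drop (i + j) xs),
     amap = (\<lambda>fs. take i fs @ [amap F (take j (drop i fs))] @ drop (i + j) fs) \<rparr>"

text \<open>The associator \<open>\<alpha>\<^sup>i\<^sup>,\<^sup>j\<^sup>,\<^sup>k\<close> exists.\<close>

definition assoc_range :: "enat \<Rightarrow> nat \<Rightarrow> nat \<Rightarrow> nat \<Rightarrow> bool" where
  "assoc_range n i j k \<longleftrightarrow> enat (i + j + k) < n + 1 \<and> enat (i + 1 + k) < n + 1"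

text \<open>
  The component of \<open>\<alpha>\<^sup>i\<^sup>,\<^sup>j\<^sup>,\<^sup>k\<close> at \<open>(X, Y, Z)\<close> is \<open>\<alpha> i j k (X @ Y @ Z)\<close>. Only the \<open>\<mu> k\<close> with
  \<open>k < n + 1\<close> and the \<open>\<alpha> i j k\<close> with \<open>assoc_range n i j k\<close> are part of the structure.
  In each axiom the range conditions on the associators occurring in it bound the indices of all
  the functors \<open>\<mu>\<close> that are involved.
\<close>

locale A_monoidal =
  fixes n :: enat and C :: "('o, 'm) cat"
    and \<mu> :: "nat \<Rightarrow> ('o list, 'm list, 'o, 'm) ftor"
    and \<alpha> :: "nat \<Rightarrow> nat \<Rightarrow> nat \<Rightarrow> 'o list \<Rightarrow> 'm"
  assumes mult_functor: "enat k < n + 1 \<Longrightarrow> is_functor (power_cat C k) C (\<mu> k)"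
    and mult_1_obj: "x \<in> Obj C \<Longrightarrow> omap (\<mu> 1) [x] = x"
    and mult_1_arr: "f \<in> Arr C \<Longrightarrow> amap (\<mu> 1) [f] = f"
    and strict_unit_obj:
      "\<lbrakk>i + j + 1 = k; enat k < n + 1; xs \<in> Obj (power_cat C i); ys \<in> Obj (power_cat C j)\<rbrakk> \<Longrightarrow>
        omap (\<mu> k) (xs @ [omap (\<mu> 0) []] @ ys) = omap (\<mu> (k - 1)) (xs @ ys)"
    and strict_unit_arr:
      "\<lbrakk>i + j + 1 = k; enat k < n + 1; fs \<in> Arr (power_cat C i); gs \<in> Arr (power_cat C j)\<rbrakk> \<Longrightarrow>
        amap (\<mu> k) (fs @ [Idt C (omap (\<mu> 0) [])] @ gs) = amap (\<mu> (k - 1)) (fs @ gs)"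
    and assoc_natural: "assoc_range n i j k \<Longrightarrow>
      nat_transf (power_cat C (i + j + k)) C
        (functor_comp (\<mu> (i + 1 + k)) (whisker i j (\<mu> j))) (\<mu> (i + j + k)) (\<alpha> i j k)"
    and assoc_id_0: "\<lbrakk>assoc_range n i 0 k; xs \<in> Obj (power_cat C (i + k))\<rbrakk> \<Longrightarrow>
      \<alpha> i 0 k xs = Idt C (omap (\<mu> (i + k)) xs)"
    and assoc_id_1: "\<lbrakk>assoc_range n i 1 k; xs \<in> Obj (power_cat C (i + 1 + k))\<rbrakk> \<Longrightarrow>
      \<alpha> i 1 k xs = Idt C (omap (\<mu> (i + 1 + k)) xs)"
    and assoc_id_outer: "\<lbrakk>assoc_range n 0 j 0; xs \<in> Obj (power_cat C j)\<rbrakk> \<Longrightarrow>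
      \<alpha> 0 j 0 xs = Idt C (omap (\<mu> j) xs)"
    and assoc_unit_left:
      "\<lbrakk>assoc_range n (a + b + 1) c d; assoc_range n (a + b) c d;
        A \<in> Obj (power_cat C a); B \<in> Obj (power_cat C b);
        X \<in> Obj (power_cat C c); D \<in> Obj (power_cat C d)\<rbrakk> \<Longrightarrow>
        \<alpha> (a + b + 1) c d ((A @ [omap (\<mu> 0) []] @ B) @ X @ D) = \<alpha> (a + b) c d ((A @ B) @ X @ D)"
    and assoc_unit_right:
      "\<lbrakk>assoc_range n a b (c + d + 1); assoc_range n a b (c + d);
        A \<in> Obj (power_cat C a); B \<in> Obj (power_cat C b);
        X \<in> Obj (power_cat C c); D \<in> Obj (power_cat C d)\<rbrakk> \<Longrightarrow>
        \<alpha> a b (c + d + 1) (A @ B @ (X @ [omap (\<mu> 0) []] @ D)) = \<alpha> a b (c + d) (A @ B @ (X @ D))"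
    and assoc_unit_middle:
      "\<lbrakk>assoc_range n a (b + c + 1) d; assoc_range n a (b + c) d;
        A \<in> Obj (power_cat C a); B \<in> Obj (power_cat C b);
        X \<in> Obj (power_cat C c); D \<in> Obj (power_cat C d)\<rbrakk> \<Longrightarrow>
        \<alpha> a (b + c + 1) d (A @ (B @ [omap (\<mu> 0) []] @ X) @ D) = \<alpha> a (b + c) d (A @ (B @ X) @ D)"
    and assoc_parallel:
      "\<lbrakk>assoc_range n (a + b + c) d e; assoc_range n a b (c + e + 1);
        assoc_range n a b (c + d + e); assoc_range n (a + c + 1) d e;
        A \<in> Obj (power_cat C a); B \<in> Obj (power_cat C b); X \<in> Obj (power_cat C c);
        D \<in> Obj (power_cat C d); E \<in> Obj (power_cat C e)\<rbrakk> \<Longrightarrow>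
        Cmp C (\<alpha> (a + b + c) d e ((A @ B @ X) @ D @ E))
              (\<alpha> a b (c + e + 1) (A @ B @ (X @ [omap (\<mu> d) D] @ E)))
      = Cmp C (\<alpha> a b (c + d + e) (A @ B @ (X @ D @ E)))
              (\<alpha> (a + c + 1) d e ((A @ [omap (\<mu> b) B] @ X) @ D @ E))"
    and assoc_nested:
      "\<lbrakk>assoc_range n a (b + c + d) e; assoc_range n b c d;
        assoc_range n (a + b) c (d + e); assoc_range n a (b + d + 1) e;
        A \<in> Obj (power_cat C a); B \<in> Obj (power_cat C b); X \<in> Obj (power_cat C c);
        D \<in> Obj (power_cat C d); E \<in> Obj (power_cat C e)\<rbrakk> \<Longrightarrow>
        Cmp C (\<alpha> a (b + c + d) e (A @ (B @ X @ D) @ E))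
              (amap (\<mu> (a + e + 1)) (map (Idt C) A @ [\<alpha> b c d (B @ X @ D)] @ map (Idt C) E))
      = Cmp C (\<alpha> (a + b) c (d + e) ((A @ B) @ X @ (D @ E)))
              (\<alpha> a (b + d + 1) e (A @ (B @ [omap (\<mu> c) X] @ D) @ E))"


section \<open>Comparison of the two structures\<close>

definition corolla :: "nat \<Rightarrow> tree" where
  "corolla k = (if k = 0 then Zero else if k = 1 then Leaf else Node (replicate k Leaf))"

text \<open>
  The \<open>A\<^sub>n\<close>-monoidal structure carried by a \<open>K n\<close>-algebra: \<open>\<mu> k\<close> is the action of the corolla with
  \<open>k\<close> leaves, and \<open>\<alpha> i j k\<close> is the action of the arrow that shrinks the internal edge of the
  tree obtained by grafting a corolla with \<open>j\<close> leaves onto a leaf of a corolla.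
\<close>

definition corresponds ::
  "enat \<Rightarrow> ('o, 'm) cat
    \<Rightarrow> (nat \<Rightarrow> (tree \<times> 'o list, (tree \<times> tree) \<times> 'm list, 'o, 'm) ftor)
    \<Rightarrow> (nat \<Rightarrow> ('o list, 'm list, 'o, 'm) ftor)
    \<Rightarrow> (nat \<Rightarrow> nat \<Rightarrow> nat \<Rightarrow> 'o list \<Rightarrow> 'm) \<Rightarrow> bool" where
  "corresponds n C \<theta> \<mu> \<alpha> \<longleftrightarrow>
     (\<forall>k. enat k < n + 1 \<longrightarrow>
        functor_eq (power_cat C k) (\<mu> k)
          \<lparr> omap = (\<lambda>xs. omap (\<theta> k) (corolla k, xs)),
            amap = (\<lambda>fs. amap (\<theta> k) ((corolla k, corolla k), fs)) \<rparr>) \<and>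
     (\<forall>i j k. assoc_range n i j k \<longrightarrow>
        (\<forall>xs \<in> Obj (power_cat C (i + j + k)).
           \<alpha> i j k xs =
           amap (\<theta> (i + j + k))
             ((graft (corolla (i + 1 + k)) (replicate i Leaf @ [corolla j] @ replicate k Leaf),
               corolla (i + j + k)), map (Idt C) xs)))"

end

theory Submission
  imports Defs
begin

text \<open>
  In an \<open>A\<^sub>n\<close>-monoidal category a tree acts on objects and arrows by iterating the \<open>\<mu>\<close>'s. Composites of
  the associators give unbiased morphisms
  \<open>\<gamma> : \<mu>(\<mu>(x\<^sub>1\<^sub>1, \<dots>), \<dots>, \<mu>(x\<^sub>k\<^sub>1, \<dots>)) \<rightarrow> \<mu>(x\<^sub>1\<^sub>1, \<dots>)\<close>, and axioms (v) and (vi) imply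
  \<open>\<gamma> \<circ> \<gamma> = \<gamma> \<circ> \<mu>(\<gamma>, \<dots>, \<gamma>)\<close> as for a monad. If \<open>T \<le> T'\<close>, the list of trees above the root of \<open>T'\<close> splits
  in a unique way into segments, the \<open>i\<close>-th of which, joined at a new root, is a contraction of the \<open>i\<close>-th tree
  above the root of \<open>T\<close>. By recursion this gives a morphism from the value of \<open>T\<close> to that of \<open>T'\<close>, namely \<open>\<gamma>\<close>
  after \<open>\<mu>\<close> of the recursively obtained morphisms. No contraction order is chosen, so no coherence
  theorem for paths of contractions is needed: functoriality and compatibility with grafting follow
  from the laws of \<open>\<gamma>\<close>, and deleted leaves are harmless by axioms (i)--(iv).

  Conversely, the axioms of an \<open>A\<^sub>n\<close>-monoidal category hold in a \<open>K n\<close>-algebra because both sides are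
  the action of the same arrow of a poset.
\<close>

section \<open>Evaluating trees\<close>

text \<open>Grafting empty trees deletes leaves and may collapse nodes, so a composite need not have
  the shape of the trees it is built from. Hence constructions are stated for \<open>mk_node\<close>
  of lists of possibly empty trees, and one evaluator \<open>tval\<close> serves for grafting, for
  objects and for arrows: all three are operations of bounded arity with a strict unit. The second
  obstacle is the bound \<open>n\<close> on all arities. Opening a nonempty bracket never shortens a
  list, so it suffices to bound the final length; empty brackets are therefore kept out of the
  iterated associators. Contracting an edge never lowers the largest arity, so a path of
  contractions that ends within the bound stays within it. The canonical morphism is a relation
  \<open>ct\<close> and not a recursive function, so that a grafted tree can be recognized as an
  instance of the recursion after its empty parts have been discarded. The relation is single-valued
  because a nonempty stable tree has at least one leaf, so that leaf counts determine the
  segments.\<close>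

fun tval :: "('a list \<Rightarrow> 'a) \<Rightarrow> tree \<Rightarrow> 'a list \<Rightarrow> 'a"
  and tvals :: "('a list \<Rightarrow> 'a) \<Rightarrow> tree list \<Rightarrow> 'a list \<Rightarrow> 'a list" where
  "tval F Zero xs = F []"
| "tval F Leaf xs = hd xs"
| "tval F (Node ts) xs = F (tvals F ts xs)"
| "tvals F [] xs = []"
| "tvals F (t # ts) xs = tval F t (take (leaves t) xs) # tvals F ts (drop (leaves t) xs)"

abbreviation total_leaves :: "tree list \<Rightarrow> nat" where
  "total_leaves ts \<equiv> sum_list (map leaves ts)"

section \<open>Nodes over possibly empty trees\<close>

lemma mk_node_Nil [simp]: "mk_node [] = Zero"
  by (simp add: mk_node_def)

lemma mk_node_single [simp]: "mk_node [t] = t"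
  by (simp add: mk_node_def)

lemma mk_node_filter: "mk_node (filter (\<lambda>t. t \<noteq> Zero) ts) = mk_node ts"
  by (simp add: mk_node_def)

lemma mk_node_Node: "Zero \<notin> set ts \<Longrightarrow> 2 \<le> length ts \<Longrightarrow> mk_node ts = Node ts"
  by (cases ts; cases "tl ts") (auto simp: mk_node_def filter_id_conv intro!: filter_True)

lemma mk_node_cases:
  obtains (none) "filter (\<lambda>t. t \<noteq> Zero) ts = []" "mk_node ts = Zero"
  | (single) t where "filter (\<lambda>t. t \<noteq> Zero) ts = [t]" "mk_node ts = t" "t \<noteq> Zero"
  | (many) "2 \<le> length (filter (\<lambda>t. t \<noteq> Zero) ts)"
      "mk_node ts = Node (filter (\<lambda>t. t \<noteq> Zero) ts)"
proof -
  let ?us = "filter (\<lambda>t. t \<noteq> Zero) ts"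
  consider "?us = []" | t where "?us = [t]" | a b us where "?us = a # b # us"
    by (metis neq_Nil_conv)
  then show thesis
  proof cases
    case 1 then show ?thesis using none by (simp add: mk_node_def)
  next
    case (2 t)
    then have "t \<in> set ?us" by simp
    then have "t \<noteq> Zero" by simp
    then show ?thesis using 2 single by (simp add: mk_node_def)
  next
    case 3 then show ?thesis using many by (simp add: mk_node_def)
  qed
qed

lemma leaves_mk_node [simp]: "leaves (mk_node ts) = total_leaves ts"
proof -
  have "total_leaves (filter (\<lambda>t. t \<noteq> Zero) ts) = total_leaves ts"
    by (induction ts) auto
  then show ?thesis by (cases ts rule: mk_node_cases) auto
qed

lemma mk_node_eq_Zero: "mk_node ts = Zero \<longleftrightarrow> set ts \<subseteq> {Zero}"
proof
  assume "mk_node ts = Zero"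
  then have "filter (\<lambda>t. t \<noteq> Zero) ts = []" by (cases ts rule: mk_node_cases) auto
  then show "set ts \<subseteq> {Zero}" by (auto simp: filter_empty_conv)
next
  assume "set ts \<subseteq> {Zero}"
  then have "filter (\<lambda>t. t \<noteq> Zero) ts = []" by (auto simp: filter_empty_conv)
  then show "mk_node ts = Zero" by (metis mk_node_filter mk_node_Nil)
qed

text \<open>The induction rule generated for \<open>tval_tvals\<close> carries the operation
  \<open>F\<close>. Removing it lets one induction serve statements that involve different
  operations, or several at once.\<close>

lemma tree_labels_induct [case_names Zero Leaf Node Nil Cons]:
  fixes xs :: "'a list"
  assumes "\<And>xs. P Zero xs" and "\<And>xs. P Leaf xs" and "\<And>ts xs. Q ts xs \<Longrightarrow> P (Node ts) xs"
    and "\<And>xs. Q [] xs"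
    and "\<And>t ts xs. P t (take (leaves t) xs) \<Longrightarrow> Q ts (drop (leaves t) xs) \<Longrightarrow> Q (t # ts) xs"
  shows "P T xs" and "Q ts xs"
  using tval_tvals.induct[of "\<lambda>_. P" "\<lambda>_. Q"] assms by metis+

text \<open>Grafting is evaluation in the algebra of trees themselves: the labels are trees and the
  operation is \<open>mk_node\<close>. General facts about evaluation thus apply to the operad
  composition.\<close>

lemma graft_tval: "graft S Ts = tval mk_node S Ts"
  and graft_list_tvals: "graft_list Ss Ts = tvals mk_node Ss Ts"
  by (induction S Ts and Ss Ts rule: graft_graft_list.induct) auto

lemma length_tvals [simp]: "length (tvals F ts xs) = length ts"
  by (induction ts arbitrary: xs) auto

lemma tvals_append:
  "length xs = total_leaves ts \<Longrightarrow> tvals F (ts @ us) (xs @ ys) = tvals F ts xs @ tvals F us ys"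
  by (induction ts arbitrary: xs) auto

lemma tvals_map_concat:
  "\<forall>p\<in>set ps. length (l p) = leaves (t p) \<Longrightarrow>
    tvals F (map t ps) (concat (map l ps)) = map (\<lambda>p. tval F (t p) (l p)) ps"
  by (induction ps) auto

lemma tvals_concat_concat:
  "\<forall>p\<in>set ps. length (l p) = total_leaves (s p) \<Longrightarrow>
    tvals F (concat (map s ps)) (concat (map l ps)) = concat (map (\<lambda>p. tvals F (s p) (l p)) ps)"
  by (induction ps) (auto simp: tvals_append)

text \<open>Pairs every tree with its block of labels. Later inductions run over such lists of pairs
  instead of the \<open>take\<close> and \<open>drop\<close> of the evaluator.\<close>

lemma split_lengths:
  assumes "length xs = sum_list (map k ts)"
  obtains ps where "ts = map fst ps" "xs = concat (map snd ps)"
    "\<forall>p\<in>set ps. length (snd p) = k (fst p)"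
proof -
  have "\<exists>ps. ts = map fst ps \<and> xs = concat (map snd ps) \<and>
      (\<forall>p\<in>set ps. length (snd p) = k (fst p))"
    using assms
  proof (induction ts arbitrary: xs)
    case Nil then show ?case by simp
  next
    case (Cons t ts)
    then have "length (drop (k t) xs) = sum_list (map k ts)" by simp
    from Cons.IH[OF this] obtain ps where ps: "ts = map fst ps"
      "drop (k t) xs = concat (map snd ps)" "\<forall>p\<in>set ps. length (snd p) = k (fst p)"
      by blast
    have "xs = take (k t) xs @ concat (map snd ps)"
      by (metis append_take_drop_id ps(2))
    moreover have "length (take (k t) xs) = k t" using Cons.prems by simp
    ultimately show ?case using ps
      by (intro exI[of _ "(t, take (k t) xs) # ps"]) auto
  qed
  then show thesis using that by blast
qed

section \<open>Deletion of units from lists\<close>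

inductive drops :: "'a \<Rightarrow> 'a list \<Rightarrow> 'a list \<Rightarrow> bool" for z where
  drops_Nil: "drops z [] []"
| drops_keep: "drops z xs ys \<Longrightarrow> drops z (x # xs) (x # ys)"
| drops_skip: "drops z xs ys \<Longrightarrow> drops z (z # xs) ys"

lemma drops_refl: "drops z xs xs"
  by (induction xs) (auto intro: drops.intros)

lemma drops_append: "drops z xs ys \<Longrightarrow> drops z us vs \<Longrightarrow> drops z (xs @ us) (ys @ vs)"
  by (induction rule: drops.induct) (auto intro: drops.intros)

lemma drops_set: "drops z xs ys \<Longrightarrow> set ys \<subseteq> set xs"
  by (induction rule: drops.induct) auto

lemma drops_length: "drops z xs ys \<Longrightarrow> length ys \<le> length xs"
  by (induction rule: drops.induct) auto

lemma drops_mid: "drops z (xs @ z # ys) (xs @ ys)"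
  by (intro drops_append drops_refl drops_skip)

text \<open>The unit axioms remove one unit at an arbitrary position, whereas the rules of
  \<open>drops\<close> work at the head of the list. This rule turns the latter into single
  deletions.\<close>

lemma drops_induct_step [consumes 1, case_names refl insert]:
  assumes "drops z xs ys"
    and refl: "\<And>xs. P xs xs"
    and insert: "\<And>us vs ws. drops z (us @ vs) ws \<Longrightarrow> P (us @ vs) ws \<Longrightarrow> P (us @ z # vs) ws"
  shows "P xs ys"
proof -
  \<comment> \<open>The prefix \<open>us\<close> absorbs the entries that have been kept.\<close>
  have "P (us @ xs) (us @ ys)" for us
    using assms(1)
  proof (induction arbitrary: us rule: drops.induct)
    case drops_Nil then show ?case by (simp add: refl)
  next
    case (drops_keep xs ys x)
    then show ?case using drops_keep.IH[of "us @ [x]"] by simp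
  next
    case (drops_skip xs ys)
    then show ?case by (intro insert drops_append drops_refl)
  qed
  from this[of "[]"] show ?thesis by simp
qed

text \<open>The relation \<open>drops\<close> allows occurrences of the unit to survive. This
  matters here, because a nonempty tree may also have the unit as its value.\<close>

lemma tvals_filter:
  "length xs = total_leaves ts \<Longrightarrow>
    drops (F []) (tvals F ts xs) (tvals F (filter (\<lambda>t. t \<noteq> Zero) ts) xs)"
  by (induction ts arbitrary: xs) (auto intro: drops.intros)

abbreviation okt :: "enat \<Rightarrow> tree \<Rightarrow> bool" where
  "okt n T \<equiv> T = Zero \<or> stable n T"

lemma okt_Node: "okt n (Node ts) \<longleftrightarrow>
    2 \<le> length ts \<and> enat (length ts) \<le> n \<and> (\<forall>t\<in>set ts. stable n t)"
  using stable.simps[of n "Node ts"] by auto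

lemma stable_Zero [simp]: "\<not> stable n Zero"
  by (auto elim: stable.cases)

lemma stable_leaves: "stable n t \<Longrightarrow> 1 \<le> leaves t"
proof (induction rule: stable.induct)
  case (stable_Node ts)
  then show ?case by (cases ts) auto
qed simp

lemma okt_mk_node: "\<forall>t\<in>set ts. okt n t \<Longrightarrow> enat (length ts) \<le> n \<Longrightarrow> okt n (mk_node ts)"
proof (cases ts rule: mk_node_cases)
  case (single t)
  assume "\<forall>t\<in>set ts. okt n t"
  then have *: "okt n t" if "t \<in> set ts" for t using that by blast
  have "t \<in> set ts" using single(1) by (metis filter_is_subset list.set_intros(1) subset_iff)
  then show ?thesis using *[of t] single(2) by simp
next
  case many
  assume a: "\<forall>t\<in>set ts. okt n t" "enat (length ts) \<le> n"
  have "enat (length (filter (\<lambda>t. t \<noteq> Zero) ts)) \<le> n"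
    using a(2) length_filter_le by (meson enat_ord_simps(1) order_trans)
  then show ?thesis using many a by (auto intro!: stable_Node)
qed simp

section \<open>Operations of bounded arity with a strict unit: the common setting of trees, objects
  and arrows\<close>

locale nary =
  fixes n :: enat and D :: "'a set" and F :: "'a list \<Rightarrow> 'a"
  assumes closed: "set xs \<subseteq> D \<Longrightarrow> enat (length xs) \<le> n \<Longrightarrow> F xs \<in> D"
    and single: "x \<in> D \<Longrightarrow> F [x] = x"
    and drop_unit: "set (xs @ ys) \<subseteq> D \<Longrightarrow> enat (length (xs @ F [] # ys)) \<le> n \<Longrightarrow>
      F (xs @ F [] # ys) = F (xs @ ys)"
begin

lemma nil_closed: "F [] \<in> D"
  by (rule closed) (simp_all add: zero_enat_def[symmetric])

lemma drop_units:
  assumes "drops (F []) xs ys" "set xs \<subseteq> D" "enat (length xs) \<le> n"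
  shows "F xs = F ys"
  using assms
proof (induction rule: drops_induct_step)
  case (insert us vs ws)
  have "enat (length (us @ vs)) \<le> n"
    using insert(4) by (metis (no_types, lifting) drops_length drops_mid enat_ord_simps(1) order_trans)
  then show ?case using insert drop_unit[of us vs] by simp
qed simp

lemma tval_closed: "okt n T \<Longrightarrow> set xs \<subseteq> D \<Longrightarrow> length xs = leaves T \<Longrightarrow> tval F T xs \<in> D"
  and tvals_closed: "\<forall>t\<in>set ts. okt n t \<Longrightarrow> set xs \<subseteq> D \<Longrightarrow> length xs = total_leaves ts \<Longrightarrow>
    set (tvals F ts xs) \<subseteq> D"
proof (induction T xs and ts xs rule: tree_labels_induct)
  case (Leaf xs) then show ?case by (cases xs) auto
next
  case (Node ts xs)
  then have "\<forall>t\<in>set ts. okt n t" "enat (length ts) \<le> n"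
    using okt_Node[of ts n] by auto
  then show ?case using Node by (auto intro!: closed simp del: subset_iff)
next
  case (Cons t ts xs)
  have "set (take (leaves t) xs) \<subseteq> D" "set (drop (leaves t) xs) \<subseteq> D"
    using Cons.prems by (meson order_trans set_take_subset set_drop_subset)+
  then show ?case using Cons by auto
qed (auto intro: nil_closed)

text \<open>Evaluation does not see the deletions made by \<open>mk_node\<close>: empty trees
  contribute strict units, and a unary node would be the identity on its argument. The first case is
  covered by \<open>drop_units\<close>, the second by \<open>single\<close>.\<close>

lemma tval_mk_node:
  assumes "\<forall>t\<in>set ts. okt n t" "enat (length ts) \<le> n" "set xs \<subseteq> D" "length xs = total_leaves ts"
  shows "tval F (mk_node ts) xs = F (tvals F ts xs)"
proof -
  let ?us = "filter (\<lambda>t. t \<noteq> Zero) ts"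
  have eq: "total_leaves ?us = total_leaves ts" by (induction ts) auto
  have "tval F (mk_node ts) xs = F (tvals F ?us xs)"
  proof (cases ts rule: mk_node_cases)
    case (single t)
    have "okt n (mk_node ts)" using assms okt_mk_node by blast
    then have "tval F t xs \<in> D" using single assms leaves_mk_node[of ts]
      by (intro tval_closed) auto
    then show ?thesis using single eq assms(4) by (simp add: nary.single[OF nary_axioms])
  qed simp_all
  also have "\<dots> = F (tvals F ts xs)"
    using tvals_filter[OF assms(4)] tvals_closed[OF assms(1,3,4)] assms(2)
    by (intro drop_units[symmetric]) simp_all
  finally show ?thesis .
qed

end

lemma nary_mk_node: "nary n {T. okt n T} mk_node"
proof
  fix xs :: "tree list"
  assume "set xs \<subseteq> {T. okt n T}" "enat (length xs) \<le> n"
  then show "mk_node xs \<in> {T. okt n T}" using okt_mk_node by blast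
next
  fix xs ys show "mk_node (xs @ mk_node [] # ys) = mk_node (xs @ ys)"
    using mk_node_filter[of "xs @ mk_node [] # ys"] mk_node_filter[of "xs @ ys"] by simp
qed simp

lemma leaves_tval:
  "length Ts = leaves S \<Longrightarrow> leaves (tval mk_node S Ts) = sum_list (map leaves Ts)"
  "length Ts = total_leaves Ss \<Longrightarrow> total_leaves (tvals mk_node Ss Ts) = sum_list (map leaves Ts)"
proof (induction S Ts and Ss Ts rule: graft_graft_list.induct)
  case (2 Ts) then show ?case by (cases Ts) auto
next
  case (5 s ss Ts)
  then show ?case by (simp flip: sum_list_append map_append)
qed auto

lemma okt_tval:
  "okt n S \<Longrightarrow> \<forall>T\<in>set Ts. okt n T \<Longrightarrow> length Ts = leaves S \<Longrightarrow> okt n (tval mk_node S Ts)"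
  "\<forall>s\<in>set Ss. okt n s \<Longrightarrow> \<forall>T\<in>set Ts. okt n T \<Longrightarrow> length Ts = total_leaves Ss \<Longrightarrow>
    \<forall>T\<in>set (tvals mk_node Ss Ts). okt n T"
  using nary.tval_closed[OF nary_mk_node[of n], of S Ts] nary.tvals_closed[OF nary_mk_node[of n], of Ss Ts]
  by (auto simp: subset_iff)

context nary begin

text \<open>Taken for objects and for arrows, this is the associativity axiom of the action as far
  as no contraction of trees is involved. The critical case is a root node, which grafting may
  collapse; \<open>tval_mk_node\<close> absorbs this.\<close>

lemma tval_graft:
  "okt n S \<Longrightarrow> length qs = leaves S \<Longrightarrow>
    \<forall>q\<in>set qs. okt n (T q) \<and> set (l q) \<subseteq> D \<and> length (l q) = leaves (T q) \<Longrightarrow>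
    tval F (tval mk_node S (map T qs)) (concat (map l qs)) =
    tval F S (map (\<lambda>q. tval F (T q) (l q)) qs)"
  and tvals_graft: "\<forall>s\<in>set Ss. okt n s \<Longrightarrow> length qs = total_leaves Ss \<Longrightarrow>
    \<forall>q\<in>set qs. okt n (T q) \<and> set (l q) \<subseteq> D \<and> length (l q) = leaves (T q) \<Longrightarrow>
    tvals F (tvals mk_node Ss (map T qs)) (concat (map l qs)) =
    tvals F Ss (map (\<lambda>q. tval F (T q) (l q)) qs)"
proof (induction S qs and Ss qs rule: tree_labels_induct)
  case (Leaf qs)
  then obtain q where "qs = [q]" by (cases qs) auto
  then show ?case by simp
next
  case (Node ts qs)
  have ts: "\<forall>t\<in>set ts. okt n t" "enat (length ts) \<le> n"
    using Node.prems(1) okt_Node[of ts n] by auto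
  have lv: "length qs = total_leaves ts" using Node.prems(2) by simp
  have "tval F (mk_node (tvals mk_node ts (map T qs))) (concat (map l qs)) =
      F (tvals F (tvals mk_node ts (map T qs)) (concat (map l qs)))"
  proof (rule tval_mk_node)
    show "\<forall>t\<in>set (tvals mk_node ts (map T qs)). okt n t"
      using ts lv Node.prems(3) by (intro okt_tval(2)) auto
    have "length (concat (map l qs)) = sum_list (map leaves (map T qs))"
      using Node.prems(3) by (induction qs) auto
    then show "length (concat (map l qs)) = total_leaves (tvals mk_node ts (map T qs))"
      using lv by (simp add: leaves_tval(2))
  qed (use ts Node.prems(3) in auto)
  then show ?case using Node.IH[OF ts(1) lv Node.prems(3)] by simp
next
  case (Cons s Ss qs)
  let ?q = "take (leaves s) qs" and ?r = "drop (leaves s) qs"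
  have sub: "set ?q \<subseteq> set qs" "set ?r \<subseteq> set qs" by (simp_all add: set_take_subset set_drop_subset)
  have "length (concat (map l ?q)) = sum_list (map leaves (map T ?q))"
  proof -
    have "\<forall>q\<in>set ?q. length (l q) = leaves (T q)" using Cons.prems(3) sub(1) by blast
    then show ?thesis by (simp add: length_concat o_def cong: map_cong)
  qed
  also have "\<dots> = leaves (tval mk_node s (map T ?q))"
    using Cons.prems(2) by (simp add: leaves_tval(1))
  finally have len: "length (concat (map l ?q)) = leaves (tval mk_node s (map T ?q))" .
  have eq: "concat (map l qs) = concat (map l ?q) @ concat (map l ?r)"
    by (metis append_take_drop_id concat_append map_append)
  have 1: "tval F (tval mk_node s (map T ?q)) (concat (map l ?q)) =
      tval F s (map (\<lambda>q. tval F (T q) (l q)) ?q)"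
    using Cons.prems sub by (intro Cons.IH(1)) auto
  have 2: "tvals F (tvals mk_node Ss (map T ?r)) (concat (map l ?r)) =
      tvals F Ss (map (\<lambda>q. tval F (T q) (l q)) ?r)"
    using Cons.prems sub by (intro Cons.IH(2)) auto
  show ?case using 1 2 len by (simp add: take_map drop_map eq)
qed simp_all

end

section \<open>Iterated associators\<close>

lemma enat_less_add_1: "enat k < n + 1 \<longleftrightarrow> enat k \<le> n"
  by (cases n) (simp_all add: one_enat_def less_Suc_eq_le)

lemma power_cat_simps [simp]:
  "Obj (power_cat C k) = {xs. length xs = k \<and> set xs \<subseteq> Obj C}"
  "Arr (power_cat C k) = {fs. length fs = k \<and> set fs \<subseteq> Arr C}"
  "Src (power_cat C k) = map (Src C)" "Tgt (power_cat C k) = map (Tgt C)"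
  "Idt (power_cat C k) = map (Idt C)" "Cmp (power_cat C k) = map2 (Cmp C)"
  by (simp_all add: power_cat_def)

section \<open>Typed arrows and lists of arrows\<close>

context category begin

abbreviation comp (infixr "\<bullet>" 55) where "g \<bullet> f \<equiv> Cmp C g f"

abbreviation ids where "ids xs \<equiv> map (Idt C) xs"

definition hom where "hom f x y \<longleftrightarrow> f \<in> Arr C \<and> Src C f = x \<and> Tgt C f = y"

definition homs where "homs fs xs ys \<longleftrightarrow> list_all2 (\<lambda>f (x, y). hom f x y) fs (zip xs ys) \<and> length xs = length ys"

lemma hom_Obj: "hom f x y \<Longrightarrow> x \<in> Obj C" "hom f x y \<Longrightarrow> y \<in> Obj C"
  using Src_Obj Tgt_Obj by (auto simp: hom_def)

lemma hom_Idt [intro]: "x \<in> Obj C \<Longrightarrow> hom (Idt C x) x x"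
  by (simp add: hom_def Idt_Arr Src_Idt Tgt_Idt)

lemma hom_comp [intro]: "hom f x y \<Longrightarrow> hom g y z \<Longrightarrow> hom (g \<bullet> f) x z"
  by (simp add: hom_def Cmp_Arr Src_Cmp Tgt_Cmp)

lemma comp_assoc: "hom f w x \<Longrightarrow> hom g x y \<Longrightarrow> hom h y z \<Longrightarrow> (h \<bullet> g) \<bullet> f = h \<bullet> g \<bullet> f"
  by (simp add: hom_def Cmp_assoc)

lemma comp_Idt: "hom f x y \<Longrightarrow> f \<bullet> Idt C x = f" "hom f x y \<Longrightarrow> Idt C y \<bullet> f = f"
  using Cmp_Idt_left Cmp_Idt_right by (auto simp: hom_def)

lemma homs_Nil [simp]: "homs [] [] []"
  by (simp add: homs_def)

lemma homs_Cons [simp]: "homs (f # fs) (x # xs) (y # ys) \<longleftrightarrow> hom f x y \<and> homs fs xs ys"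
  by (auto simp: homs_def)

lemma homs_iff: "homs fs xs ys \<longleftrightarrow> set fs \<subseteq> Arr C \<and> map (Src C) fs = xs \<and> map (Tgt C) fs = ys"
proof (induction fs arbitrary: xs ys)
  case Nil then show ?case by (auto simp: homs_def)
next
  case (Cons f fs)
  have "homs (f # fs) xs ys \<longleftrightarrow>
      (\<exists>x xs' y ys'. xs = x # xs' \<and> ys = y # ys' \<and> hom f x y \<and> homs fs xs' ys')"
    by (cases xs; cases ys) (auto simp: homs_def)
  then show ?case by (auto simp: Cons.IH hom_def)
qed

lemma homs_append: "homs fs xs ys \<Longrightarrow> homs gs us vs \<Longrightarrow> homs (fs @ gs) (xs @ us) (ys @ vs)"
  by (auto simp: homs_iff)

lemma homs_ids: "set xs \<subseteq> Obj C \<Longrightarrow> homs (ids xs) xs xs"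
  by (induction xs) auto

lemma homs_map: "\<forall>p\<in>set ps. hom (f p) (x p) (y p) \<Longrightarrow> homs (map f ps) (map x ps) (map y ps)"
  by (induction ps) auto

lemma homs_length: "homs fs xs ys \<Longrightarrow> length xs = length fs \<and> length ys = length fs"
  by (auto simp: homs_iff)

lemma homs_Obj: "homs fs xs ys \<Longrightarrow> set xs \<subseteq> Obj C \<and> set ys \<subseteq> Obj C"
proof (induction fs arbitrary: xs ys)
  case (Cons f fs)
  then show ?case by (cases xs; cases ys) (auto simp: homs_iff intro: Src_Obj Tgt_Obj)
qed (simp add: homs_iff)

lemma homs_comp:
  assumes "homs fs xs ys" "homs gs ys zs"
  shows "homs (map2 comp gs fs) xs zs"
proof -
  have "length fs = length ys" "length gs = length ys" using assms by (auto dest: homs_length)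
  then show ?thesis using assms
  proof (induction fs arbitrary: xs ys gs zs)
    case (Cons f fs)
    then obtain x xs' y ys' g gs' z zs' where
      eq: "xs = x # xs'" "ys = y # ys'" "gs = g # gs'" "zs = z # zs'"
      by (cases xs; cases ys; cases gs; cases zs) (auto simp: homs_iff)
    then show ?case using Cons by auto
  qed (auto simp: homs_iff)
qed

lemma map2_ids_left: "homs fs xs ys \<Longrightarrow> map2 comp (ids ys) fs = fs"
  by (induction fs arbitrary: xs ys) (auto simp: homs_iff Cmp_Idt_left)

lemma map2_ids_right: "homs fs xs ys \<Longrightarrow> map2 comp fs (ids xs) = fs"
  by (induction fs arbitrary: xs ys) (auto simp: homs_iff Cmp_Idt_right)

end

section \<open>The axioms of an A_n-monoidal category in terms of lists\<close>

locale monoidal = category C + A_monoidal n C \<mu> \<alpha>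
  for n :: enat and C :: "('o, 'm) cat"
    and \<mu> :: "nat \<Rightarrow> ('o list, 'm list, 'o, 'm) ftor"
    and \<alpha> :: "nat \<Rightarrow> nat \<Rightarrow> nat \<Rightarrow> 'o list \<Rightarrow> 'm"
begin

definition M where "M xs = omap (\<mu> (length xs)) xs"
definition Mf where "Mf fs = amap (\<mu> (length fs)) fs"
text \<open>The three indices are the lengths of the arguments, so that the axioms become statements
  about lists alone.\<close>

definition al where "al as bs cs = \<alpha> (length as) (length bs) (length cs) (as @ bs @ cs)"
definition bnd where "bnd k \<longleftrightarrow> enat k \<le> n"

abbreviation ob where "ob xs \<equiv> set xs \<subseteq> Obj C"

lemma bnd_mono: "bnd k \<Longrightarrow> j \<le> k \<Longrightarrow> bnd j"
  unfolding bnd_def by (meson enat_ord_simps(1) order_trans)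

lemma range_iff: "assoc_range n i j k \<longleftrightarrow> bnd (i + j + k) \<and> bnd (i + 1 + k)"
  unfolding assoc_range_def bnd_def enat_less_add_1 ..

lemma functor_M: "bnd k \<Longrightarrow> is_functor (power_cat C k) C (\<mu> k)"
  using mult_functor unfolding bnd_def enat_less_add_1 .

lemma M_Obj: "ob xs \<Longrightarrow> bnd (length xs) \<Longrightarrow> M xs \<in> Obj C"
  using is_functor.omap_Obj[OF functor_M, of "length xs" xs] by (simp add: M_def)

lemma hom_Mf: "homs fs xs ys \<Longrightarrow> bnd (length fs) \<Longrightarrow> hom (Mf fs) (M xs) (M ys)"
  using functor_M[of "length fs"]
  by (auto simp: hom_def homs_iff M_def Mf_def is_functor.Src_amap is_functor.Tgt_amap
      is_functor.amap_Arr)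

lemma Mf_comp:
  assumes "homs fs xs ys" "homs gs ys zs" "bnd (length fs)"
  shows "Mf gs \<bullet> Mf fs = Mf (map2 comp gs fs)"
proof -
  have "length gs = length fs" using assms by (auto dest!: homs_length)
  then show ?thesis
    using is_functor.amap_Cmp[OF functor_M, of "length fs" fs gs] assms
    by (auto simp: Mf_def homs_iff)
qed

lemma Mf_ids: "ob xs \<Longrightarrow> bnd (length xs) \<Longrightarrow> Mf (ids xs) = Idt C (M xs)"
  using is_functor.amap_Idt[OF functor_M, of "length xs" xs] by (simp add: M_def Mf_def)

lemma M_single: "x \<in> Obj C \<Longrightarrow> M [x] = x"
  using mult_1_obj by (simp add: M_def)

lemma Mf_single: "f \<in> Arr C \<Longrightarrow> Mf [f] = f"
  using mult_1_arr by (simp add: Mf_def)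

lemma bnd_0: "bnd 0" by (simp add: bnd_def zero_enat_def[symmetric])

lemma M_Nil_Obj: "M [] \<in> Obj C"
  by (rule M_Obj) (simp_all add: bnd_0)

lemma Mf_Nil: "Mf [] = Idt C (M [])"
  using Mf_ids[of "[]"] by (simp add: bnd_0)

lemma nary_M: "nary n (Obj C) M"
proof
  fix xs ys assume "set (xs @ ys) \<subseteq> Obj C" "enat (length (xs @ M [] # ys)) \<le> n"
  then show "M (xs @ M [] # ys) = M (xs @ ys)"
    using strict_unit_obj[of "length xs" "length ys" "length (xs @ M [] # ys)" xs ys]
    by (simp add: M_def enat_less_add_1)
qed (simp_all add: M_Obj bnd_def M_single)

lemma nary_Mf: "nary n (Arr C) Mf"
proof
  fix xs ys assume "set (xs @ ys) \<subseteq> Arr C" "enat (length (xs @ Mf [] # ys)) \<le> n"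
  then show "Mf (xs @ Mf [] # ys) = Mf (xs @ ys)"
    using strict_unit_arr[of "length xs" "length ys" "length (xs @ Mf [] # ys)" xs ys]
    unfolding Mf_Nil by (simp add: M_def Mf_def enat_less_add_1)
next
  fix xs assume "set xs \<subseteq> Arr C" "enat (length xs) \<le> n"
  then show "Mf xs \<in> Arr C" using hom_Mf[of xs] by (simp add: homs_iff bnd_def hom_def)
qed (simp_all add: Mf_single)

lemma hom_al:
  assumes "ob (as @ bs @ cs)" "bnd (length as + length bs + length cs)"
    "bnd (length as + 1 + length cs)"
  shows "hom (al as bs cs) (M (as @ M bs # cs)) (M (as @ bs @ cs))"
proof -
  interpret nat_transf "power_cat C (length as + length bs + length cs)" C
    "functor_comp (\<mu> (length as + 1 + length cs)) (whisker (length as) (length bs) (\<mu> (length bs)))"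
    "\<mu> (length as + length bs + length cs)" "\<alpha> (length as) (length bs) (length cs)"
    using assms by (intro assoc_natural) (simp add: range_iff)
  have x: "as @ bs @ cs \<in> Obj (power_cat C (length as + length bs + length cs))"
    using assms(1) by simp
  show ?thesis
    using component_Arr[OF x] Src_component[OF x] Tgt_component[OF x]
    by (simp add: hom_def al_def M_def functor_comp_def whisker_def add.assoc)
qed

lemma al_nat:
  assumes "homs fs as as'" "homs gs bs bs'" "homs hs cs cs'"
    "bnd (length as + length bs + length cs)" "bnd (length as + 1 + length cs)"
  shows "al as' bs' cs' \<bullet> Mf (fs @ Mf gs # hs) = Mf (fs @ gs @ hs) \<bullet> al as bs cs"
proof -
  interpret nat_transf "power_cat C (length as + length bs + length cs)" C
    "functor_comp (\<mu> (length as + 1 + length cs)) (whisker (length as) (length bs) (\<mu> (length bs)))"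
    "\<mu> (length as + length bs + length cs)" "\<alpha> (length as) (length bs) (length cs)"
    using assms by (intro assoc_natural) (simp add: range_iff)
  have l: "length fs = length as" "length gs = length bs" "length hs = length cs"
    "length as' = length as" "length bs' = length bs" "length cs' = length cs"
    using assms by (auto dest!: homs_length)
  have x: "fs @ gs @ hs \<in> Arr (power_cat C (length as + length bs + length cs))"
    using assms(1-3) by (auto simp: homs_iff)
  have "map (Src C) (fs @ gs @ hs) = as @ bs @ cs" "map (Tgt C) (fs @ gs @ hs) = as' @ bs' @ cs'"
    using assms(1-3) by (auto simp: homs_iff)
  then show ?thesis using naturality[OF x] l
    by (simp add: al_def Mf_def functor_comp_def whisker_def add.assoc)
qed

lemma al_Nil: "ob (as @ cs) \<Longrightarrow> bnd (length as + 1 + length cs) \<Longrightarrow>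
    al as [] cs = Idt C (M (as @ cs))"
  using assoc_id_0[of "length as" "length cs" "as @ cs"] bnd_mono[of "length as + 1 + length cs" "length as + length cs"]
  by (simp add: al_def M_def range_iff)

lemma al_single: "ob (as @ b # cs) \<Longrightarrow> bnd (length as + 1 + length cs) \<Longrightarrow>
    al as [b] cs = Idt C (M (as @ b # cs))"
  using assoc_id_1[of "length as" "length cs" "as @ b # cs"] by (simp add: al_def M_def range_iff)

lemma al_outer: "ob bs \<Longrightarrow> bnd (length bs) \<Longrightarrow> bnd 1 \<Longrightarrow> al [] bs [] = Idt C (M bs)"
  using assoc_id_outer[of "length bs" bs] by (simp add: al_def M_def range_iff)

lemma al_parallel:
  assumes "ob (as @ bs @ cs @ ds @ es)"
    "bnd (length as + length bs + length cs + length ds + length es)"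
    "bnd (length as + length bs + length cs + 1 + length es)"
    "bnd (length as + 1 + length cs + length ds + length es)"
    "bnd (length as + 1 + length cs + 1 + length es)"
  shows "al (as @ bs @ cs) ds es \<bullet> al as bs (cs @ M ds # es) =
    al as bs (cs @ ds @ es) \<bullet> al (as @ M bs # cs) ds es"
  using assoc_parallel[of "length as" "length bs" "length cs" "length ds" "length es" as bs cs ds es] assms
  by (simp add: al_def M_def range_iff add.assoc)

lemma al_nested:
  assumes "ob (as @ bs @ cs @ ds @ es)"
    "bnd (length as + length bs + length cs + length ds + length es)"
    "bnd (length as + 1 + length es)"
    "bnd (length as + length bs + 1 + length ds + length es)"
    "bnd (length bs + 1 + length ds)" "bnd (length bs + length cs + length ds)"
  shows "al as (bs @ cs @ ds) es \<bullet> Mf (ids as @ al bs cs ds # ids es) =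
    al (as @ bs) cs (ds @ es) \<bullet> al as (bs @ M cs # ds) es"
  using assoc_nested[of "length as" "length bs" "length cs" "length ds" "length es" as bs cs ds es] assms
  by (simp add: al_def M_def Mf_def range_iff add.assoc)

lemma al_drops_left:
  assumes "drops (M []) as as'" "ob (as @ bs @ cs)" "bnd (length as + length bs + length cs)"
    "bnd (length as + 1 + length cs)"
  shows "al as bs cs = al as' bs cs"
  using assms
proof (induction rule: drops_induct_step)
  case (insert us vs ws)
  have b: "bnd (length (us @ vs) + length bs + length cs)" "bnd (length (us @ vs) + 1 + length cs)"
    using insert.prems by (auto elim!: bnd_mono)
  show ?case
    using insert assoc_unit_left[of "length us" "length vs" "length bs" "length cs" us vs bs cs] b
    by (simp add: al_def M_def range_iff)
qed simp

lemma al_drops_mid: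
  assumes "drops (M []) bs bs'" "ob (as @ bs @ cs)" "bnd (length as + length bs + length cs)"
    "bnd (length as + 1 + length cs)"
  shows "al as bs cs = al as bs' cs"
  using assms
proof (induction rule: drops_induct_step)
  case (insert us vs ws)
  have b: "bnd (length as + length (us @ vs) + length cs)"
    using insert.prems by (auto elim!: bnd_mono)
  show ?case
    using insert assoc_unit_middle[of "length as" "length us" "length vs" "length cs" as us vs cs] b
    by (simp add: al_def M_def range_iff add.assoc)
qed simp

lemma al_drops_right:
  assumes "drops (M []) cs cs'" "ob (as @ bs @ cs)" "bnd (length as + length bs + length cs)"
    "bnd (length as + 1 + length cs)"
  shows "al as bs cs = al as bs cs'"
  using assms
proof (induction rule: drops_induct_step)
  case (insert us vs ws)
  have b: "bnd (length as + length bs + length (us @ vs))" "bnd (length as + 1 + length (us @ vs))"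
    using insert.prems by (auto elim!: bnd_mono)
  show ?case
    using insert assoc_unit_right[of "length as" "length bs" "length us" "length vs" as bs us vs] b
    by (simp add: al_def M_def range_iff)
qed simp

text \<open>Axioms (ii)-(iv) delete one unit in one argument. Iterated and combined, they show that
  the associator depends on its arguments only up to deletion of units; the range conditions persist
  because deletion shortens lists.\<close>

lemma al_drops:
  assumes "drops (M []) as as'" "drops (M []) bs bs'" "drops (M []) cs cs'"
    "ob (as @ bs @ cs)" "bnd (length as + length bs + length cs)" "bnd (length as + 1 + length cs)"
  shows "al as bs cs = al as' bs' cs'"
proof -
  have l: "length as' \<le> length as" "length bs' \<le> length bs"
    using assms by (auto dest: drops_length)
  have s: "set as' \<subseteq> set as" "set bs' \<subseteq> set bs" using assms by (simp_all add: drops_set)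
  have "al as bs cs = al as' bs cs" using assms by (intro al_drops_left)
  also have "\<dots> = al as' bs' cs" using assms l s
    by (intro al_drops_mid) (auto intro: bnd_mono[OF assms(5)] bnd_mono[OF assms(6)])
  also have "\<dots> = al as' bs' cs'" using assms l s
    by (intro al_drops_right) (auto intro: bnd_mono[OF assms(5)] bnd_mono[OF assms(6)])
  finally show ?thesis .
qed

end

text \<open>The reason for excluding empty brackets: the number of brackets is then bounded by the
  number of letters, and so is every intermediate arity.\<close>

lemma length_le_concat: "\<forall>xs\<in>set xss. xs \<noteq> [] \<Longrightarrow> length xss \<le> length (concat xss)"
proof (induction xss)
  case (Cons xs xss)
  then show ?case by (cases xs) auto
qed simp

section \<open>Removal of inner brackets one at a time\<close>

context monoidal begin

text \<open>The inner brackets of \<open>M (pre @ map M xss @ post)\<close> are removed from left to right, and only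
  for nonempty members of \<open>xss\<close>: this keeps all intermediate arities within the bound \<open>n\<close>.\<close>

fun G :: "'o list \<Rightarrow> 'o list list \<Rightarrow> 'o list \<Rightarrow> 'm" where
  "G pre [] post = Idt C (M (pre @ post))"
| "G pre (xs # xss) post = G (pre @ xs) xss post \<bullet> al pre xs (map M xss @ post)"

text \<open>Only the final length is bounded. Since the members of \<open>xss\<close> are nonempty,
  every list in which some brackets are still closed is at most as long.\<close>

definition gok where
  "gok pre xss post \<longleftrightarrow> ob pre \<and> ob post \<and> (\<forall>xs\<in>set xss. xs \<noteq> [] \<and> ob xs) \<and>
    bnd (length pre + length (concat xss) + length post)"

lemma gok_Nil: "gok pre [] post \<longleftrightarrow> ob pre \<and> ob post \<and> bnd (length pre + length post)"
  by (simp add: gok_def)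

lemma gok_Cons: "gok pre (xs # xss) post \<longleftrightarrow> xs \<noteq> [] \<and> ob xs \<and> ob pre \<and> gok (pre @ xs) xss post"
  by (auto simp: gok_def add.assoc)

lemma gok_bnd: "gok pre xss post \<Longrightarrow> k \<le> length pre + length (concat xss) + length post \<Longrightarrow> bnd k"
  using bnd_mono by (auto simp: gok_def)

lemma gok_length: "gok pre xss post \<Longrightarrow> length xss \<le> length (concat xss)"
  by (auto simp: gok_def intro!: length_le_concat)

lemma gok_M: "gok pre xss post \<Longrightarrow> ob (map M xss)"
proof (induction xss arbitrary: pre)
  case (Cons xs xss)
  have "bnd (length xs)" using Cons.prems by (rule gok_bnd) simp
  moreover have "gok (pre @ xs) xss post" "ob xs" using Cons.prems by (simp_all add: gok_Cons)
  ultimately show ?case using Cons.IH[of "pre @ xs"] by (simp add: M_Obj)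
qed simp

lemma gok_ob: "gok pre xss post \<Longrightarrow> ob pre \<and> ob post \<and> ob (concat xss)"
  by (auto simp: gok_def)

lemma gok_al:
  assumes "gok pre (xs # xss) post"
  shows "hom (al pre xs (map M xss @ post)) (M (pre @ map M (xs # xss) @ post))
    (M ((pre @ xs) @ map M xss @ post))"
proof -
  have 1: "gok (pre @ xs) xss post" "xs \<noteq> []" "ob xs" "ob pre" using assms by (auto simp: gok_Cons)
  have 2: "length xss \<le> length (concat xss)" "1 \<le> length xs"
    using gok_length[OF 1(1)] 1(2) by (auto simp: Suc_le_eq)
  show ?thesis
    using hom_al[of pre xs "map M xss @ post"] 1 2 gok_M[OF 1(1)] gok_ob[OF 1(1)]
      gok_bnd[OF assms, of "length pre + length xs + (length xss + length post)"]
      gok_bnd[OF assms, of "length pre + 1 + (length xss + length post)"]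
    by simp
qed

lemma hom_G: "gok pre xss post \<Longrightarrow> hom (G pre xss post) (M (pre @ map M xss @ post)) (M (pre @ concat xss @ post))"
proof (induction xss arbitrary: pre)
  case Nil then show ?case by (auto simp: gok_Nil intro!: hom_Idt M_Obj)
next
  case (Cons xs xss)
  have "hom (G (pre @ xs) xss post) (M ((pre @ xs) @ map M xss @ post)) (M ((pre @ xs) @ concat xss @ post))"
    using Cons by (simp add: gok_Cons del: append_assoc)
  from hom_comp[OF gok_al[OF Cons.prems] this] show ?case by simp
qed

lemma G_append:
  "gok pre (xss @ yss) post \<Longrightarrow>
    G pre (xss @ yss) post = G (pre @ concat xss) yss post \<bullet> G pre xss (map M yss @ post)"
proof (induction xss arbitrary: pre)
  case Nil
  then show ?case using hom_G[of pre yss post] by (simp add: comp_Idt)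
next
  case (Cons xs xss)
  have g: "gok (pre @ xs) (xss @ yss) post" using Cons.prems by (simp add: gok_Cons)
  have g2: "gok (pre @ xs @ concat xss) yss post" "gok (pre @ xs) xss (map M yss @ post)"
  proof -
    show "gok (pre @ xs @ concat xss) yss post" using g by (auto simp: gok_def add.assoc)
    then have "length yss \<le> length (concat yss)" "ob (map M yss)" by (rule gok_length, rule gok_M)
    then show "gok (pre @ xs) xss (map M yss @ post)" using g
      by (auto simp: gok_def add.assoc elim!: bnd_mono)
  qed
  have "hom (al pre xs (map M xss @ map M yss @ post)) (M (pre @ map M (xs # xss @ yss) @ post))
    (M ((pre @ xs) @ map M xss @ map M yss @ post))"
    using gok_al[of pre xs "xss @ yss" post] Cons.prems by simp
  then show ?case using Cons.IH[OF g] comp_assoc hom_G[OF g2(1)] hom_G[OF g2(2)]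
    by (simp add: comp_assoc)
qed

text \<open>Two commuting squares side by side. As \<open>G\<close> is a composite of associators,
  this is the inductive step of several of its commutation laws.\<close>

lemma paste:
  assumes "a1 \<bullet> a2 = a3 \<bullet> a4" "b \<bullet> a3 = c \<bullet> d"
    and "hom a2 w x" "hom a1 x y" "hom b y z" "hom a4 w x'" "hom a3 x' y" "hom d x' y'" "hom c y' z"
  shows "(b \<bullet> a1) \<bullet> a2 = c \<bullet> d \<bullet> a4"
proof -
  have "(b \<bullet> a1) \<bullet> a2 = b \<bullet> a3 \<bullet> a4" using comp_assoc[of a2 w x a1 y b z] assms by simp
  also have "\<dots> = (c \<bullet> d) \<bullet> a4" using comp_assoc[of a4 w x' a3 y b z] assms by simp
  also have "\<dots> = c \<bullet> d \<bullet> a4" using comp_assoc[of a4 w x' d y' c z] assms by simp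
  finally show ?thesis .
qed

text \<open>Axiom (v) iterated over \<open>xss\<close>: opening the bracket around \<open>bs\<close>
  commutes with opening all the brackets further right.\<close>

lemma al_G:
  assumes "gok (as @ bs @ cs) xss post" "bs \<noteq> []"
    "bnd (length as + 1 + length cs + length (concat xss) + length post)"
  shows "G (as @ bs @ cs) xss post \<bullet> al as bs (cs @ map M xss @ post) =
    al as bs (cs @ concat xss @ post) \<bullet> G (as @ M bs # cs) xss post"
  using assms
proof (induction xss arbitrary: cs)
  case Nil
  have l: "1 \<le> length bs" using Nil by (simp add: Suc_le_eq)
  have "hom (al as bs (cs @ post)) (M (as @ M bs # cs @ post)) (M (as @ bs @ cs @ post))"
    using hom_al[of as bs "cs @ post"] l Nil
      gok_bnd[OF Nil.prems(1), of "length as + length bs + (length cs + length post)"]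
      gok_bnd[OF Nil.prems(1), of "length as + 1 + (length cs + length post)"]
    by (auto simp: gok_Nil)
  then show ?case by (simp add: comp_Idt)
next
  case (Cons xs xss)
  have g: "gok (as @ bs @ cs @ xs) xss post" and xs: "xs \<noteq> []" "ob xs"
    using Cons.prems by (auto simp: gok_Cons)
  have ob: "ob as" "ob bs" "ob cs" "ob post" "ob (concat xss)" "ob (map M xss)"
    using gok_ob[OF g] gok_M[OF g] by auto
  have l: "1 \<le> length bs" "1 \<le> length xs" "length xss \<le> length (concat xss)"
    using Cons.prems xs gok_length[OF g] by (auto simp: Suc_le_eq)
  let ?B = "length as + length bs + length cs + length xs + length (concat xss) + length post"
  have B: "bnd k" if "k \<le> ?B" for k
    using gok_bnd[OF Cons.prems(1), of k] that by simp
  have Mo: "M bs \<in> Obj C" "M xs \<in> Obj C" using ob xs by (auto intro!: M_Obj B)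
  have g1: "gok (as @ M bs # cs @ xs) xss post"
    using g ob xs Mo l by (auto simp: gok_def add.assoc intro!: B)
  have 1: "al (as @ bs @ cs) xs (map M xss @ post) \<bullet> al as bs (cs @ M xs # map M xss @ post) =
      al as bs (cs @ xs @ map M xss @ post) \<bullet> al (as @ M bs # cs) xs (map M xss @ post)"
    using ob xs l by (intro al_parallel) (auto intro!: B)
  have 2: "G (as @ bs @ cs @ xs) xss post \<bullet> al as bs (cs @ xs @ map M xss @ post) =
      al as bs (cs @ xs @ concat xss @ post) \<bullet> G (as @ M bs # cs @ xs) xss post"
    using Cons.IH[of "cs @ xs"] g Cons.prems l by (auto simp: add.assoc intro!: B)
  have "hom (al as bs (cs @ M xs # map M xss @ post)) (M (as @ M bs # cs @ M xs # map M xss @ post))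
      (M (as @ bs @ cs @ M xs # map M xss @ post))"
    using ob Mo l by (intro hom_al) (auto intro!: B)
  moreover have "hom (al (as @ bs @ cs) xs (map M xss @ post))
      (M (as @ bs @ cs @ M xs # map M xss @ post)) (M (as @ bs @ cs @ xs @ map M xss @ post))"
    using hom_al[of "as @ bs @ cs" xs "map M xss @ post"] ob xs l B by simp
  moreover have "hom (al (as @ M bs # cs) xs (map M xss @ post))
      (M (as @ M bs # cs @ M xs # map M xss @ post)) (M (as @ M bs # cs @ xs @ map M xss @ post))"
    using hom_al[of "as @ M bs # cs" xs "map M xss @ post"] ob xs l Mo B by simp
  moreover have "hom (al as bs (cs @ xs @ map M xss @ post))
      (M (as @ M bs # cs @ xs @ map M xss @ post)) (M (as @ bs @ cs @ xs @ map M xss @ post))"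
    using ob xs l by (intro hom_al) (auto intro!: B)
  moreover have "hom (al as bs (cs @ xs @ concat xss @ post))
      (M (as @ M bs # cs @ xs @ concat xss @ post)) (M (as @ bs @ cs @ xs @ concat xss @ post))"
    using ob xs l by (intro hom_al) (auto intro!: B)
  ultimately show ?case
    using paste[OF 1 2] hom_G[OF g] hom_G[OF g1] by simp
qed

text \<open>Disjoint families of brackets can be opened in either order. Induction on the left
  family moves its brackets one by one past the right family, using \<open>al_G\<close>.\<close>

lemma G_interchange:
  assumes "gok (pre @ concat yss) zss post" "gok pre yss []"
  shows "G (pre @ concat yss) zss post \<bullet> G pre yss (map M zss @ post) =
    G pre yss (concat zss @ post) \<bullet> G (pre @ map M yss) zss post"
  using assms
proof (induction yss arbitrary: pre)
  case Nil
  then show ?case using hom_G[of pre zss post] by (auto simp: comp_Idt)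
next
  case (Cons y yss)
  have g: "gok (pre @ y @ concat yss) zss post" "gok (pre @ y) yss []" and y: "y \<noteq> []" "ob y" "ob pre"
    using Cons.prems by (auto simp: gok_Cons)
  have ob: "ob pre" "ob post" "ob (concat yss)" "ob (map M yss)" "ob (concat zss)" "ob (map M zss)"
    using y gok_ob[OF g(1)] gok_M[OF g(1)] gok_ob[OF g(2)] gok_M[OF g(2)] by auto
  have l: "1 \<le> length y" "length yss \<le> length (concat yss)" "length zss \<le> length (concat zss)"
    using y gok_length[OF g(1)] gok_length[OF g(2)] by (auto simp: Suc_le_eq)
  let ?B = "length pre + length y + length (concat yss) + length (concat zss) + length post"
  have B: "bnd k" if "k \<le> ?B" for k
    using gok_bnd[OF g(1), of k] that by simp
  have Mo: "M y \<in> Obj C" using y by (auto intro!: M_Obj B)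
  have ne: "\<forall>xs\<in>set zss. xs \<noteq> [] \<and> ob xs" "\<forall>xs\<in>set yss. xs \<noteq> [] \<and> ob xs"
    using g by (simp_all add: gok_def)
  have gs: "gok (pre @ y) yss (map M zss @ post)" "gok (pre @ y) yss (concat zss @ post)"
    "gok (pre @ y @ map M yss) zss post" "gok (pre @ M y # map M yss) zss post"
    using ob y l Mo ne by (auto simp: gok_def intro!: B)
  have 1: "G (pre @ y @ map M yss) zss post \<bullet> al pre y (map M yss @ map M zss @ post) =
     al pre y (map M yss @ concat zss @ post) \<bullet> G (pre @ M y # map M yss) zss post"
    using l y gs by (intro al_G) (auto intro!: B)
  have 2: "G (pre @ y @ concat yss) zss post \<bullet> G (pre @ y) yss (map M zss @ post) =
      G (pre @ y) yss (concat zss @ post) \<bullet> G (pre @ y @ map M yss) zss post"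
    using Cons.IH[of "pre @ y"] g by simp
  have h1: "hom (al pre y (map M yss @ map M zss @ post)) (M (pre @ M y # map M yss @ map M zss @ post))
      (M (pre @ y @ map M yss @ map M zss @ post))"
    using ob y l by (intro hom_al) (auto intro!: B)
  have h2: "hom (al pre y (map M yss @ concat zss @ post)) (M (pre @ M y # map M yss @ concat zss @ post))
      (M (pre @ y @ map M yss @ concat zss @ post))"
    using ob y l by (intro hom_al) (auto intro!: B)
  have hs: "hom (G (pre @ y) yss (map M zss @ post)) (M (pre @ y @ map M yss @ map M zss @ post))
      (M (pre @ y @ concat yss @ map M zss @ post))"
    "hom (G (pre @ y) yss (concat zss @ post)) (M (pre @ y @ map M yss @ concat zss @ post))
      (M (pre @ y @ concat yss @ concat zss @ post))"
    "hom (G (pre @ y @ map M yss) zss post) (M (pre @ y @ map M yss @ map M zss @ post))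
      (M (pre @ y @ map M yss @ concat zss @ post))"
    "hom (G (pre @ M y # map M yss) zss post) (M (pre @ M y # map M yss @ map M zss @ post))
      (M (pre @ M y # map M yss @ concat zss @ post))"
    "hom (G (pre @ y @ concat yss) zss post) (M (pre @ y @ concat yss @ map M zss @ post))
      (M (pre @ y @ concat yss @ concat zss @ post))"
    using hom_G[OF gs(1)] hom_G[OF gs(2)] hom_G[OF gs(3)] hom_G[OF gs(4)] hom_G[OF g(1)] by simp_all
  let ?w = "G (pre @ y @ concat yss) zss post" and ?a = "al pre y (map M yss @ map M zss @ post)"
  have "?w \<bullet> G (pre @ y) yss (map M zss @ post) \<bullet> ?a = (?w \<bullet> G (pre @ y) yss (map M zss @ post)) \<bullet> ?a"
    by (rule comp_assoc[symmetric, OF h1 hs(1) hs(5)])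
  also have "\<dots> = G (pre @ y) yss (concat zss @ post) \<bullet> G (pre @ y @ map M yss) zss post \<bullet> ?a"
    unfolding 2 by (rule comp_assoc[OF h1 hs(3) hs(2)])
  also have "\<dots> = (G (pre @ y) yss (concat zss @ post) \<bullet> al pre y (map M yss @ concat zss @ post)) \<bullet>
      G (pre @ M y # map M yss) zss post"
    unfolding 1 by (rule comp_assoc[symmetric, OF hs(4) h2 hs(2)])
  finally show ?case by simp
qed

text \<open>Axiom (vi) iterated: opening an outer bracket and then the inner ones agrees with first
  opening the inner ones inside it. The accumulator \<open>p\<close> holds the letters of the outer
  bracket that are already free of inner brackets.\<close>

lemma G_nested:
  assumes "gok (pre @ p) yss post" "bnd (length pre + 1 + length post)"
  shows "G (pre @ p) yss post \<bullet> al pre (p @ map M yss) post =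
    al pre (p @ concat yss) post \<bullet> Mf (ids pre @ G p yss [] # ids post)"
  using assms
proof (induction yss arbitrary: p)
  case Nil
  have ob: "ob pre" "ob p" "ob post" using Nil by (auto simp: gok_Nil)
  have B: "bnd (length pre + length p + length post)" "bnd (length p)"
    using gok_bnd[OF Nil.prems(1)] by simp_all
  have "hom (al pre p post) (M (pre @ M p # post)) (M (pre @ p @ post))"
    using ob B Nil by (intro hom_al) auto
  moreover have "Mf (ids pre @ Idt C (M p) # ids post) = Idt C (M (pre @ M p # post))"
    using Mf_ids[of "pre @ M p # post"] ob B Nil M_Obj[of p] by simp
  ultimately show ?case by (simp add: comp_Idt)
next
  case (Cons y yss)
  have g: "gok (pre @ p @ y) yss post" and y: "y \<noteq> []" "ob y" "ob pre" "ob p"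
    using Cons.prems by (auto simp: gok_Cons)
  have ob: "ob post" "ob (concat yss)" "ob (map M yss)"
    using y gok_ob[OF g(1)] gok_M[OF g(1)] by auto
  have l: "1 \<le> length y" "length yss \<le> length (concat yss)"
    using y gok_length[OF g(1)] by (auto simp: Suc_le_eq)
  let ?B = "length pre + length p + length y + length (concat yss) + length post"
  have B: "bnd k" if "k \<le> ?B" for k
    using gok_bnd[OF g(1), of k] that by simp
  have Mo: "M y \<in> Obj C" "M (p @ y @ concat yss) \<in> Obj C" "M (p @ y @ map M yss) \<in> Obj C"
    "M (p @ M y # map M yss) \<in> Obj C"
  proof -
    show *: "M y \<in> Obj C" using y by (auto intro!: M_Obj B)
    show "M (p @ y @ concat yss) \<in> Obj C" "M (p @ y @ map M yss) \<in> Obj C"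
      "M (p @ M y # map M yss) \<in> Obj C"
      using y ob l * by (intro M_Obj B; simp)+
  qed
  have ne: "\<forall>xs\<in>set yss. xs \<noteq> [] \<and> ob xs" using g by (simp_all add: gok_def)
  have g2: "gok (p @ y) yss []" using ob y ne l by (auto simp: gok_def intro!: B)
  let ?f = "Mf (ids pre @ G (p @ y) yss [] # ids post)"
  let ?g = "Mf (ids pre @ al p y (map M yss) # ids post)"
  have 1: "al (pre @ p) y (map M yss @ post) \<bullet> al pre (p @ M y # map M yss) post =
      al pre (p @ y @ map M yss) post \<bullet> ?g"
    using y ob l Cons.prems(2) by (intro al_nested[symmetric]) (auto intro!: B)
  have 2: "G (pre @ p @ y) yss post \<bullet> al pre (p @ y @ map M yss) post =
      al pre (p @ y @ concat yss) post \<bullet> ?f"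
    using Cons.IH[of "p @ y"] g Cons.prems(2) by simp
  have h1: "hom (al p y (map M yss)) (M (p @ M y # map M yss)) (M (p @ y @ map M yss))"
    using y ob l by (intro hom_al) (auto intro!: B)
  have h2: "hom (G (p @ y) yss []) (M (p @ y @ map M yss)) (M (p @ y @ concat yss))"
    using hom_G[OF g2] by simp
  have hs1: "homs (ids pre @ al p y (map M yss) # ids post) (pre @ M (p @ M y # map M yss) # post)
      (pre @ M (p @ y @ map M yss) # post)"
    using h1 y ob by (intro homs_append) (simp_all add: homs_ids)
  have hs2: "homs (ids pre @ G (p @ y) yss [] # ids post) (pre @ M (p @ y @ map M yss) # post)
      (pre @ M (p @ y @ concat yss) # post)"
    using h2 y ob by (intro homs_append) (simp_all add: homs_ids)
  \<comment> \<open>Functoriality of the product merges the two steps that are carried out inside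
    the outer bracket.\<close>
  have fg: "?f \<bullet> ?g = Mf (ids pre @ (G (p @ y) yss [] \<bullet> al p y (map M yss)) # ids post)"
    using Mf_comp[OF hs1 hs2] Cons.prems(2) y ob
    by (simp add: map2_ids_left[OF homs_ids])
  have "hom ?g (M (pre @ M (p @ M y # map M yss) # post)) (M (pre @ M (p @ y @ map M yss) # post))"
    "hom ?f (M (pre @ M (p @ y @ map M yss) # post)) (M (pre @ M (p @ y @ concat yss) # post))"
    using hom_Mf[OF hs1] hom_Mf[OF hs2] Cons.prems(2) by simp_all
  moreover have "hom (al pre (p @ M y # map M yss) post) (M (pre @ M (p @ M y # map M yss) # post))
      (M (pre @ p @ M y # map M yss @ post))"
    using hom_al[of pre "p @ M y # map M yss" post] y ob l Mo Cons.prems(2) B by simp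
  moreover have "hom (al (pre @ p) y (map M yss @ post)) (M (pre @ p @ M y # map M yss @ post))
      (M (pre @ p @ y @ map M yss @ post))"
    using hom_al[of "pre @ p" y "map M yss @ post"] y ob l B by simp
  moreover have "hom (al pre (p @ y @ map M yss) post) (M (pre @ M (p @ y @ map M yss) # post))
      (M (pre @ p @ y @ map M yss @ post))"
    using hom_al[of pre "p @ y @ map M yss" post] y ob l Mo Cons.prems(2) B by simp
  moreover have "hom (al pre (p @ y @ concat yss) post) (M (pre @ M (p @ y @ concat yss) # post))
      (M (pre @ p @ y @ concat yss @ post))"
    using hom_al[of pre "p @ y @ concat yss" post] y ob l Mo Cons.prems(2) B by simp
  moreover have "hom (G (pre @ p @ y) yss post) (M (pre @ p @ y @ map M yss @ post))
      (M (pre @ p @ y @ concat yss @ post))"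
    using hom_G[OF g] by simp
  ultimately show ?case
    using paste[OF 1 2] fg by simp
qed

end

section \<open>The unbiased associator \<open>gamma\<close> and its laws\<close>

lemma concat_map_concat: "concat (map concat xsss) = concat (concat xsss)"
  by (induction xsss) auto

context monoidal begin

sublocale M: nary n "Obj C" M by (rule nary_M)
sublocale Mf: nary n "Arr C" Mf by (rule nary_Mf)

definition gamma where "gamma xss = G [] xss []"

lemmas cat_simps = hom_def Cmp_assoc[symmetric] Cmp_Arr Src_Cmp Tgt_Cmp

lemma homs_gamma:
  assumes "\<forall>xss\<in>set xsss. gok [] xss []"
  shows "homs (map gamma xsss) (map M (map (map M) xsss)) (map M (map concat xsss))"
  using assms by (induction xsss) (use hom_G[of "[]" _ "[]"] in \<open>auto simp: gamma_def\<close>)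

text \<open>The monad-like law of \<open>gamma\<close>, with a prefix \<open>pre\<close> for the
  induction on \<open>xsss\<close>. The head of \<open>xsss\<close> is an outer bracket with inner
  brackets, handled by \<open>G_nested\<close>; \<open>G_interchange\<close> moves it past the
  brackets on its right, and naturality of the associator past the morphisms \<open>gamma\<close> of
  the remaining members.\<close>

lemma G_assoc:
  assumes "gok pre (concat xsss) []" "\<forall>xss\<in>set xsss. xss \<noteq> []"
  shows "G pre (concat xsss) [] \<bullet> G pre (map (map M) xsss) [] =
    G pre (map concat xsss) [] \<bullet> Mf (ids pre @ map gamma xsss)"
  using assms
proof (induction xsss arbitrary: pre)
  case Nil
  then show ?case using Mf_ids[of pre] M_Obj[of pre] by (simp add: gok_Nil)
next
  case (Cons yss xsss)
  let ?c = "concat yss" and ?R1 = "map M (map (map M) xsss)" and ?R2 = "map M (map concat xsss)"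
  have g: "gok pre (yss @ concat xsss) []" and yss: "yss \<noteq> []" using Cons.prems by simp_all
  have nex: "\<forall>xss\<in>set xsss. xss \<noteq> []" using Cons.prems by simp
  have ne: "\<forall>xs\<in>set yss. xs \<noteq> [] \<and> ob xs" "\<forall>xss\<in>set xsss. \<forall>xs\<in>set xss. xs \<noteq> [] \<and> ob xs" "ob pre"
    using g by (auto simp: gok_def)
  let ?B = "length pre + length ?c + length (concat (concat xsss))"
  have B: "bnd k" if "k \<le> ?B" for k
    using gok_bnd[OF g, of k] that by simp
  have l1: "length yss \<le> length ?c" using ne by (auto intro!: length_le_concat)
  have l2: "length (concat xsss) \<le> length (concat (concat xsss))"
    using ne by (intro length_le_concat) auto
  have l3: "length xsss \<le> length (concat xsss)" using nex by (intro length_le_concat) auto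
  have l4: "1 \<le> length yss" using yss by (simp add: Suc_le_eq)
  have le: "length (concat (map concat xsss)) = length (concat (concat xsss))"
    "length (concat (map (map M) xsss)) = length (concat xsss)"
    by (simp_all add: concat_map_concat map_concat[symmetric])
  have gy: "gok [] yss []" using ne by (auto simp: gok_def intro!: B)
  have oM: "ob (map M yss)" by (rule gok_M[OF gy])
  have oc: "ob ?c" using gok_ob[OF gy] by simp
  have gx: "\<forall>xss\<in>set xsss. gok [] xss []"
  proof
    fix xss assume x: "xss \<in> set xsss"
    then obtain a b where "xsss = a @ xss # b" by (meson split_list)
    then have "length (concat xss) \<le> length (concat (concat xsss))" by simp
    then show "gok [] xss []" using ne(2) x by (auto simp: gok_def intro!: B)
  qed
  have g1: "gok (pre @ ?c) (concat xsss) []"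
    using ne oc by (auto simp: gok_def add.assoc intro!: B)
  have oR: "ob (map M (concat xsss))" by (rule gok_M[OF g1])
  have oMM: "\<forall>xs\<in>set (map (map M) xsss). xs \<noteq> [] \<and> ob xs" using nex oR by auto
  have g2: "gok (pre @ ?c) (map (map M) xsss) []" "gok (pre @ map M yss) (map (map M) xsss) []"
    using oMM ne oM oc l1 l2 unfolding gok_def le by (auto simp: le intro!: B)
  have oR1: "ob ?R1" by (rule gok_M[OF g2(1)])
  have "\<forall>xs\<in>set (map concat xsss). xs \<noteq> [] \<and> ob xs"
  proof -
    have "concat xss \<noteq> [] \<and> ob (concat xss)" if "xss \<in> set xsss" for xss
    proof -
      have "xss \<noteq> []" "\<forall>xs\<in>set xss. xs \<noteq> []" "\<forall>xs\<in>set xss. ob xs" using nex ne that by auto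
      then show ?thesis by (cases xss) auto
    qed
    then show ?thesis by simp
  qed
  then have g3: "gok (pre @ ?c) (map concat xsss) []"
    using ne oc unfolding gok_def le by (auto simp: le intro!: B)
  have oR2: "ob ?R2" by (rule gok_M[OF g3])
  have g4: "gok pre yss (map M (concat xsss))" "gok pre yss ?R1" "gok pre yss []"
    using ne oR oR1 l2 l3 by (auto simp: gok_def intro!: B)
  let ?u = "G (pre @ ?c) (concat xsss) []" and ?v = "G pre yss (map M (concat xsss))"
    and ?w = "G (pre @ map M yss) (map (map M) xsss) []" and ?a = "al pre (map M yss) ?R1"
    and ?w' = "G (pre @ ?c) (map (map M) xsss) []" and ?v' = "G pre yss ?R1"
    and ?g = "G (pre @ ?c) (map concat xsss) []" and ?m1 = "Mf (ids (pre @ ?c) @ map gamma xsss)"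
    and ?m2 = "Mf (ids pre @ gamma yss # ids ?R1)" and ?a1 = "al pre ?c ?R1" and ?a2 = "al pre ?c ?R2"
    and ?m3 = "Mf (ids pre @ Mf (ids ?c) # map gamma xsss)"
  have hs1: "homs (ids (pre @ ?c) @ map gamma xsss) ((pre @ ?c) @ ?R1) ((pre @ ?c) @ ?R2)"
    using ne oc gx by (intro homs_append homs_ids homs_gamma) auto
  have hs2: "homs (ids pre @ gamma yss # ids ?R1) (pre @ M (map M yss) # ?R1) (pre @ M ?c # ?R1)"
    using ne homs_ids[OF oR1] hom_G[OF gy] by (intro homs_append homs_ids) (simp_all add: gamma_def)
  have idc: "Mf (ids ?c) = Idt C (M ?c)" "M ?c \<in> Obj C"
    using oc by (auto intro!: Mf_ids M_Obj B)
  have hs3: "homs (ids pre @ Mf (ids ?c) # map gamma xsss) (pre @ M ?c # ?R1) (pre @ M ?c # ?R2)"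
    using ne homs_gamma[OF gx] idc by (intro homs_append homs_ids) (simp_all add: hom_Idt)
  have h: "hom ?u (M (pre @ ?c @ map M (concat xsss))) (M (pre @ ?c @ concat (concat xsss)))"
    "hom ?v (M (pre @ map M yss @ map M (concat xsss))) (M (pre @ ?c @ map M (concat xsss)))"
    "hom ?w (M (pre @ map M yss @ ?R1)) (M (pre @ map M yss @ map M (concat xsss)))"
    "hom ?w' (M (pre @ ?c @ ?R1)) (M (pre @ ?c @ map M (concat xsss)))"
    "hom ?v' (M (pre @ map M yss @ ?R1)) (M (pre @ ?c @ ?R1))"
    "hom ?g (M (pre @ ?c @ ?R2)) (M (pre @ ?c @ concat (concat xsss)))"
    "hom ?m1 (M (pre @ ?c @ ?R1)) (M (pre @ ?c @ ?R2))"
    "hom ?m2 (M (pre @ M (map M yss) # ?R1)) (M (pre @ M ?c # ?R1))"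
    "hom ?m3 (M (pre @ M ?c # ?R1)) (M (pre @ M ?c # ?R2))"
    using hom_G[OF g1] hom_G[OF g4(1)] hom_G[OF g2(2)] hom_G[OF g2(1)] hom_G[OF g4(2)] hom_G[OF g3]
      hom_Mf[OF hs1] hom_Mf[OF hs2] hom_Mf[OF hs3] l1 l2 l3 l4 B
    by (simp_all add: concat_map_concat map_concat[symmetric])
  have h': "hom ?a (M (pre @ M (map M yss) # ?R1)) (M (pre @ map M yss @ ?R1))"
    "hom ?a1 (M (pre @ M ?c # ?R1)) (M (pre @ ?c @ ?R1))"
    "hom ?a2 (M (pre @ M ?c # ?R2)) (M (pre @ ?c @ ?R2))"
    using ne oM oc oR1 oR2 l1 l2 l3 l4 by (intro hom_al; simp add: B)+
  have 1: "?w' \<bullet> ?v' = ?v \<bullet> ?w"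
    using G_interchange[OF g2(1) g4(3)] by (simp add: map_concat[symmetric])
  have 2: "?u \<bullet> ?w' = ?g \<bullet> ?m1" using Cons.IH[OF g1 nex] .
  have 3: "?v' \<bullet> ?a = ?a1 \<bullet> ?m2"
    using G_nested[of pre "[]" yss ?R1] g4(2) l1 l2 l3 l4 by (simp add: gamma_def B)
  have 4: "?a2 \<bullet> ?m3 = ?m1 \<bullet> ?a1"
    using al_nat[OF homs_ids homs_ids homs_gamma[OF gx], of pre ?c] ne oc l1 l2 l3 l4 by (simp add: B)
  have 5: "?m3 \<bullet> ?m2 = Mf (ids pre @ gamma yss # map gamma xsss)"
    using Mf_comp[OF hs2 hs3] l1 l2 l3 l4 ne oR1 hom_G[OF gy] map2_ids_right[OF homs_gamma[OF gx]]
    by (simp add: B map2_ids_left[OF homs_ids] idc gamma_def comp_Idt)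
  \<comment> \<open>The chain begins with all outer brackets opened before the inner ones and ends
    with the inner brackets opened first.\<close>
  have "(?u \<bullet> ?v) \<bullet> ?w \<bullet> ?a = ?u \<bullet> (?v \<bullet> ?w) \<bullet> ?a" using h h' by (simp add: cat_simps)
  also have "\<dots> = (?u \<bullet> ?w') \<bullet> ?v' \<bullet> ?a" unfolding 1[symmetric] using h h' by (simp add: cat_simps)
  also have "\<dots> = ?g \<bullet> (?m1 \<bullet> ?a1) \<bullet> ?m2" unfolding 2 3 using h h' by (simp add: cat_simps)
  also have "\<dots> = (?g \<bullet> ?a2) \<bullet> ?m3 \<bullet> ?m2" unfolding 4[symmetric] using h h' by (simp add: cat_simps)
  finally show ?case unfolding 5 using G_append[OF g] by simp
qed

lemma gamma_assoc:
  assumes "gok [] (concat xsss) []" "\<forall>xss\<in>set xsss. xss \<noteq> []"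
  shows "gamma (concat xsss) \<bullet> gamma (map (map M) xsss) = gamma (map concat xsss) \<bullet> Mf (map gamma xsss)"
  using G_assoc[OF assms] by (simp add: gamma_def)

text \<open>Obtained by pasting the naturality squares of the single associators. Indexing by
  \<open>Q\<close> makes the arrows, their sources and their targets functions of one index.\<close>

lemma G_nat:
  assumes "homs fp pre pre'" "homs fq post post'" "\<forall>q\<in>set Q. homs (f q) (x q) (y q)"
    "gok pre (map x Q) post"
  shows "G pre' (map y Q) post' \<bullet> Mf (fp @ map (\<lambda>q. Mf (f q)) Q @ fq) =
    Mf (fp @ concat (map f Q) @ fq) \<bullet> G pre (map x Q) post"
  using assms
proof (induction Q arbitrary: pre pre' fp)
  case Nil
  have "homs (fp @ fq) (pre @ post) (pre' @ post')" using Nil by (intro homs_append)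
  from hom_Mf[OF this] have "hom (Mf (fp @ fq)) (M (pre @ post)) (M (pre' @ post'))"
    using Nil by (simp add: gok_Nil homs_length)
  then show ?case by (simp add: comp_Idt)
next
  case (Cons q Q)
  let ?X = "map x Q" and ?Y = "map y Q"
  have fq: "homs (f q) (x q) (y q)" and Q: "\<forall>q\<in>set Q. homs (f q) (x q) (y q)" using Cons by auto
  have g: "gok (pre @ x q) ?X post" and x: "x q \<noteq> []" "ob (x q)" using Cons.prems by (auto simp: gok_Cons)
  have lQ: "length (concat (map x Q)) = length (concat (map f Q))"
      "length (concat (map y Q)) = length (concat (map f Q))"
    using Q by (induction Q) (auto simp: homs_length)
  \<comment> \<open>Lists of arrows have sources and targets of equal length, so the targets inherit
    the nonemptiness and the bound.\<close>
  have g': "gok (pre' @ y q) ?Y post'"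
  proof -
    have "\<forall>xs\<in>set ?Y. xs \<noteq> [] \<and> ob xs"
    proof clarsimp
      fix r assume "r \<in> set Q"
      then have "homs (f r) (x r) (y r)" "x r \<noteq> []" using Q g by (auto simp: gok_def)
      then show "y r \<noteq> [] \<and> ob (y r)" by (auto dest: homs_length homs_Obj)
    qed
    then show ?thesis using g Cons.prems(1,2) fq lQ homs_Obj[OF Cons.prems(1)] homs_Obj[OF Cons.prems(2)] homs_Obj[OF fq]
      by (auto simp: gok_def homs_length)
  qed
  have oM: "ob (map M ?X)" by (rule gok_M[OF g])
  have l: "1 \<le> length (x q)" "length Q \<le> length (concat (map x Q))"
    using x gok_length[OF g] by (auto simp: Suc_le_eq)
  let ?B = "length pre + length (x q) + length (concat (map x Q)) + length post"
  have B: "bnd k" if "k \<le> ?B" for k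
    using gok_bnd[OF g, of k] that by simp
  have len: "length fp = length pre" "length pre' = length pre" "length fq = length post" "length post' = length post"
     "length (f q) = length (x q)" "length (y q) = length (x q)"
    using homs_length Cons.prems(1,2) fq by auto
  have MfQ: "homs (map (\<lambda>q. Mf (f q)) Q) (map M ?X) (map M ?Y)"
  proof -
    have "\<forall>r\<in>set Q. hom (Mf (f r)) (M (x r)) (M (y r))"
    proof
      fix r assume r: "r \<in> set Q"
      then obtain a b where "Q = a @ r # b" by (meson split_list)
      then have "length (x r) \<le> length (concat (map x Q))" by simp
      moreover have "homs (f r) (x r) (y r)" using Q r by blast
      ultimately show "hom (Mf (f r)) (M (x r)) (M (y r))"
        by (intro hom_Mf) (auto simp: homs_length intro!: B dest: homs_length)
    qed
    then show ?thesis by (induction Q) auto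
  qed
  let ?fs = "map (\<lambda>q. Mf (f q)) Q @ fq"
  have hfs: "homs ?fs (map M ?X @ post) (map M ?Y @ post')" using MfQ Cons.prems(2) by (rule homs_append)
  have hq: "hom (Mf (f q)) (M (x q)) (M (y q))" using fq len by (intro hom_Mf) (auto intro!: B)
  have hc: "homs (Mf (f q) # ?fs) (M (x q) # map M ?X @ post) (M (y q) # map M ?Y @ post')"
    using hq hfs by simp
  have hm1: "hom (Mf (fp @ Mf (f q) # ?fs)) (M (pre @ M (x q) # map M ?X @ post))
      (M (pre' @ M (y q) # map M ?Y @ post'))"
    using hom_Mf[OF homs_append[OF Cons.prems(1) hc]] len l B by simp
  have hm2: "hom (Mf (fp @ f q @ ?fs)) (M (pre @ x q @ map M ?X @ post))
      (M (pre' @ y q @ map M ?Y @ post'))"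
    using hom_Mf[OF homs_append[OF Cons.prems(1) homs_append[OF fq hfs]]] len l B by simp
  have cf: "homs (concat (map f Q)) (concat ?X) (concat ?Y)"
    using Q by (induction Q) (auto intro!: homs_append)
  have hm3: "hom (Mf (fp @ f q @ concat (map f Q) @ fq)) (M (pre @ x q @ concat ?X @ post))
      (M (pre' @ y q @ concat ?Y @ post'))"
    using hom_Mf[OF homs_append[OF Cons.prems(1) homs_append[OF fq homs_append[OF cf Cons.prems(2)]]]]
      len l lQ B by simp
  have 1: "al pre' (y q) (map M ?Y @ post') \<bullet> Mf (fp @ Mf (f q) # ?fs) =
      Mf (fp @ f q @ ?fs) \<bullet> al pre (x q) (map M ?X @ post)"
    using Cons.prems(1) fq hfs l by (intro al_nat) (auto intro!: B)
  have 2: "G (pre' @ y q) ?Y post' \<bullet> Mf (fp @ f q @ ?fs) =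
      Mf (fp @ f q @ concat (map f Q) @ fq) \<bullet> G (pre @ x q) ?X post"
    using Cons.IH[OF homs_append[OF Cons.prems(1) fq] Cons.prems(2) Q g] by simp
  have g1: "gok pre (x q # ?X) post" "gok pre' (y q # ?Y) post'"
    using g g' x homs_Obj[OF fq] len homs_Obj[OF Cons.prems(1)] by (auto simp: gok_Cons)
  show ?case
    using paste[OF 1 2 hm1 _ _ _ _ _ _] gok_al[OF g1(1)] gok_al[OF g1(2)] hm2 hm3 hom_G[OF g] hom_G[OF g'] by simp
qed

text \<open>The unit law: by axiom (i), brackets around single objects are opened by
  identities.\<close>

lemma G_singles:
  "ob (pre @ xs @ post) \<Longrightarrow> bnd (length (pre @ xs @ post)) \<Longrightarrow>
    G pre (map (\<lambda>x. [x]) xs) post = Idt C (M (pre @ xs @ post))"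
proof (induction xs arbitrary: pre)
  case (Cons x xs)
  have "map M (map (\<lambda>x. [x]) xs) = xs" using Cons.prems(1) by (induction xs) (auto simp: M_single)
  moreover have "al pre [x] (xs @ post) = Idt C (M (pre @ x # xs @ post))"
    using Cons.prems by (intro al_single) auto
  moreover have "M (pre @ x # xs @ post) \<in> Obj C" using Cons.prems by (intro M_Obj) auto
  ultimately show ?case using Cons.IH[of "pre @ [x]"] Cons.prems comp_Idt(1)[OF hom_Idt]
    by (simp add: comp_def)
qed simp

text \<open>Units may disappear inside a bracket. A bracket from which everything disappears has to
  vanish itself, since \<open>G\<close> is only used with nonempty brackets.\<close>

inductive gdrops :: "'o list list \<Rightarrow> 'o list list \<Rightarrow> bool" where
  gdrops_Nil: "gdrops [] []"
| gdrops_keep: "drops (M []) xs ys \<Longrightarrow> ys \<noteq> [] \<Longrightarrow> gdrops xss yss \<Longrightarrow> gdrops (xs # xss) (ys # yss)"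
| gdrops_skip: "drops (M []) xs [] \<Longrightarrow> gdrops xss yss \<Longrightarrow> gdrops (xs # xss) yss"

lemma M_drops: "drops (M []) xs ys \<Longrightarrow> ob xs \<Longrightarrow> bnd (length xs) \<Longrightarrow> M xs = M ys"
  using M.drop_units by (simp add: bnd_def)

lemma gdrops_M: "gdrops xss yss \<Longrightarrow> \<forall>xs\<in>set xss. ob xs \<and> bnd (length xs) \<Longrightarrow> drops (M []) (map M xss) (map M yss)"
proof (induction rule: gdrops.induct)
  case (gdrops_keep xs ys xss yss)
  then show ?case using M_drops[of xs ys] by (simp add: drops_keep)
next
  case (gdrops_skip xs xss yss)
  then show ?case using M_drops[of xs "[]"] by (simp add: drops_skip)
qed (simp add: drops_Nil)

text \<open>Transports \<open>al_drops\<close> to composites of associators. A bracket consisting of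
  units only is opened by an identity: deleting the units leaves the associator with empty middle
  argument, to which axiom (i) applies.\<close>

lemma G_drops:
  assumes "gdrops xss yss" "drops (M []) pre pre'" "drops (M []) post post'" "gok pre xss post"
  shows "G pre xss post = G pre' yss post'"
  using assms
proof (induction arbitrary: pre pre' rule: gdrops.induct)
  case gdrops_Nil
  then show ?case using M_drops[OF drops_append[OF gdrops_Nil(1,2)]] by (simp add: gok_Nil)
next
  case (gdrops_keep xs ys xss yss)
  have g: "gok (pre @ xs) xss post" and xs: "xs \<noteq> []" "ob xs" "ob pre" using gdrops_keep.prems by (auto simp: gok_Cons)
  have l: "1 \<le> length xs" "length xss \<le> length (concat xss)"
    using xs gok_length[OF g] by (auto simp: Suc_le_eq)
  have B: "bnd k" if "k \<le> length pre + length xs + length (concat xss) + length post" for k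
    using gok_bnd[OF g, of k] that by simp
  have "\<forall>xs\<in>set xss. ob xs \<and> bnd (length xs)"
  proof
    fix xs assume "xs \<in> set xss"
    then show "ob xs \<and> bnd (length xs)" using g
      by (auto simp: gok_def intro!: B dest!: split_list)
  qed
  then have "al pre xs (map M xss @ post) = al pre' ys (map M yss @ post')"
    using gdrops_keep l xs gok_M[OF g] gok_ob[OF g]
    by (intro al_drops drops_append gdrops_M) (auto intro!: B)
  moreover have "G (pre @ xs) xss post = G (pre' @ ys) yss post'"
    using gdrops_keep g by (intro gdrops_keep.IH drops_append)
  ultimately show ?case by simp
next
  case (gdrops_skip xs xss yss)
  have g: "gok (pre @ xs) xss post" and xs: "xs \<noteq> []" "ob xs" "ob pre" using gdrops_skip.prems by (auto simp: gok_Cons)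
  have l: "1 \<le> length xs" "length xss \<le> length (concat xss)"
    using xs gok_length[OF g] by (auto simp: Suc_le_eq)
  have B: "bnd k" if "k \<le> length pre + length xs + length (concat xss) + length post" for k
    using gok_bnd[OF g, of k] that by simp
  have ob: "ob (map M xss)" "ob post" using gok_M[OF g] gok_ob[OF g] by auto
  have "al pre xs (map M xss @ post) = al pre [] (map M xss @ post)"
    using gdrops_skip(1) l xs ob by (intro al_drops_mid) (auto intro!: B)
  also have "\<dots> = Idt C (M (pre @ map M xss @ post))"
    using l xs ob by (intro al_Nil) (auto intro!: B)
  also have "M (pre @ map M xss @ post) = M ((pre @ xs) @ map M xss @ post)"
    using drops_append[OF drops_refl[of _ pre] drops_append[OF gdrops_skip(1) drops_refl[of _ "map M xss @ post"]]] l xs ob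
    by (intro M_drops[symmetric]) (auto intro!: B)
  finally have "G pre (xs # xss) post = G (pre @ xs) xss post"
    using hom_G[OF g] by (simp add: comp_Idt)
  also have "\<dots> = G pre' yss post'"
    using gdrops_skip.IH[of "pre @ xs" pre'] drops_append[OF gdrops_skip.prems(1) gdrops_skip(1)] gdrops_skip.prems g by simp
  finally show ?case .
qed

end

section \<open>Contraction morphisms\<close>

text \<open>The data belonging to one tree above the root of the source: the tree, the segment of
  the target it is contracted to, its block of labels, and a morphism between the values. One list
  of pieces replaces four parallel lists.\<close>

datatype ('o, 'm) piece = Piece (tr: tree) (sg: "tree list") (lb: "'o list") (ar: 'm)

context monoidal begin

definition vals where "vals p = tvals M (sg p) (lb p)"

text \<open>\<open>ct T T' xs f\<close>: \<open>f\<close> is the canonical morphism from the value of \<open>T\<close> at \<open>xs\<close> to that of \<open>T'\<close>.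
  Contraction of edges turns the \<open>i\<close>-th tree above the root of \<open>T\<close> into a segment of the list of trees
  above the root of \<open>T'\<close>, regarded as a tree by \<open>mk_node\<close>.\<close>

inductive ct :: "tree \<Rightarrow> tree \<Rightarrow> 'o list \<Rightarrow> 'm \<Rightarrow> bool" where
  ct_Zero: "ct Zero Zero [] (Idt C (M []))"
| ct_Leaf: "x \<in> Obj C \<Longrightarrow> ct Leaf Leaf [x] (Idt C x)"
| ct_Node: "2 \<le> length ps \<Longrightarrow> bnd (length (concat (map sg ps))) \<Longrightarrow>
    \<forall>p\<in>set ps. ct (tr p) (mk_node (sg p)) (lb p) (ar p) \<and> tr p \<noteq> Zero \<and> sg p \<noteq> [] \<and>
      (\<forall>t\<in>set (sg p). stable n t) \<Longrightarrow>
    ct (Node (map tr ps)) (Node (concat (map sg ps))) (concat (map lb ps))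
      (gamma (map vals ps) \<bullet> Mf (map ar ps))"

text \<open>Typing is stated separately from \<open>ct\<close>, so that \<open>pieces_typing\<close>
  is available within the induction that proves \<open>ct_ctt\<close>.\<close>

definition ctt where
  "ctt T T' xs f \<longleftrightarrow> okt n T \<and> okt n T' \<and> length xs = leaves T \<and> leaves T' = leaves T \<and> ob xs \<and>
    hom f (tval M T xs) (tval M T' xs)"

lemma length_le_concat_map: "p \<in> set ps \<Longrightarrow> length (f p) \<le> length (concat (map f ps))"
  by (auto dest!: split_list)

text \<open>Everything needed for the formula in \<open>ct_Node\<close> to be well typed. A single
  bound on the total length of the segments covers all arities that occur, because no segment is
  empty.\<close>

lemma pieces_typing:
  assumes "\<forall>p\<in>set ps. sg p \<noteq> [] \<and> (\<forall>t\<in>set (sg p). okt n t) \<and> ctt (tr p) (mk_node (sg p)) (lb p) (ar p)"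
    and "bnd (length (concat (map sg ps)))"
  shows "gok [] (map vals ps) []"
    and "\<forall>p\<in>set ps. tval M (mk_node (sg p)) (lb p) = M (vals p)"
    and "homs (map ar ps) (tvals M (map tr ps) (concat (map lb ps))) (map M (map vals ps))"
    and "tvals M (concat (map sg ps)) (concat (map lb ps)) = concat (map vals ps)"
    and "hom (gamma (map vals ps) \<bullet> Mf (map ar ps)) (M (tvals M (map tr ps) (concat (map lb ps))))
      (M (concat (map vals ps)))"
    and "length (concat (map lb ps)) = total_leaves (map tr ps)"
    and "total_leaves (concat (map sg ps)) = total_leaves (map tr ps)"
    and "length ps \<le> length (concat (map sg ps))"
proof -
  have l: "length (lb p) = total_leaves (sg p)" "length (lb p) = leaves (tr p)" if "p \<in> set ps" for p
    using assms(1) that by (auto simp: ctt_def)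
  have b: "bnd (length (sg p))" if "p \<in> set ps" for p
    using length_le_concat_map[OF that, of sg] assms(2) by (rule bnd_mono[rotated])
  have o: "ob (vals p)" "vals p \<noteq> []" "length (vals p) = length (sg p)" if "p \<in> set ps" for p
  proof -
    show "length (vals p) = length (sg p)" by (simp add: vals_def)
    moreover have "sg p \<noteq> []" using assms(1) that by blast
    ultimately show "vals p \<noteq> []" by auto
    have "\<forall>t\<in>set (sg p). okt n t" "ob (lb p)" using assms(1) that by (auto simp: ctt_def)
    then show "ob (vals p)" unfolding vals_def using l(1)[OF that] by (intro M.tvals_closed)
  qed
  have len: "length (concat (map vals ps)) = length (concat (map sg ps))"
    by (simp add: length_concat vals_def o_def)
  show g: "gok [] (map vals ps) []"
    using o assms(2) len by (auto simp: gok_def)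
  show v: "\<forall>p\<in>set ps. tval M (mk_node (sg p)) (lb p) = M (vals p)"
  proof
    fix p assume p: "p \<in> set ps"
    have "\<forall>t\<in>set (sg p). okt n t" "ob (lb p)" using assms(1) p by (auto simp: ctt_def)
    then show "tval M (mk_node (sg p)) (lb p) = M (vals p)"
      unfolding vals_def using l(1)[OF p] b[OF p] by (intro M.tval_mk_node) (auto simp: bnd_def)
  qed
  have e: "tvals M (map tr ps) (concat (map lb ps)) = map (\<lambda>p. tval M (tr p) (lb p)) ps"
    using l by (intro tvals_map_concat) auto
  show h: "homs (map ar ps) (tvals M (map tr ps) (concat (map lb ps))) (map M (map vals ps))"
    unfolding e map_map using assms(1) v by (intro homs_map) (auto simp: ctt_def)
  show "tvals M (concat (map sg ps)) (concat (map lb ps)) = concat (map vals ps)"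
    unfolding vals_def using l by (intro tvals_concat_concat) auto
  show n: "length ps \<le> length (concat (map sg ps))"
    using length_le_concat[of "map sg ps"] assms(1) by auto
  have "hom (Mf (map ar ps)) (M (tvals M (map tr ps) (concat (map lb ps)))) (M (map M (map vals ps)))"
    using h n assms(2) by (intro hom_Mf) (auto elim!: bnd_mono)
  moreover have "hom (gamma (map vals ps)) (M (map M (map vals ps))) (M (concat (map vals ps)))"
    using hom_G[OF g] by (simp add: gamma_def)
  ultimately show "hom (gamma (map vals ps) \<bullet> Mf (map ar ps)) (M (tvals M (map tr ps) (concat (map lb ps))))
      (M (concat (map vals ps)))" by (rule hom_comp)
  show "length (concat (map lb ps)) = total_leaves (map tr ps)"
    using l(2) by (induction ps) auto
  show "total_leaves (concat (map sg ps)) = total_leaves (map tr ps)"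
    using l by (induction ps) auto
qed

lemma ct_ctt: "ct T T' xs f \<Longrightarrow> ctt T T' xs f"
proof (induction rule: ct.induct)
  case ct_Zero
  then show ?case using M_Nil_Obj by (auto simp: ctt_def)
next
  case (ct_Leaf x)
  then show ?case by (auto simp: ctt_def stable_Leaf)
next
  case (ct_Node ps)
  have a: "\<forall>p\<in>set ps. sg p \<noteq> [] \<and> (\<forall>t\<in>set (sg p). okt n t) \<and> ctt (tr p) (mk_node (sg p)) (lb p) (ar p)"
    using ct_Node.IH by auto
  note P = pieces_typing[OF a ct_Node.hyps(2)]
  have "\<forall>p\<in>set ps. stable n (tr p) \<and> ob (lb p)" using ct_Node.IH by (auto simp: ctt_def)
  moreover have "bnd (length ps)" using P(8) ct_Node.hyps(2) by (auto elim!: bnd_mono)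
  moreover have "\<forall>t\<in>set (concat (map sg ps)). stable n t" using ct_Node.IH by auto
  moreover have "2 \<le> length (concat (map sg ps))" using P(8) ct_Node.hyps(1) by linarith
  ultimately show ?case
    using P ct_Node.hyps(1,2) unfolding ctt_def okt_Node by (auto simp: bnd_def)
qed

lemma ct_Zero_left: "ct Zero T' xs f \<Longrightarrow> T' = Zero \<and> xs = [] \<and> f = Idt C (M [])"
  by (erule ct.cases) auto

lemma ct_Zero_right: "ct T Zero xs f \<Longrightarrow> T = Zero"
  by (erule ct.cases) auto

lemma gamma_single: "ob xs \<Longrightarrow> bnd (length xs) \<Longrightarrow> bnd 1 \<Longrightarrow> gamma [xs] = Idt C (M xs)"
  using al_outer[of xs] comp_Idt(1)[OF hom_Idt[OF M_Obj]] by (simp add: gamma_def)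

text \<open>Empty trees are allowed here and can be discarded because the unit is strict; this makes the
  lemma applicable both to composites and to grafting.\<close>

lemma ct_mk:
  assumes "\<forall>p\<in>set ps. sg p \<noteq> [] \<and> (\<forall>t\<in>set (sg p). okt n t) \<and> ct (tr p) (mk_node (sg p)) (lb p) (ar p)"
    and "bnd (length (concat (map sg ps)))"
  shows "ct (mk_node (map tr ps)) (mk_node (concat (map sg ps))) (concat (map lb ps))
      (gamma (map vals ps) \<bullet> Mf (map ar ps))"
proof -
  let ?nz = "filter (\<lambda>t. t \<noteq> Zero)"
  \<comment> \<open>Empty trees are removed from every segment, and pieces with empty source are
    removed altogether. What remains satisfies the conditions that \<open>ct_Node\<close> imposes on
    single pieces.\<close>
  let ?r = "\<lambda>p. Piece (tr p) (?nz (sg p)) (lb p) (ar p)"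
  let ?qs = "map ?r (filter (\<lambda>p. tr p \<noteq> Zero) ps)"
  have a: "\<forall>p\<in>set ps. sg p \<noteq> [] \<and> (\<forall>t\<in>set (sg p). okt n t) \<and> ctt (tr p) (mk_node (sg p)) (lb p) (ar p)"
    using assms(1) ct_ctt by auto
  note P = pieces_typing[OF a assms(2)]
  have z: "?nz (sg p) = []" "lb p = []" "ar p = Mf []" "drops (M []) (vals p) []"
    if "p \<in> set ps" "tr p = Zero" for p
  proof -
    have "ct Zero (mk_node (sg p)) (lb p) (ar p)" using assms(1) that by auto
    then have *: "mk_node (sg p) = Zero \<and> lb p = [] \<and> ar p = Mf []"
      unfolding Mf_Nil by (rule ct_Zero_left)
    then show f: "?nz (sg p) = []" and "lb p = []" "ar p = Mf []"
      by (auto simp: mk_node_eq_Zero filter_empty_conv)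
    have "length (lb p) = total_leaves (sg p)" using a that(1) by (auto simp: ctt_def)
    from tvals_filter[OF this, of M] show "drops (M []) (vals p) []" by (simp add: vals_def f)
  qed
  have nz: "?nz (sg p) \<noteq> []" "drops (M []) (vals p) (vals (?r p))"
    if "p \<in> set ps" "tr p \<noteq> Zero" for p
  proof -
    have "mk_node (sg p) \<noteq> Zero" using assms(1) that ct_Zero_right by auto
    then show "?nz (sg p) \<noteq> []" by (auto simp: mk_node_eq_Zero filter_empty_conv)
    have "length (lb p) = total_leaves (sg p)" using a that(1) by (auto simp: ctt_def)
    from tvals_filter[OF this, of M] show "drops (M []) (vals p) (vals (?r p))" by (simp add: vals_def)
  qed
  \<comment> \<open>Neither factor of the formula changes: removed trees have the unit as value, and
    the morphism of a removed piece is the identity of the unit.\<close>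
  have "gdrops (map vals ps) (map vals ?qs)"
    using z nz
  proof (induction ps)
    case (Cons p ps)
    have IH: "gdrops (map vals ps) (map vals (map ?r (filter (\<lambda>p. tr p \<noteq> Zero) ps)))"
      using Cons.prems by (intro Cons.IH) auto
    show ?case
    proof (cases "tr p = Zero")
      case True
      then show ?thesis using IH Cons.prems(4)[of p] by (auto intro: gdrops_skip)
    next
      case False
      have "length (vals (?r p)) = length (?nz (sg p))" by (simp add: vals_def)
      then have "vals (?r p) \<noteq> []" using Cons.prems(5)[of p] False by auto
      then show ?thesis using IH Cons.prems(6)[of p] False by (auto intro: gdrops_keep)
    qed
  qed (simp add: gdrops_Nil)
  then have g: "gamma (map vals ps) = gamma (map vals ?qs)"
    unfolding gamma_def by (rule G_drops[OF _ drops_Nil drops_Nil P(1)])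
  have "drops (Mf []) (map ar ps) (map ar ?qs)"
    using z(3) by (induction ps) (auto intro: drops.intros)
  then have m: "Mf (map ar ps) = Mf (map ar ?qs)"
    using P(3) bnd_mono[OF assms(2) P(8)] by (intro Mf.drop_units) (auto simp: homs_iff bnd_def)
  have lbs: "concat (map lb ps) = concat (map lb ?qs)"
    using z(2) by (induction ps) auto
  have "?nz (map tr ps) = map tr ?qs" by (induction ps) auto
  then have t: "mk_node (map tr ps) = mk_node (map tr ?qs)" by (metis mk_node_filter)
  have sgs: "?nz (concat (map sg ps)) = concat (map sg ?qs)"
    using z(1) by (induction ps) auto
  then have s: "mk_node (concat (map sg ps)) = mk_node (concat (map sg ?qs))" by (metis mk_node_filter)
  have q: "\<forall>q\<in>set ?qs. ct (tr q) (mk_node (sg q)) (lb q) (ar q) \<and> tr q \<noteq> Zero \<and> sg q \<noteq> [] \<and>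
      (\<forall>t\<in>set (sg q). stable n t)"
    using assms(1) nz(1) by (auto simp: mk_node_filter)
  have b: "bnd (length (concat (map sg ?qs)))"
    unfolding sgs[symmetric] using assms(2) by (rule bnd_mono) simp
  have q': "\<forall>p\<in>set ?qs. sg p \<noteq> [] \<and> (\<forall>t\<in>set (sg p). okt n t) \<and> ctt (tr p) (mk_node (sg p)) (lb p) (ar p)"
    using q ct_ctt by blast
  note Q = pieces_typing[OF q' b]
  have "ct (mk_node (map tr ?qs)) (mk_node (concat (map sg ?qs))) (concat (map lb ?qs))
      (gamma (map vals ?qs) \<bullet> Mf (map ar ?qs))"
  proof -
    define qs where "qs = ?qs"
    have "ct (mk_node (map tr qs)) (mk_node (concat (map sg qs))) (concat (map lb qs))
      (gamma (map vals qs) \<bullet> Mf (map ar qs))"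
    proof -
      note q = q[folded qs_def] and b = b[folded qs_def] and Q = Q[folded qs_def]
        and q' = q'[folded qs_def]
      \<comment> \<open>Only with at least two remaining pieces is the claim an instance of
        \<open>ct_Node\<close>. With none or one, \<open>gamma\<close> is an identity and the node
        has been deleted.\<close>
      consider "qs = []" | p where "qs = [p]" | "2 \<le> length qs"
        by (cases qs; cases "tl qs") auto
      then show ?thesis
      proof cases
        case 1
        then show ?thesis using comp_Idt(1)[OF hom_Idt[OF M_Nil_Obj]]
          by (simp add: gamma_def Mf_Nil ct_Zero)
      next
        case (2 p)
        have "1 \<le> length (sg p)" using q 2 by (simp add: Suc_le_eq)
        moreover have "bnd (length (sg p))" using b 2 by simp
        ultimately have "bnd 1" by (rule bnd_mono[rotated])
        then have "gamma [vals p] = Idt C (M (vals p))"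
          using Q(1) b 2 by (intro gamma_single) (auto simp: gok_def vals_def)
        moreover have h: "hom (ar p) (tval M (tr p) (lb p)) (M (vals p))"
          using q' Q(2) 2 by (auto simp: ctt_def)
        moreover have "ar p \<in> Arr C" using h by (simp add: hom_def)
        ultimately show ?thesis using 2 q by (simp add: Mf_single comp_Idt(2)[OF h])
      next
        case 3
        have "mk_node (map tr qs) = Node (map tr qs)"
          using q 3 by (intro mk_node_Node) (auto simp: image_iff)
        moreover have "\<forall>t\<in>set (concat (map sg qs)). stable n t" using q by simp
        then have "Zero \<notin> set (concat (map sg qs))" using stable_Zero by blast
        then have "mk_node (concat (map sg qs)) = Node (concat (map sg qs))"
          using 3 Q(8) by (intro mk_node_Node) auto
        ultimately show ?thesis using ct_Node[OF 3 b q] by simp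
      qed
    qed
    then show ?thesis by (simp only: qs_def)
  qed
  then show ?thesis by (simp only: g m lbs t s)
qed

section \<open>Uniqueness of canonical morphisms\<close>

lemma ct_pos: "\<forall>t\<in>set ts. stable n t \<Longrightarrow> \<forall>t\<in>set ts. 1 \<le> leaves t"
  using stable_leaves by auto

text \<open>Every tree adds at least one leaf, so the number of leaves tells where a segment
  ends.\<close>

lemma segment_unique:
  assumes "as @ bs = cs @ ds" "total_leaves as = total_leaves cs"
    "\<forall>t\<in>set (as @ bs). 1 \<le> leaves t"
  shows "as = cs \<and> bs = ds"
  using assms
proof (induction as arbitrary: cs)
  case Nil
  then show ?case by (cases cs) auto
next
  case (Cons a as)
  then show ?case by (cases cs) auto
qed

text \<open>Leaf counts cut both target lists, and both label lists, at the same places. Trees and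
  labels therefore determine the pieces once the morphism of a piece is determined by its other
  components.\<close>

lemma pieces_unique:
  assumes "map tr ps = map tr qs" "concat (map sg ps) = concat (map sg qs)"
    "concat (map lb ps) = concat (map lb qs)"
    "\<forall>p\<in>set ps. total_leaves (sg p) = leaves (tr p) \<and> length (lb p) = leaves (tr p) \<and> (\<forall>t\<in>set (sg p). 1 \<le> leaves t)"
    "\<forall>p\<in>set qs. total_leaves (sg p) = leaves (tr p) \<and> length (lb p) = leaves (tr p)"
    "\<And>p q. p \<in> set ps \<Longrightarrow> q \<in> set qs \<Longrightarrow> tr p = tr q \<Longrightarrow> sg p = sg q \<Longrightarrow> lb p = lb q \<Longrightarrow> ar p = ar q"
  shows "ps = qs"
  using assms
proof (induction ps arbitrary: qs)
  case (Cons p ps)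
  then obtain q qs' where qs: "qs = q # qs'" by (cases qs) auto
  have t: "tr p = tr q" using Cons.prems(1) qs by simp
  have "sg p = sg q \<and> concat (map sg ps) = concat (map sg qs')"
  proof (rule segment_unique)
    show "sg p @ concat (map sg ps) = sg q @ concat (map sg qs')" using Cons.prems(2) qs by simp
    show "total_leaves (sg p) = total_leaves (sg q)" using Cons.prems(4,5) qs t by simp
    show "\<forall>t\<in>set (sg p @ concat (map sg ps)). 1 \<le> leaves t" using Cons.prems(4) by auto
  qed
  moreover have "lb p = lb q \<and> concat (map lb ps) = concat (map lb qs')"
  proof -
    have "lb p @ concat (map lb ps) = lb q @ concat (map lb qs')" using Cons.prems(3) qs by simp
    moreover have "length (lb p) = length (lb q)" using Cons.prems(4,5) qs t by simp
    ultimately show ?thesis by simp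
  qed
  moreover have "ps = qs'"
  proof (rule Cons.IH)
    fix p' q' assume "p' \<in> set ps" "q' \<in> set qs'" "tr p' = tr q'" "sg p' = sg q'" "lb p' = lb q'"
    then show "ar p' = ar q'" using Cons.prems(6)[of p' q'] qs by simp
  qed (use Cons.prems(1,4,5) qs calculation in simp_all)
  moreover have "ar p = ar q" using Cons.prems(6)[of p q] qs t calculation by simp
  ultimately show ?case using qs t by (simp add: piece.expand)
qed simp

lemma ct_Node_inv:
  assumes "ct (Node ts) T' xs f"
  obtains ps where "ts = map tr ps" "T' = Node (concat (map sg ps))" "xs = concat (map lb ps)"
    "f = gamma (map vals ps) \<bullet> Mf (map ar ps)" "2 \<le> length ps" "bnd (length (concat (map sg ps)))"
    "\<forall>p\<in>set ps. ct (tr p) (mk_node (sg p)) (lb p) (ar p) \<and> tr p \<noteq> Zero \<and> sg p \<noteq> [] \<and>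
      (\<forall>t\<in>set (sg p). stable n t)"
  using assms by (rule ct.cases) auto

lemma ct_leaves: "ct T T' xs f \<Longrightarrow> leaves T' = leaves T" "ct T T' xs f \<Longrightarrow> length xs = leaves T"
  using ct_ctt[of T T' xs f] by (simp_all add: ctt_def)

text \<open>This takes the place of a coherence theorem: source, target and labels determine the
  pieces, and inductively the morphisms they carry.\<close>

lemma ct_unique: "ct T T' xs f \<Longrightarrow> ct T T' xs g \<Longrightarrow> f = g"
proof (induction arbitrary: g rule: ct.induct)
  case ct_Zero then show ?case using ct_Zero_left by auto
next
  case (ct_Leaf x)
  from ct_Leaf(2) show ?case by (rule ct.cases) auto
next
  case (ct_Node ps)
  from ct_Node.prems obtain qs where q: "map tr ps = map tr qs"
    "concat (map sg ps) = concat (map sg qs)" "concat (map lb ps) = concat (map lb qs)"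
    "g = gamma (map vals qs) \<bullet> Mf (map ar qs)"
    "\<forall>p\<in>set qs. ct (tr p) (mk_node (sg p)) (lb p) (ar p)"
    by (elim ct_Node_inv) auto
  have "ps = qs"
  proof (rule pieces_unique[OF q(1-3)])
    show "\<forall>p\<in>set ps. total_leaves (sg p) = leaves (tr p) \<and> length (lb p) = leaves (tr p) \<and>
        (\<forall>t\<in>set (sg p). 1 \<le> leaves t)"
    proof
      fix p assume "p \<in> set ps"
      then have "ct (tr p) (mk_node (sg p)) (lb p) (ar p)" "\<forall>t\<in>set (sg p). stable n t"
        using ct_Node.IH by auto
      then show "total_leaves (sg p) = leaves (tr p) \<and> length (lb p) = leaves (tr p) \<and>
        (\<forall>t\<in>set (sg p). 1 \<le> leaves t)"
        using ct_leaves[of "tr p" "mk_node (sg p)" "lb p" "ar p"] ct_pos[of "sg p"] by simp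
    qed
    show "\<forall>p\<in>set qs. total_leaves (sg p) = leaves (tr p) \<and> length (lb p) = leaves (tr p)"
    proof
      fix p assume "p \<in> set qs"
      then show "total_leaves (sg p) = leaves (tr p) \<and> length (lb p) = leaves (tr p)"
        using q(5) ct_leaves[of "tr p" "mk_node (sg p)" "lb p" "ar p"] by simp
    qed
    fix p q assume "p \<in> set ps" "q \<in> set qs" "tr p = tr q" "sg p = sg q" "lb p = lb q"
    moreover from this have "ct (tr p) (mk_node (sg p)) (lb p) (ar q)" using q(5) by metis
    ultimately show "ar p = ar q" using ct_Node.IH by blast
  qed
  then show ?case using q(4) by simp
qed

lemma Mf_comp_map:
  assumes "\<forall>z\<in>set zs. hom (f z) (x z) (y z) \<and> hom (g z) (y z) (w z)" "bnd (length zs)"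
  shows "Mf (map g zs) \<bullet> Mf (map f zs) = Mf (map (\<lambda>z. g z \<bullet> f z) zs)"
proof -
  have "homs (map f zs) (map x zs) (map y zs)" "homs (map g zs) (map y zs) (map w zs)"
    using assms by (auto intro!: homs_map)
  moreover have "map2 comp (map g zs) (map f zs) = map (\<lambda>z. g z \<bullet> f z) zs"
    by (induction zs) auto
  ultimately show ?thesis using Mf_comp assms(2) by simp
qed

lemma gamma_nat:
  assumes "\<forall>q\<in>set Q. homs (f q) (x q) (y q)" "gok [] (map x Q) []"
  shows "gamma (map y Q) \<bullet> Mf (map (\<lambda>q. Mf (f q)) Q) = Mf (concat (map f Q)) \<bullet> gamma (map x Q)"
  using G_nat[of "[]" "[]" "[]" "[]" "[]" "[]" Q f x y] assms by (simp add: gamma_def)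

section \<open>Canonical morphisms of identities and of single contractions\<close>

lemma gamma_singles: "ob xs \<Longrightarrow> bnd (length xs) \<Longrightarrow> gamma (map (\<lambda>x. [x]) xs) = Idt C (M xs)"
  using G_singles[of "[]" xs "[]"] by (simp add: gamma_def)

lemma map_M_singles: "ob xs \<Longrightarrow> map M (map (\<lambda>x. [x]) xs) = xs"
  by (induction xs) (auto simp: M_single)

text \<open>The factors of \<open>gamma\<close> that open brackets around single objects are
  identities; the factor for the middle bracket is the given associator.\<close>

lemma gamma_mid:
  assumes "ob (as @ bs @ cs)" "bnd (length as + length bs + length cs)" "bs \<noteq> []"
  shows "gamma (map (\<lambda>x. [x]) as @ [bs] @ map (\<lambda>x. [x]) cs) = al as bs cs"
proof -
  have l: "1 \<le> length bs" using assms(3) by (simp add: Suc_le_eq)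
  have B: "bnd k" if "k \<le> length as + length bs + length cs" for k
    using assms(2) that by (rule bnd_mono)
  have g: "gok [] (map (\<lambda>x. [x]) as @ [bs] @ map (\<lambda>x. [x]) cs) []"
    using assms by (auto simp: gok_def length_concat o_def sum_list_triv add.assoc)
  have g2: "gok (as @ []) ([bs] @ map (\<lambda>x. [x]) cs) []"
    using assms by (auto simp: gok_def length_concat o_def sum_list_triv add.assoc)
  have h: "hom (al as bs cs) (M (as @ M bs # cs)) (M (as @ bs @ cs))"
    using assms l by (intro hom_al) (auto intro!: B)
  have "gamma (map (\<lambda>x. [x]) as @ [bs] @ map (\<lambda>x. [x]) cs) =
      (Idt C (M (as @ bs @ cs)) \<bullet> al as bs cs) \<bullet> Idt C (M (as @ M bs # cs))"
    unfolding gamma_def G_append[OF g]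
    using assms map_M_singles[of cs] G_singles[of "as @ bs" cs "[]"]
      G_singles[of "[]" as "M bs # cs"] l M_Obj[of bs]
    by (simp add: concat_map_singleton B)
  then show ?thesis using h by (simp add: comp_Idt)
qed

text \<open>Pieces that change nothing, one for each tree of \<open>us\<close>. The choice operator
  merely names the decomposition of \<open>xs\<close> into blocks of labels, which exists when the
  lengths match.\<close>

definition id_pieces where
  "id_pieces us xs = map (\<lambda>(u, l). Piece u [u] l (Idt C (tval M u l)))
     (SOME ps. us = map fst ps \<and> xs = concat (map snd ps) \<and> (\<forall>p\<in>set ps. length (snd p) = leaves (fst p)))"

lemma id_pieces:
  assumes "length xs = total_leaves us" "ob xs" "\<forall>t\<in>set us. okt n t"
  shows "map tr (id_pieces us xs) = us" "map sg (id_pieces us xs) = map (\<lambda>u. [u]) us"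
    "concat (map lb (id_pieces us xs)) = xs"
    "map vals (id_pieces us xs) = map (\<lambda>x. [x]) (tvals M us xs)"
    "map ar (id_pieces us xs) = ids (tvals M us xs)"
    "\<forall>p\<in>set (id_pieces us xs). sg p = [tr p] \<and> tr p \<in> set us \<and> ob (lb p) \<and>
      length (lb p) = leaves (tr p) \<and> ar p = Idt C (tval M (tr p) (lb p))"
proof -
  define ps where "ps = (SOME ps. us = map fst ps \<and> xs = concat (map snd ps) \<and>
    (\<forall>p\<in>set ps. length (snd p) = leaves (fst p)))"
  have "\<exists>ps. us = map fst ps \<and> xs = concat (map snd ps) \<and>
    (\<forall>p\<in>set ps. length (snd p) = leaves (fst p))"
    using split_lengths[OF assms(1)] by blast
  then have ps: "us = map fst ps \<and> xs = concat (map snd ps) \<and>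
    (\<forall>p\<in>set ps. length (snd p) = leaves (fst p))"
    unfolding ps_def by (rule someI_ex)
  then have u: "us = map fst ps" and x: "xs = concat (map snd ps)"
    and l: "\<forall>p\<in>set ps. length (snd p) = leaves (fst p)" by auto
  have i: "id_pieces us xs = map (\<lambda>(u, l). Piece u [u] l (Idt C (tval M u l))) ps"
    by (simp add: id_pieces_def ps_def)
  have v: "tvals M us xs = map (\<lambda>p. tval M (fst p) (snd p)) ps"
    unfolding u x by (rule tvals_map_concat[OF l])
  show "map tr (id_pieces us xs) = us" "map sg (id_pieces us xs) = map (\<lambda>u. [u]) us"
    "concat (map lb (id_pieces us xs)) = xs"
    unfolding i by (simp_all add: u x split_def o_def)
  show "map vals (id_pieces us xs) = map (\<lambda>x. [x]) (tvals M us xs)"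
    unfolding v i using l by (auto simp: vals_def)
  show "map ar (id_pieces us xs) = ids (tvals M us xs)"
    unfolding v i by auto
  show "\<forall>p\<in>set (id_pieces us xs). sg p = [tr p] \<and> tr p \<in> set us \<and> ob (lb p) \<and>
      length (lb p) = leaves (tr p) \<and> ar p = Idt C (tval M (tr p) (lb p))"
    using l assms(2) unfolding i by (force simp: u x)
qed

lemma ct_refl: "okt n T \<Longrightarrow> ob xs \<Longrightarrow> length xs = leaves T \<Longrightarrow> ct T T xs (Idt C (tval M T xs))"
proof (induction T arbitrary: xs)
  case Zero then show ?case by (simp add: ct_Zero)
next
  case Leaf
  then obtain x where "xs = [x]" by (cases xs) auto
  then show ?case using Leaf by (simp add: ct_Leaf)
next
  case (Node ts)
  have ts: "2 \<le> length ts" "bnd (length ts)" "\<forall>t\<in>set ts. stable n t"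
    using Node.prems(1) unfolding okt_Node by (auto simp: bnd_def)
  have l: "length xs = total_leaves ts" using Node.prems by simp
  have tv: "ob (tvals M ts xs)" using ts l Node.prems by (intro M.tvals_closed) auto
  define ps where "ps = id_pieces ts xs"
  have P: "map tr ps = ts" "map sg ps = map (\<lambda>u. [u]) ts"
    "concat (map lb ps) = xs"
    "map vals ps = map (\<lambda>x. [x]) (tvals M ts xs)"
    "map ar ps = ids (tvals M ts xs)"
    "\<forall>p\<in>set ps. sg p = [tr p] \<and> tr p \<in> set ts \<and> ob (lb p) \<and>
      length (lb p) = leaves (tr p) \<and> ar p = Idt C (tval M (tr p) (lb p))"
    unfolding ps_def using id_pieces[OF l Node.prems(2)] ts(3) by auto
  have lp: "length ps = length ts" using P(1) by (metis length_map)
  have c: "concat (map sg ps) = ts" unfolding P(2) by (induction ts) auto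
  have "ct (Node (map tr ps)) (Node (concat (map sg ps))) (concat (map lb ps))
      (gamma (map vals ps) \<bullet> Mf (map ar ps))"
  proof (rule ct_Node)
    show "\<forall>p\<in>set ps. ct (tr p) (mk_node (sg p)) (lb p) (ar p) \<and> tr p \<noteq> Zero \<and> sg p \<noteq> [] \<and>
      (\<forall>t\<in>set (sg p). stable n t)"
    proof
      fix p assume "p \<in> set ps"
      then have "sg p = [tr p] \<and> tr p \<in> set ts \<and> ob (lb p) \<and>
        length (lb p) = leaves (tr p) \<and> ar p = Idt C (tval M (tr p) (lb p))" using P(6) by blast
      moreover from this have "stable n (tr p)" using ts(3) by blast
      ultimately show "ct (tr p) (mk_node (sg p)) (lb p) (ar p) \<and> tr p \<noteq> Zero \<and> sg p \<noteq> [] \<and>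
        (\<forall>t\<in>set (sg p). stable n t)" using Node.IH[of "tr p" "lb p"] by auto
    qed
  qed (use ts lp c in auto)
  moreover have "gamma (map vals ps) \<bullet> Mf (map ar ps) = Idt C (tval M (Node ts) xs)"
    unfolding P using tv ts M_Obj[of "tvals M ts xs"]
    by (simp add: gamma_singles Mf_ids comp_Idt(1)[OF hom_Idt])
  ultimately show ?case by (simp add: P c)
qed

lemma id_pieces_ct:
  assumes "length xs = total_leaves us" "ob xs" "\<forall>t\<in>set us. okt n t" "p \<in> set (id_pieces us xs)"
  shows "sg p \<noteq> [] \<and> (\<forall>t\<in>set (sg p). okt n t) \<and> ct (tr p) (mk_node (sg p)) (lb p) (ar p)"
proof -
  have "sg p = [tr p] \<and> tr p \<in> set us \<and> ob (lb p) \<and> length (lb p) = leaves (tr p) \<and>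
    ar p = Idt C (tval M (tr p) (lb p))" using id_pieces(6)[OF assms(1-3)] assms(4) by blast
  moreover from this have "okt n (tr p)" using assms(3) by blast
  ultimately show ?thesis using ct_refl[of "tr p" "lb p"] by simp
qed

text \<open>One piece has all of \<open>ts\<close> as its segment, and the pieces on both sides of
  it change nothing; \<open>gamma_mid\<close> then identifies the formula with an
  associator.\<close>

lemma ct_root:
  assumes "\<forall>t\<in>set (us @ ts @ vs). okt n t" "bnd (length us + length ts + length vs)"
    "bnd (length us + 1 + length vs)"
    "length xu = total_leaves us" "length xt = total_leaves ts" "length xv = total_leaves vs"
    "ob (xu @ xt @ xv)"
  shows "ct (mk_node (us @ mk_node ts # vs)) (mk_node (us @ ts @ vs)) (xu @ xt @ xv)
    (al (tvals M us xu) (tvals M ts xt) (tvals M vs xv))"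
proof -
  have okts: "okt n (mk_node ts)" using assms(1,2) bnd_mono[OF assms(2), of "length ts"]
    by (intro okt_mk_node) (auto simp: bnd_def)
  have obv: "ob (tvals M us xu)" "ob (tvals M ts xt)" "ob (tvals M vs xv)"
    using assms by (simp_all add: M.tvals_closed)
  have mv: "tval M (mk_node ts) xt = M (tvals M ts xt)"
    using assms bnd_mono[OF assms(2), of "length ts"] by (intro M.tval_mk_node) (auto simp: bnd_def)
  show ?thesis
  proof (cases "ts = []")
    \<comment> \<open>Empty segments are excluded in \<open>ct_mk\<close>. For empty
      \<open>ts\<close>, however, the inner node is the empty tree, source and target coincide, and
      the associator is an identity by axiom (i).\<close>
    case True
    have "tvals M (us @ vs) (xu @ xv) = tvals M us xu @ tvals M vs xv"
      by (rule tvals_append[OF assms(4)])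
    moreover have "tval M (mk_node (us @ vs)) (xu @ xv) = M (tvals M (us @ vs) (xu @ xv))"
      using assms True by (intro M.tval_mk_node) (auto simp: bnd_def)
    moreover have "mk_node (us @ Zero # vs) = mk_node (us @ vs)"
      using mk_node_filter[of "us @ Zero # vs"] mk_node_filter[of "us @ vs"] by simp
    moreover have "okt n (mk_node (us @ vs))" using assms True by (intro okt_mk_node) (auto simp: bnd_def)
    ultimately show ?thesis using True assms ct_refl[of "mk_node (us @ vs)" "xu @ xv"] obv
      by (simp add: al_Nil)
  next
    case False
    have l: "1 \<le> length ts" using False by (simp add: Suc_le_eq)
    let ?m = "Piece (mk_node ts) ts xt (Idt C (M (tvals M ts xt)))"
    let ?ps = "id_pieces us xu @ [?m] @ id_pieces vs xv"
    have U: "length xu = total_leaves us" "ob xu" "\<forall>t\<in>set us. okt n t"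
      "length xv = total_leaves vs" "ob xv" "\<forall>t\<in>set vs. okt n t" using assms by auto
    note Pu = id_pieces[OF U(1-3)] and Pv = id_pieces[OF U(4-6)]
    have m: "ct (mk_node ts) (mk_node ts) xt (Idt C (M (tvals M ts xt)))"
      unfolding mv[symmetric] using okts assms by (intro ct_refl) auto
    have c: "concat (map sg ?ps) = us @ ts @ vs"
      by (simp add: Pu(2) Pv(2) concat_map_singleton)
    have "ct (mk_node (map tr ?ps)) (mk_node (concat (map sg ?ps))) (concat (map lb ?ps))
      (gamma (map vals ?ps) \<bullet> Mf (map ar ?ps))"
    proof (rule ct_mk)
      show "bnd (length (concat (map sg ?ps)))" unfolding c using assms(2) by (simp add: add.assoc)
      show "\<forall>p\<in>set ?ps. sg p \<noteq> [] \<and> (\<forall>t\<in>set (sg p). okt n t) \<and> ct (tr p) (mk_node (sg p)) (lb p) (ar p)"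
      proof
        fix p assume "p \<in> set ?ps"
        then consider "p \<in> set (id_pieces us xu)" | "p = ?m" | "p \<in> set (id_pieces vs xv)" by auto
        then show "sg p \<noteq> [] \<and> (\<forall>t\<in>set (sg p). okt n t) \<and> ct (tr p) (mk_node (sg p)) (lb p) (ar p)"
        proof cases
          case 1 then show ?thesis using id_pieces_ct[OF U(1-3)] by blast
        next
          case 2 then show ?thesis using m False assms(1) by auto
        next
          case 3 then show ?thesis using id_pieces_ct[OF U(4-6)] by blast
        qed
      qed
    qed
    moreover have "map vals ?ps = map (\<lambda>x. [x]) (tvals M us xu) @ [tvals M ts xt] @ map (\<lambda>x. [x]) (tvals M vs xv)"
      by (simp add: Pu(4) Pv(4) vals_def)
    moreover have "gamma \<dots> = al (tvals M us xu) (tvals M ts xt) (tvals M vs xv)"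
    proof (rule gamma_mid)
      show "tvals M ts xt \<noteq> []" using False by (cases ts) auto
    qed (use obv assms in auto)
    moreover have "Mf (map ar ?ps) = Idt C (M (tvals M us xu @ M (tvals M ts xt) # tvals M vs xv))"
      using Mf_ids[of "tvals M us xu @ M (tvals M ts xt) # tvals M vs xv"] obv assms(3)
        M_Obj[of "tvals M ts xt"] bnd_mono[OF assms(2), of "length ts"]
      by (simp add: Pu(5) Pv(5))
    moreover have "hom (al (tvals M us xu) (tvals M ts xt) (tvals M vs xv))
      (M (tvals M us xu @ M (tvals M ts xt) # tvals M vs xv)) (M (tvals M us xu @ tvals M ts xt @ tvals M vs xv))"
      using obv assms by (intro hom_al) auto
    ultimately show ?thesis using c by (simp add: Pu Pv comp_Idt)
  qed
qed

text \<open>All segments are single trees, so \<open>gamma\<close> is an identity and only the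
  product of the morphisms of the pieces remains.\<close>

lemma ct_above:
  assumes "\<forall>t\<in>set (us @ vs). okt n t" "ct t t' xt f" "bnd (length us + 1 + length vs)"
    "length xu = total_leaves us" "length xv = total_leaves vs" "ob (xu @ xv)"
  shows "ct (mk_node (us @ t # vs)) (mk_node (us @ t' # vs)) (xu @ xt @ xv)
    (Mf (ids (tvals M us xu) @ f # ids (tvals M vs xv)))"
proof -
  have t: "okt n t'" "length xt = leaves t'" "ob xt" "hom f (tval M t xt) (tval M t' xt)"
    using ct_ctt[OF assms(2)] by (auto simp: ctt_def)
  have obv: "ob (tvals M us xu)" "ob (tvals M vs xv)" "tval M t' xt \<in> Obj C"
    using assms t by (simp_all add: M.tvals_closed M.tval_closed)
  let ?m = "Piece t [t'] xt f"
  let ?ps = "id_pieces us xu @ [?m] @ id_pieces vs xv"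
  have U: "length xu = total_leaves us" "ob xu" "\<forall>t\<in>set us. okt n t"
    "length xv = total_leaves vs" "ob xv" "\<forall>t\<in>set vs. okt n t" using assms by auto
  note Pu = id_pieces[OF U(1-3)] and Pv = id_pieces[OF U(4-6)]
  have c: "concat (map sg ?ps) = us @ t' # vs"
    by (simp add: Pu(2) Pv(2) concat_map_singleton)
  have "ct (mk_node (map tr ?ps)) (mk_node (concat (map sg ?ps))) (concat (map lb ?ps))
    (gamma (map vals ?ps) \<bullet> Mf (map ar ?ps))"
  proof (rule ct_mk)
    show "bnd (length (concat (map sg ?ps)))" unfolding c using assms(3) by simp
    show "\<forall>p\<in>set ?ps. sg p \<noteq> [] \<and> (\<forall>t\<in>set (sg p). okt n t) \<and> ct (tr p) (mk_node (sg p)) (lb p) (ar p)"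
    proof
      fix p assume "p \<in> set ?ps"
      then consider "p \<in> set (id_pieces us xu)" | "p = ?m" | "p \<in> set (id_pieces vs xv)" by auto
      then show "sg p \<noteq> [] \<and> (\<forall>t\<in>set (sg p). okt n t) \<and> ct (tr p) (mk_node (sg p)) (lb p) (ar p)"
      proof cases
        case 1 then show ?thesis using id_pieces_ct[OF U(1-3)] by blast
      next
        case 2 then show ?thesis using t assms by auto
      next
        case 3 then show ?thesis using id_pieces_ct[OF U(4-6)] by blast
      qed
    qed
  qed
  moreover have "map vals ?ps = map (\<lambda>x. [x]) (tvals M us xu @ tval M t' xt # tvals M vs xv)"
    using t by (simp add: Pu(4) Pv(4) vals_def)
  moreover have "gamma \<dots> = Idt C (M (tvals M us xu @ tval M t' xt # tvals M vs xv))"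
    using obv assms(3) by (intro gamma_singles) auto
  moreover have "homs (ids (tvals M us xu) @ f # ids (tvals M vs xv))
      (tvals M us xu @ tval M t xt # tvals M vs xv) (tvals M us xu @ tval M t' xt # tvals M vs xv)"
    using obv t by (intro homs_append homs_ids) (simp_all add: homs_ids)
  then have "hom (Mf (ids (tvals M us xu) @ f # ids (tvals M vs xv)))
      (M (tvals M us xu @ tval M t xt # tvals M vs xv)) (M (tvals M us xu @ tval M t' xt # tvals M vs xv))"
    using assms(3) by (intro hom_Mf) auto
  ultimately show ?thesis using c by (simp add: Pu Pv comp_Idt)
qed

section \<open>Functoriality of the evaluation of a fixed tree\<close>

lemma hom_tval:
  "okt n T \<Longrightarrow> set fs \<subseteq> Arr C \<Longrightarrow> length fs = leaves T \<Longrightarrow>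
    hom (tval Mf T fs) (tval M T (map (Src C) fs)) (tval M T (map (Tgt C) fs))"
  and homs_tvals: "\<forall>t\<in>set ts. okt n t \<Longrightarrow> set fs \<subseteq> Arr C \<Longrightarrow> length fs = total_leaves ts \<Longrightarrow>
    homs (tvals Mf ts fs) (tvals M ts (map (Src C) fs)) (tvals M ts (map (Tgt C) fs))"
proof (induction T fs and ts fs rule: tree_labels_induct)
  case (Zero fs)
  then show ?case using M_Nil_Obj by (auto simp: Mf_Nil)
next
  case (Leaf fs)
  then obtain f where "fs = [f]" by (cases fs) auto
  then show ?case using Leaf by (simp add: hom_def)
next
  case (Node ts fs)
  have "\<forall>t\<in>set ts. okt n t" "bnd (length ts)"
    using Node.prems(1) unfolding okt_Node by (auto simp: bnd_def)
  moreover have "length fs = total_leaves ts" using Node.prems by simp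
  ultimately show ?case using hom_Mf[OF Node.IH] Node.prems by simp
next
  case (Cons t ts fs)
  have "set (take (leaves t) fs) \<subseteq> Arr C" "set (drop (leaves t) fs) \<subseteq> Arr C"
    using Cons.prems by (meson order_trans set_take_subset set_drop_subset)+
  then show ?case using Cons by (simp add: take_map drop_map)
qed simp

lemma tval_ids:
  "okt n T \<Longrightarrow> ob xs \<Longrightarrow> length xs = leaves T \<Longrightarrow> tval Mf T (ids xs) = Idt C (tval M T xs)"
  and tvals_ids: "\<forall>t\<in>set ts. okt n t \<Longrightarrow> ob xs \<Longrightarrow> length xs = total_leaves ts \<Longrightarrow>
    tvals Mf ts (ids xs) = ids (tvals M ts xs)"
proof (induction T xs and ts xs rule: tree_labels_induct)
  case (Zero xs)
  then show ?case by (simp add: Mf_Nil)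
next
  case (Leaf xs)
  then obtain x where "xs = [x]" by (cases xs) auto
  then show ?case by simp
next
  case (Node ts xs)
  have ts: "\<forall>t\<in>set ts. okt n t" "bnd (length ts)"
    using Node.prems(1) unfolding okt_Node by (auto simp: bnd_def)
  moreover have l: "length xs = total_leaves ts" using Node.prems by simp
  moreover have "ob (tvals M ts xs)" by (rule M.tvals_closed[OF ts(1) Node.prems(2) l])
  ultimately show ?case using Node.IH Node.prems(2) by (simp add: Mf_ids)
next
  case (Cons t ts xs)
  have "ob (take (leaves t) xs)" "ob (drop (leaves t) xs)"
    using Cons.prems by (meson order_trans set_take_subset set_drop_subset)+
  then show ?case using Cons by (simp add: take_map drop_map)
qed simp

lemma tval_comp:
  "okt n T \<Longrightarrow> homs fs xs ys \<Longrightarrow> homs gs ys zs \<Longrightarrow> length fs = leaves T \<Longrightarrow>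
    tval Mf T (map2 comp gs fs) = tval Mf T gs \<bullet> tval Mf T fs"
  and tvals_comp: "\<forall>t\<in>set ts. okt n t \<Longrightarrow> homs fs xs ys \<Longrightarrow> homs gs ys zs \<Longrightarrow>
    length fs = total_leaves ts \<Longrightarrow>
    tvals Mf ts (map2 comp gs fs) = map2 comp (tvals Mf ts gs) (tvals Mf ts fs)"
proof (induction T fs and ts fs arbitrary: xs ys zs gs and xs ys zs gs rule: tree_labels_induct)
  case (Zero fs)
  then show ?case by (simp add: Mf_Nil comp_Idt(1)[OF hom_Idt[OF M_Nil_Obj]])
next
  case (Leaf fs)
  have "length fs = 1" "length gs = 1" using Leaf by (auto dest!: homs_length)
  then obtain f g where "fs = [f]" "gs = [g]" by (auto simp: length_Suc_conv)
  then show ?case by simp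
next
  case (Node ts fs)
  have ts: "\<forall>t\<in>set ts. okt n t" "bnd (length ts)"
    using Node.prems(1) unfolding okt_Node by (auto simp: bnd_def)
  have l: "length fs = total_leaves ts" "length gs = total_leaves ts"
    using Node.prems by (auto dest!: homs_length)
  have "homs (tvals Mf ts fs) (tvals M ts xs) (tvals M ts ys)"
    "homs (tvals Mf ts gs) (tvals M ts ys) (tvals M ts zs)"
    using homs_tvals[OF ts(1) _ l(1)] homs_tvals[OF ts(1) _ l(2)] Node.prems(2,3) by (auto simp: homs_iff)
  from Mf_comp[OF this] show ?case using Node.IH[OF ts(1) Node.prems(2,3) l(1)] ts(2) by simp
next
  case (Cons t ts fs)
  have h: "homs (take k fs) (take k xs) (take k ys)" "homs (take k gs) (take k ys) (take k zs)"
    "homs (drop k fs) (drop k xs) (drop k ys)" "homs (drop k gs) (drop k ys) (drop k zs)" for k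
    using Cons.prems(2,3) by (auto simp: homs_iff simp flip: take_map drop_map dest: in_set_takeD in_set_dropD)
  then show ?case
    using Cons.IH(1)[OF _ h(1) h(2)] Cons.IH(2)[OF _ h(3) h(4)] Cons.prems
    by (simp add: take_map drop_map take_zip drop_zip)
qed simp

section \<open>Composition, naturality and grafting of canonical morphisms\<close>

lemma group_pieces:
  assumes "map tr qs = concat (map sg ps)" "concat (map lb qs) = concat (map lb ps)"
    "\<forall>q\<in>set qs. length (lb q) = leaves (tr q)" "\<forall>p\<in>set ps. length (lb p) = total_leaves (sg p)"
  obtains zs where "ps = map fst zs" "qs = concat (map snd zs)"
    "\<forall>z\<in>set zs. map tr (snd z) = sg (fst z) \<and> concat (map lb (snd z)) = lb (fst z)"
proof -
  have "\<exists>zs. ps = map fst zs \<and> qs = concat (map snd zs) \<and>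
    (\<forall>z\<in>set zs. map tr (snd z) = sg (fst z) \<and> concat (map lb (snd z)) = lb (fst z))"
    using assms
  proof (induction ps arbitrary: qs)
    case Nil then show ?case by simp
  next
    case (Cons p ps)
    let ?k = "length (sg p)"
    have eq: "qs = take ?k qs @ drop ?k qs" by simp
    have 1: "map tr (take ?k qs) = sg p" "map tr (drop ?k qs) = concat (map sg ps)"
      using Cons.prems(1) by (simp_all add: take_map[symmetric] drop_map[symmetric])
    have "\<forall>q\<in>set (take ?k qs). length (lb q) = leaves (tr q)"
      using Cons.prems(3) by (meson in_set_takeD)
    then have "length (concat (map lb (take ?k qs))) = total_leaves (map tr (take ?k qs))"
      by (simp add: length_concat o_def cong: map_cong)
    then have l: "length (concat (map lb (take ?k qs))) = length (lb p)"
      using 1 Cons.prems(4) by simp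
    have "concat (map lb (take ?k qs)) @ concat (map lb (drop ?k qs)) = lb p @ concat (map lb ps)"
      using Cons.prems(2) eq by (metis concat.simps(2) concat_append list.simps(9) map_append)
    then have 2: "concat (map lb (take ?k qs)) = lb p" "concat (map lb (drop ?k qs)) = concat (map lb ps)"
      using l by simp_all
    have "\<forall>q\<in>set (drop ?k qs). length (lb q) = leaves (tr q)"
      using Cons.prems(3) by (meson in_set_dropD)
    from Cons.IH[OF 1(2) 2(2) this] Cons.prems(4) obtain zs where
      zs: "ps = map fst zs" "drop ?k qs = concat (map snd zs)"
      "\<forall>z\<in>set zs. map tr (snd z) = sg (fst z) \<and> concat (map lb (snd z)) = lb (fst z)" by auto
    show ?case
      using zs 1(1) 2(1) eq by (intro exI[of _ "(p, take ?k qs) # zs"]) auto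
  qed
  then show thesis using that by blast
qed

lemma ct_pieces_typing:
  assumes "\<forall>p\<in>set ps. sg p \<noteq> [] \<and> (\<forall>t\<in>set (sg p). okt n t) \<and> ct (tr p) (mk_node (sg p)) (lb p) (ar p)"
  shows "\<forall>p\<in>set ps. sg p \<noteq> [] \<and> (\<forall>t\<in>set (sg p). okt n t) \<and> ctt (tr p) (mk_node (sg p)) (lb p) (ar p)"
  using assms ct_ctt by blast

text \<open>A piece of the composite leads from a tree of the source to the concatenation of the
  segments into which its own segment is contracted. Its morphism comes from the induction
  hypothesis for the tree \<open>mk_node (sg p)\<close>. That tree need not be a new node, hence the
  use of \<open>ct_mk\<close>.\<close>

lemma ct_trans: "ct T T' xs f \<Longrightarrow> ct T' T'' xs g \<Longrightarrow> ct T T'' xs (g \<bullet> f)"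
proof (induction arbitrary: T'' g rule: ct.induct)
  case ct_Zero
  then show ?case using ct_Zero_left[OF ct_Zero] comp_Idt(1)[OF hom_Idt[OF M_Nil_Obj]]
    by (simp add: ct.ct_Zero)
next
  case (ct_Leaf x)
  from ct_Leaf(2) have "T'' = Leaf \<and> g = Idt C x" by (rule ct.cases) auto
  then show ?case using ct_Leaf(1) comp_Idt(1)[OF hom_Idt[OF ct_Leaf(1)]] by (simp add: ct.ct_Leaf)
next
  case (ct_Node ps)
  from ct_Node.prems obtain qs where q: "concat (map sg ps) = map tr qs" "T'' = Node (concat (map sg qs))"
    "concat (map lb ps) = concat (map lb qs)" "g = gamma (map vals qs) \<bullet> Mf (map ar qs)"
    "bnd (length (concat (map sg qs)))"
    and qq: "\<forall>p\<in>set qs. ct (tr p) (mk_node (sg p)) (lb p) (ar p) \<and> tr p \<noteq> Zero \<and> sg p \<noteq> [] \<and>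
      (\<forall>t\<in>set (sg p). stable n t)"
    by (rule ct_Node_inv)
  have cp: "\<forall>p\<in>set ps. sg p \<noteq> [] \<and> (\<forall>t\<in>set (sg p). okt n t) \<and> ct (tr p) (mk_node (sg p)) (lb p) (ar p)"
    using ct_Node.IH by blast
  have cq: "\<forall>p\<in>set qs. sg p \<noteq> [] \<and> (\<forall>t\<in>set (sg p). okt n t) \<and> ct (tr p) (mk_node (sg p)) (lb p) (ar p)"
    using qq by blast
  note P = pieces_typing[OF ct_pieces_typing[OF cp] ct_Node.hyps(2)]
  note Q = pieces_typing[OF ct_pieces_typing[OF cq] q(5)]
  have lq: "\<forall>q\<in>set qs. length (lb q) = leaves (tr q)" using qq ct_leaves(2) by blast
  have lp: "\<forall>p\<in>set ps. length (lb p) = total_leaves (sg p)"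
  proof
    fix p assume "p \<in> set ps"
    then have "ct (tr p) (mk_node (sg p)) (lb p) (ar p)" using cp by blast
    from ct_leaves[OF this] show "length (lb p) = total_leaves (sg p)" by simp
  qed
  \<comment> \<open>The trees above the root of the middle tree form the segments of
    \<open>ps\<close> and are the sources of \<open>qs\<close>. Each piece of \<open>ps\<close> is
    joined with the pieces of \<open>qs\<close> that continue it.\<close>
  obtain zs where zs: "ps = map fst zs" "qs = concat (map snd zs)"
    "\<forall>z\<in>set zs. map tr (snd z) = sg (fst z) \<and> concat (map lb (snd z)) = lb (fst z)"
    by (rule group_pieces[OF q(1)[symmetric] q(3)[symmetric] lq lp])
  define h :: "('o, 'm) piece \<times> ('o, 'm) piece list \<Rightarrow> 'm" where
    "h = (\<lambda>z. (gamma (map vals (snd z)) \<bullet> Mf (map ar (snd z))) \<bullet> ar (fst z))"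
  define r :: "('o, 'm) piece \<times> ('o, 'm) piece list \<Rightarrow> ('o, 'm) piece" where
    "r = (\<lambda>z. Piece (tr (fst z)) (concat (map sg (snd z))) (lb (fst z)) (h z))"
  have inq: "set (snd z) \<subseteq> set qs" if "z \<in> set zs" for z using that zs(2) by auto
  have bq: "bnd (length (concat (map sg (snd z))))" if "z \<in> set zs" for z
  proof -
    obtain a b where "zs = a @ z # b" using split_list[OF \<open>z \<in> set zs\<close>] by blast
    then show ?thesis using q(5) zs(2) by (auto elim!: bnd_mono)
  qed
  have cz: "\<forall>p\<in>set (snd z). sg p \<noteq> [] \<and> (\<forall>t\<in>set (sg p). okt n t) \<and> ct (tr p) (mk_node (sg p)) (lb p) (ar p)"
    if "z \<in> set zs" for z using cq inq[OF that] by blast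
  have Z: "gok [] (map vals (snd z)) []"
    "homs (map ar (snd z)) (vals (fst z)) (map M (map vals (snd z)))"
    "vals (r z) = concat (map vals (snd z))"
    "hom (gamma (map vals (snd z)) \<bullet> Mf (map ar (snd z))) (M (vals (fst z))) (M (vals (r z)))"
    "snd z \<noteq> []"
    if z: "z \<in> set zs" for z
  proof -
    note W = pieces_typing[OF ct_pieces_typing[OF cz[OF z]] bq[OF z]]
    have e: "map tr (snd z) = sg (fst z)" "concat (map lb (snd z)) = lb (fst z)" using zs(3) z by auto
    show v: "vals (r z) = concat (map vals (snd z))" using W(4) e by (simp add: vals_def r_def)
    show "gok [] (map vals (snd z)) []" by (rule W(1))
    show "homs (map ar (snd z)) (vals (fst z)) (map M (map vals (snd z)))"
      using W(3) unfolding vals_def[of "fst z"] by (simp only: e)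
    show "hom (gamma (map vals (snd z)) \<bullet> Mf (map ar (snd z))) (M (vals (fst z))) (M (vals (r z)))"
      using W(5) unfolding vals_def[of "fst z"] v by (simp only: e)
    have "sg (fst z) \<noteq> []" using cp zs(1) z by auto
    then show "snd z \<noteq> []" using e by auto
  qed
  have ar: "hom (ar (fst z)) (tval M (tr (fst z)) (lb (fst z))) (M (vals (fst z)))" if "z \<in> set zs" for z
    using P(2) ct_pieces_typing[OF cp] that zs(1) by (auto simp: ctt_def)
  have bz: "bnd (length zs)" using P(8) ct_Node.hyps(2) zs(1) by (auto elim!: bnd_mono)
  have lz: "2 \<le> length zs" using ct_Node.hyps(1) zs(1) by simp
  have "ct (Node (map tr (map r zs))) (Node (concat (map sg (map r zs)))) (concat (map lb (map r zs)))
      (gamma (map vals (map r zs)) \<bullet> Mf (map ar (map r zs)))"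
  proof (rule ct.ct_Node)
    show "2 \<le> length (map r zs)" using lz by simp
    have "concat (map sg (map r zs)) = concat (map sg qs)"
      unfolding zs(2) r_def by (induction zs) auto
    then show "bnd (length (concat (map sg (map r zs))))" using q(5) by simp
    show "\<forall>p\<in>set (map r zs). ct (tr p) (mk_node (sg p)) (lb p) (ar p) \<and> tr p \<noteq> Zero \<and> sg p \<noteq> [] \<and>
      (\<forall>t\<in>set (sg p). stable n t)"
    proof
      fix p assume "p \<in> set (map r zs)"
      then obtain z where z: "z \<in> set zs" and p: "p = r z" by auto
      have e: "map tr (snd z) = sg (fst z)" "concat (map lb (snd z)) = lb (fst z)" using zs(3) z by auto
      have "fst z \<in> set ps" using zs(1) z by simp
      then have IH: "ct (mk_node (sg (fst z))) T (lb (fst z)) k \<Longrightarrow> ct (tr (fst z)) T (lb (fst z)) (k \<bullet> ar (fst z))"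
        and "tr (fst z) \<noteq> Zero" for T k
        using ct_Node.IH by blast+
      moreover have "ct (mk_node (sg (fst z))) (mk_node (concat (map sg (snd z)))) (lb (fst z))
          (gamma (map vals (snd z)) \<bullet> Mf (map ar (snd z)))"
        using ct_mk[OF cz[OF z] bq[OF z]] e by simp
      moreover have "concat (map sg (snd z)) \<noteq> []" using cz[OF z] Z(5)[OF z] by (cases "snd z") auto
      moreover have "\<forall>t\<in>set (concat (map sg (snd z))). stable n t" using qq inq[OF z] by auto
      ultimately show "ct (tr p) (mk_node (sg p)) (lb p) (ar p) \<and> tr p \<noteq> Zero \<and> sg p \<noteq> [] \<and>
        (\<forall>t\<in>set (sg p). stable n t)"
        unfolding p by (simp add: r_def h_def)
    qed
  qed
  moreover have "map tr (map r zs) = map tr ps" by (simp add: r_def zs(1))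
  moreover have "concat (map sg (map r zs)) = concat (map sg qs)"
    unfolding zs(2) r_def by (induction zs) auto
  moreover have "concat (map lb (map r zs)) = concat (map lb ps)" by (simp add: r_def zs(1) o_def)
  moreover have "gamma (map vals (map r zs)) \<bullet> Mf (map ar (map r zs)) =
      g \<bullet> gamma (map vals ps) \<bullet> Mf (map ar ps)"
  proof -
    let ?xs = "map (\<lambda>z. map vals (snd z)) zs"
    let ?G = "gamma (map vals (map r zs))" and ?A = "Mf (map (\<lambda>z. ar (fst z)) zs)"
      and ?B = "Mf (map (\<lambda>z. Mf (map ar (snd z))) zs)" and ?D = "Mf (map (\<lambda>z. gamma (map vals (snd z))) zs)"
      and ?E = "gamma (concat ?xs)" and ?F = "gamma (map (map M) ?xs)"
      and ?H = "gamma (map vals ps)" and ?I = "Mf (map ar qs)"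
    have c: "concat ?xs = map vals qs" unfolding zs(2) by (induction zs) auto
    have G: "map vals (map r zs) = map concat ?xs" using Z(3) by simp
    have 1: "?E \<bullet> ?F = ?G \<bullet> ?D"
      using gamma_assoc[of ?xs] Q(1) Z(5) c unfolding G by (simp add: o_def)
    have vp: "map vals ps = map (\<lambda>z. vals (fst z)) zs" by (simp add: zs(1))
    have 2: "?F \<bullet> ?B = ?I \<bullet> ?H"
    proof -
      have "gamma (map (\<lambda>z. map M (map vals (snd z))) zs) \<bullet> ?B =
          Mf (concat (map (\<lambda>z. map ar (snd z)) zs)) \<bullet> gamma (map (\<lambda>z. vals (fst z)) zs)"
        using Z(2) P(1) unfolding vp by (intro gamma_nat) auto
      moreover have "concat (map (\<lambda>z. map ar (snd z)) zs) = map ar qs"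
        unfolding zs(2) by (induction zs) auto
      ultimately show ?thesis by (simp add: vp o_def)
    qed
    have bz2: "bnd (length (snd z))" if "z \<in> set zs" for z
      using pieces_typing(8)[OF ct_pieces_typing[OF cz[OF that]] bq[OF that]] bq[OF that] by (auto elim!: bnd_mono)
    have hB: "\<forall>z\<in>set zs. hom (Mf (map ar (snd z))) (M (vals (fst z))) (M (map M (map vals (snd z))))"
      using hom_Mf[OF Z(2)] bz2 by simp
    have hD: "\<forall>z\<in>set zs. hom (gamma (map vals (snd z))) (M (map M (map vals (snd z)))) (M (vals (r z)))"
      using hom_G[OF Z(1)] Z(3) by (simp add: gamma_def)
    have hA: "\<forall>z\<in>set zs. hom (ar (fst z)) (tval M (tr (fst z)) (lb (fst z))) (M (vals (fst z)))"
      using ar by blast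
    have 3: "?D \<bullet> ?B = Mf (map (\<lambda>z. gamma (map vals (snd z)) \<bullet> Mf (map ar (snd z))) zs)"
      using hB hD bz
      by (intro Mf_comp_map[where x = "\<lambda>z. M (vals (fst z))" and y = "\<lambda>z. M (map M (map vals (snd z)))"
          and w = "\<lambda>z. M (vals (r z))"]) auto
    have hDB: "\<forall>z\<in>set zs. hom (gamma (map vals (snd z)) \<bullet> Mf (map ar (snd z))) (M (vals (fst z))) (M (vals (r z)))"
      using Z(4) by blast
    have 4: "Mf (map (\<lambda>z. gamma (map vals (snd z)) \<bullet> Mf (map ar (snd z))) zs) \<bullet> ?A = Mf (map h zs)"
      unfolding h_def using hA hDB bz
      by (intro Mf_comp_map[where x = "\<lambda>z. tval M (tr (fst z)) (lb (fst z))"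
          and y = "\<lambda>z. M (vals (fst z))" and w = "\<lambda>z. M (vals (r z))"]) auto
    have hms: "hom ?A (M (map (\<lambda>z. tval M (tr (fst z)) (lb (fst z))) zs)) (M (map (\<lambda>z. M (vals (fst z))) zs))"
      "hom ?B (M (map (\<lambda>z. M (vals (fst z))) zs)) (M (map (\<lambda>z. M (map M (map vals (snd z)))) zs))"
      "hom ?D (M (map (\<lambda>z. M (map M (map vals (snd z)))) zs)) (M (map (\<lambda>z. M (vals (r z))) zs))"
      using hom_Mf[OF homs_map[OF hA]] hom_Mf[OF homs_map[OF hB]] hom_Mf[OF homs_map[OF hD]] bz by simp_all
    have hG: "hom ?G (M (map (\<lambda>z. M (vals (r z))) zs)) (M (concat (map vals (map r zs))))"
    proof -
      have "gok [] (map vals (map r zs)) []"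
      proof -
        have "concat (map vals (map r zs)) = concat (map vals qs)"
          unfolding G concat_map_concat c ..
        moreover have "vals (r z) \<noteq> [] \<and> ob (vals (r z))" if "z \<in> set zs" for z
          using Z(1)[OF that] Z(5)[OF that] Z(3)[OF that] by (cases "snd z") (auto simp: gok_def)
        ultimately show ?thesis using Q(1) by (simp add: gok_def)
      qed
      from hom_G[OF this] show ?thesis by (simp add: gamma_def o_def)
    qed
    have hE: "hom ?E (M (map M (concat ?xs))) (M (concat (concat ?xs)))"
      using hom_G[OF Q(1)] unfolding c by (simp add: gamma_def)
    have hI: "hom ?I (M (concat (map vals ps))) (M (map M (concat ?xs)))"
    proof -
      have "length qs = length (concat (map sg ps))" using q(1) by (metis length_map)
      then show ?thesis using hom_Mf[OF Q(3)] ct_Node.hyps(2) P(4) q(1,3) unfolding c by simp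
    qed
    have hH: "hom ?H (M (map M (map vals ps))) (M (concat (map vals ps)))"
      using hom_G[OF P(1)] by (simp add: gamma_def)
    have vps: "M (map M (map vals ps)) = M (map (\<lambda>z. M (vals (fst z))) zs)" by (simp add: vp o_def)
    have hF: "hom ?F (M (map (\<lambda>z. M (map M (map vals (snd z)))) zs)) (M (map M (concat ?xs)))"
    proof -
      have "gok [] (map (map M) ?xs) []"
      proof -
        have "bnd (length (concat (map (map M) ?xs)))"
          using Q(8) q(5) c by (metis bnd_mono length_map map_concat)
        moreover have "snd z \<noteq> [] \<and> ob (map M (map vals (snd z)))" if "z \<in> set zs" for z
          using Z(5)[OF that] gok_M[OF Z(1)[OF that]] by simp
        ultimately show ?thesis by (auto simp: gok_def)
      qed
      from hom_G[OF this] show ?thesis by (simp add: gamma_def o_def map_concat)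
    qed
    have A: "map ar ps = map (\<lambda>z. ar (fst z)) zs" by (simp add: zs(1))
    have "g \<bullet> ?H \<bullet> ?A = ?E \<bullet> (?I \<bullet> ?H) \<bullet> ?A"
      unfolding q(4) c[symmetric] using hE hI hH hms vps by (simp add: cat_simps)
    also have "\<dots> = (?E \<bullet> ?F) \<bullet> ?B \<bullet> ?A"
      unfolding 2[symmetric] using hE hF hms by (simp add: cat_simps)
    also have "\<dots> = ?G \<bullet> (?D \<bullet> ?B) \<bullet> ?A"
      unfolding 1 using hG hms by (simp add: cat_simps)
    also have "\<dots> = ?G \<bullet> Mf (map h zs)" by (simp only: 3 4)
    also have "map h zs = map ar (map r zs)" by (simp add: r_def)
    finally show ?thesis by (simp only: A)
  qed
  ultimately show ?case using q(2) by simp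
qed

end

lemma concat_eq_pointwise:
  assumes "concat (map a zs) = concat (map b zs)" "\<forall>z\<in>set zs. length (a z) = length (b z)"
  shows "\<forall>z\<in>set zs. a z = b z"
  using assms by (induction zs) auto

lemma sum_list_length: "sum_list (map (\<lambda>p. length (l p)) ps) = length (concat (map l ps))"
  by (simp add: length_concat o_def)

context monoidal begin

text \<open>The morphism at the new labels is constructed together with its naturality square;
  uniqueness identifies it afterwards. At a node, the squares of the pieces are combined with
  naturality of \<open>gamma\<close>.\<close>

lemma ct_nat:
  "ct T T' xs f \<Longrightarrow> homs hs xs ys \<Longrightarrow>
    \<exists>g. ct T T' ys g \<and> g \<bullet> tval Mf T hs = tval Mf T' hs \<bullet> f"
proof (induction arbitrary: hs ys rule: ct.induct)
  case ct_Zero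
  then show ?case using ct.ct_Zero by (auto simp: Mf_Nil homs_iff)
next
  case (ct_Leaf x)
  then obtain h y where "hs = [h]" "ys = [y]" "hom h x y"
    by (auto simp: homs_iff hom_def)
  then show ?case using ct.ct_Leaf[of y] hom_Obj(2)[of h x y]
    by (auto simp: comp_Idt intro!: exI[of _ "Idt C y"])
next
  case (ct_Node ps)
  have cp: "\<forall>p\<in>set ps. sg p \<noteq> [] \<and> (\<forall>t\<in>set (sg p). okt n t) \<and> ct (tr p) (mk_node (sg p)) (lb p) (ar p)"
    using ct_Node.IH by blast
  note P = pieces_typing[OF ct_pieces_typing[OF cp] ct_Node.hyps(2)]
  have "length hs = sum_list (map (\<lambda>p. length (lb p)) ps)"
    unfolding sum_list_length using homs_length[OF ct_Node.prems] by simp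
  then obtain zs where zs: "ps = map fst zs" "hs = concat (map snd zs)"
    "\<forall>z\<in>set zs. length (snd z) = length (lb (fst z))" by (rule split_lengths)
  have "\<forall>z\<in>set zs. map (Src C) (snd z) = lb (fst z)"
  proof (rule concat_eq_pointwise)
    have "map (Src C) hs = concat (map lb ps)" using ct_Node.prems by (simp add: homs_iff)
    then show "concat (map (\<lambda>z. map (Src C) (snd z)) zs) = concat (map (\<lambda>z. lb (fst z)) zs)"
      by (simp add: zs map_concat o_def)
  qed (use zs(3) in simp)
  moreover have hA: "\<forall>z\<in>set zs. set (snd z) \<subseteq> Arr C"
    using ct_Node.prems by (auto simp: homs_iff zs(2))
  ultimately have hz: "\<forall>z\<in>set zs. homs (snd z) (lb (fst z)) (map (Tgt C) (snd z))"
    by (simp add: homs_iff)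
  have ys: "ys = concat (map (\<lambda>z. map (Tgt C) (snd z)) zs)"
    using ct_Node.prems by (auto simp: homs_iff zs(2) map_concat o_def)
  have "\<forall>z\<in>set zs. \<exists>g. ct (tr (fst z)) (mk_node (sg (fst z))) (map (Tgt C) (snd z)) g \<and>
      g \<bullet> tval Mf (tr (fst z)) (snd z) = tval Mf (mk_node (sg (fst z))) (snd z) \<bullet> ar (fst z)"
  proof
    fix z assume z: "z \<in> set zs"
    then have "fst z \<in> set ps" by (simp add: zs(1))
    then show "\<exists>g. ct (tr (fst z)) (mk_node (sg (fst z))) (map (Tgt C) (snd z)) g \<and>
      g \<bullet> tval Mf (tr (fst z)) (snd z) = tval Mf (mk_node (sg (fst z))) (snd z) \<bullet> ar (fst z)"
      using ct_Node.IH hz z by blast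
  qed
  \<comment> \<open>The morphisms at the target labels are chosen for all pieces at once, since they
    enter the definition of the new pieces.\<close>
  from bchoice[OF this] obtain k where k: "\<forall>z\<in>set zs.
      ct (tr (fst z)) (mk_node (sg (fst z))) (map (Tgt C) (snd z)) (k z) \<and>
      k z \<bullet> tval Mf (tr (fst z)) (snd z) = tval Mf (mk_node (sg (fst z))) (snd z) \<bullet> ar (fst z)"
    by blast
  define r :: "('o, 'm) piece \<times> 'm list \<Rightarrow> ('o, 'm) piece" where
    "r = (\<lambda>z. Piece (tr (fst z)) (sg (fst z)) (map (Tgt C) (snd z)) (k z))"
  have inp: "fst z \<in> set ps" if "z \<in> set zs" for z using that zs(1) by simp
  have "concat (map sg (map r zs)) = concat (map sg ps)"
    by (simp add: r_def zs(1) o_def)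
  moreover have R: "\<forall>p\<in>set (map r zs). ct (tr p) (mk_node (sg p)) (lb p) (ar p) \<and> tr p \<noteq> Zero \<and> sg p \<noteq> [] \<and>
      (\<forall>t\<in>set (sg p). stable n t)"
  proof
    fix p assume "p \<in> set (map r zs)"
    then obtain z where z: "z \<in> set zs" "p = r z" by auto
    then show "ct (tr p) (mk_node (sg p)) (lb p) (ar p) \<and> tr p \<noteq> Zero \<and> sg p \<noteq> [] \<and>
      (\<forall>t\<in>set (sg p). stable n t)"
      using ct_Node.IH inp[OF z(1)] k by (simp add: r_def)
  qed
  ultimately have "ct (Node (map tr (map r zs))) (Node (concat (map sg ps))) (concat (map lb (map r zs)))
      (gamma (map vals (map r zs)) \<bullet> Mf (map ar (map r zs)))"
    using ct.ct_Node[of "map r zs"] ct_Node.hyps by (simp add: zs(1))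
  moreover have "map tr (map r zs) = map tr ps" "concat (map lb (map r zs)) = ys"
    by (simp_all add: r_def zs(1) ys o_def)
  moreover have "(gamma (map vals (map r zs)) \<bullet> Mf (map ar (map r zs))) \<bullet> tval Mf (Node (map tr ps)) hs =
      tval Mf (Node (concat (map sg ps))) hs \<bullet> gamma (map vals ps) \<bullet> Mf (map ar ps)"
  proof -
    let ?A = "\<lambda>z. tval Mf (tr (fst z)) (snd z)" and ?B = "\<lambda>z. tvals Mf (sg (fst z)) (snd z)"
    have lz: "length (snd z) = leaves (tr (fst z))" "length (snd z) = total_leaves (sg (fst z))"
      and okz: "okt n (tr (fst z))" "\<forall>t\<in>set (sg (fst z)). okt n t" "bnd (length (sg (fst z)))"
      if z: "z \<in> set zs" for z
    proof -
      have c: "ct (tr (fst z)) (mk_node (sg (fst z))) (lb (fst z)) (ar (fst z))"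
        using cp inp[OF z] by blast
      show "length (snd z) = leaves (tr (fst z))" "length (snd z) = total_leaves (sg (fst z))"
        using ct_leaves[OF c] zs(3) z by simp_all
      show "okt n (tr (fst z))" using ct_ctt[OF c] by (simp add: ctt_def)
      show "\<forall>t\<in>set (sg (fst z)). okt n t" using cp inp[OF z] by blast
      show "bnd (length (sg (fst z)))"
        using length_le_concat_map[OF inp[OF z], of sg] ct_Node.hyps(2) by (rule bnd_mono[rotated])
    qed
    have tA: "tval Mf (Node (map tr ps)) hs = Mf (map ?A zs)"
      using tvals_map_concat[of zs snd "\<lambda>z. tr (fst z)" Mf] lz by (simp add: zs(1,2) o_def)
    have tB: "tval Mf (Node (concat (map sg ps))) hs = Mf (concat (map ?B zs))"
      using tvals_concat_concat[of zs snd "\<lambda>z. sg (fst z)" Mf] lz by (simp add: zs(1,2) o_def)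
    have mB: "tval Mf (mk_node (sg (fst z))) (snd z) = Mf (?B z)" if "z \<in> set zs" for z
      using okz[OF that] lz[OF that] hA that by (intro Mf.tval_mk_node) (auto simp: bnd_def)
    have hB: "homs (?B z) (vals (fst z)) (vals (r z))" if z: "z \<in> set zs" for z
    proof -
      have "map (Src C) (snd z) = lb (fst z)" using hz z by (simp add: homs_iff)
      then show ?thesis using homs_tvals[OF okz(2)[OF z] _ lz(2)[OF z]] hA z by (simp add: vals_def r_def)
    qed
    have hAz: "hom (?A z) (tval M (tr (fst z)) (lb (fst z))) (tval M (tr (fst z)) (map (Tgt C) (snd z)))"
      if z: "z \<in> set zs" for z
    proof -
      have "map (Src C) (snd z) = lb (fst z)" using hz z by (simp add: homs_iff)
      then show ?thesis using hom_tval[OF okz(1)[OF z] _ lz(1)[OF z]] hA z by simp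
    qed
    have cr: "\<forall>p\<in>set (map r zs). sg p \<noteq> [] \<and> (\<forall>t\<in>set (sg p). okt n t) \<and> ct (tr p) (mk_node (sg p)) (lb p) (ar p)"
      using R by blast
    have br: "bnd (length (concat (map sg (map r zs))))"
      using ct_Node.hyps(2) by (simp add: r_def zs(1) o_def)
    note RT = pieces_typing[OF ct_pieces_typing[OF cr] br]
    have hk: "hom (k z) (tval M (tr (fst z)) (map (Tgt C) (snd z))) (M (vals (r z)))" if z: "z \<in> set zs" for z
    proof -
      have "tval M (mk_node (sg (r z))) (lb (r z)) = M (vals (r z))" using RT(2) z by simp
      moreover have "ctt (tr (fst z)) (mk_node (sg (fst z))) (map (Tgt C) (snd z)) (k z)" using k z ct_ctt by blast
      ultimately show ?thesis by (simp add: ctt_def r_def)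
    qed
    have ha: "hom (ar (fst z)) (tval M (tr (fst z)) (lb (fst z))) (M (vals (fst z)))" if "z \<in> set zs" for z
      using P(2) ct_pieces_typing[OF cp] inp[OF that] by (auto simp: ctt_def)
    have bz: "bnd (length zs)" using P(8) ct_Node.hyps(2) zs(1) by (auto elim!: bnd_mono)
    have hMB: "hom (Mf (?B z)) (M (vals (fst z))) (M (vals (r z)))" if "z \<in> set zs" for z
      using hom_Mf[OF hB[OF that]] okz(3)[OF that] by simp
    let ?K = "Mf (map k zs)" and ?MA = "Mf (map ?A zs)" and ?MB = "Mf (map (\<lambda>z. Mf (?B z)) zs)"
      and ?R = "Mf (map (\<lambda>z. ar (fst z)) zs)" and ?Y = "gamma (map (\<lambda>z. vals (r z)) zs)"
      and ?X = "gamma (map (\<lambda>z. vals (fst z)) zs)" and ?C = "Mf (concat (map ?B zs))"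
    have "?K \<bullet> ?MA = Mf (map (\<lambda>z. k z \<bullet> ?A z) zs)"
      using hAz hk bz by (intro Mf_comp_map[where x = "\<lambda>z. tval M (tr (fst z)) (lb (fst z))"
          and y = "\<lambda>z. tval M (tr (fst z)) (map (Tgt C) (snd z))" and w = "\<lambda>z. M (vals (r z))"]) auto
    also have "map (\<lambda>z. k z \<bullet> ?A z) zs = map (\<lambda>z. Mf (?B z) \<bullet> ar (fst z)) zs"
      using k mB by simp
    also have "Mf \<dots> = ?MB \<bullet> ?R"
      using ha hMB bz by (intro Mf_comp_map[symmetric, where x = "\<lambda>z. tval M (tr (fst z)) (lb (fst z))"
          and y = "\<lambda>z. M (vals (fst z))" and w = "\<lambda>z. M (vals (r z))"]) auto
    finally have 1: "?K \<bullet> ?MA = ?MB \<bullet> ?R" .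
    have vp: "map vals ps = map (\<lambda>z. vals (fst z)) zs" by (simp add: zs(1))
    have 2: "?Y \<bullet> ?MB = ?C \<bullet> ?X"
      using hB P(1) unfolding vp by (intro gamma_nat) auto
    have hms: "hom ?MA (M (map (\<lambda>z. tval M (tr (fst z)) (lb (fst z))) zs)) (M (map (\<lambda>z. tval M (tr (fst z)) (map (Tgt C) (snd z))) zs))"
      "hom ?K (M (map (\<lambda>z. tval M (tr (fst z)) (map (Tgt C) (snd z))) zs)) (M (map (\<lambda>z. M (vals (r z))) zs))"
      "hom ?MB (M (map (\<lambda>z. M (vals (fst z))) zs)) (M (map (\<lambda>z. M (vals (r z))) zs))"
      "hom ?R (M (map (\<lambda>z. tval M (tr (fst z)) (lb (fst z))) zs)) (M (map (\<lambda>z. M (vals (fst z))) zs))"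
      by (rule hom_Mf[OF homs_map]; use bz hAz hk hMB ha in simp)+
    have hY: "hom ?Y (M (map (\<lambda>z. M (vals (r z))) zs)) (M (concat (map (\<lambda>z. vals (r z)) zs)))"
      using hom_G[OF RT(1)] by (simp add: gamma_def o_def)
    have hX: "hom ?X (M (map (\<lambda>z. M (vals (fst z))) zs)) (M (concat (map (\<lambda>z. vals (fst z)) zs)))"
      using hom_G[OF P(1)[unfolded vp]] by (simp add: gamma_def o_def)
    have hC: "hom ?C (M (concat (map (\<lambda>z. vals (fst z)) zs))) (M (concat (map (\<lambda>z. vals (r z)) zs)))"
    proof (rule hom_Mf)
      show "homs (concat (map ?B zs)) (concat (map (\<lambda>z. vals (fst z)) zs)) (concat (map (\<lambda>z. vals (r z)) zs))"
        using hB by (induction zs) (auto intro!: homs_append)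
      have "length (concat (map ?B zs)) = length (concat (map sg ps))"
        by (simp add: length_concat zs(1) o_def)
      then show "bnd (length (concat (map ?B zs)))" using ct_Node.hyps(2) by simp
    qed
    have "(?Y \<bullet> ?K) \<bullet> ?MA = ?Y \<bullet> ?K \<bullet> ?MA" using hms hY by (simp add: cat_simps)
    also have "\<dots> = (?Y \<bullet> ?MB) \<bullet> ?R" unfolding 1 using hms hY by (simp add: cat_simps)
    also have "\<dots> = ?C \<bullet> ?X \<bullet> ?R" unfolding 2 using hms hX hC by (simp add: cat_simps)
    finally show ?thesis unfolding tA tB by (simp add: zs(1) o_def r_def)
  qed
  ultimately show ?case by metis
qed

text \<open>Compatibility with the operad composition. The grafted trees are contracted first and
  \<open>S\<close> afterwards, so \<open>S\<close> carries as labels the values of the targets of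
  the grafted arrows. Nodes that collapse are taken care of by \<open>ct_mk\<close>.\<close>

lemma ct_graft:
  assumes "ct S S' xs f"
    and "\<forall>q\<in>set qs. ct (tr q) (mk_node (sg q)) (lb q) (ar q)"
    and "xs = map (\<lambda>q. tval M (mk_node (sg q)) (lb q)) qs"
  shows "ct (tval mk_node S (map tr qs)) (tval mk_node S' (map (\<lambda>q. mk_node (sg q)) qs))
    (concat (map lb qs)) (f \<bullet> tval Mf S (map ar qs))"
  using assms
proof (induction arbitrary: qs rule: ct.induct)
  case ct_Zero
  then show ?case by (simp add: Mf_Nil ct.ct_Zero comp_Idt(1)[OF hom_Idt[OF M_Nil_Obj]])
next
  case (ct_Leaf x)
  then obtain q where q: "qs = [q]" "x = tval M (mk_node (sg q)) (lb q)"
    "ct (tr q) (mk_node (sg q)) (lb q) (ar q)" by auto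
  have "hom (ar q) (tval M (tr q) (lb q)) x" using ct_ctt[OF q(3)] q(2) by (simp add: ctt_def)
  then show ?case using q by (simp add: comp_Idt)
next
  case (ct_Node ps)
  let ?tg = "\<lambda>q. mk_node (sg q)" and ?v = "\<lambda>q. tval M (mk_node (sg q)) (lb q)"
  have cp: "\<forall>p\<in>set ps. sg p \<noteq> [] \<and> (\<forall>t\<in>set (sg p). okt n t) \<and> ct (tr p) (mk_node (sg p)) (lb p) (ar p)"
    using ct_Node.IH by blast
  note P = pieces_typing[OF ct_pieces_typing[OF cp] ct_Node.hyps(2)]
  have "length qs = sum_list (map (\<lambda>p. length (lb p)) ps)"
    unfolding sum_list_length ct_Node.prems(2) by simp
  then obtain zs where zs: "ps = map fst zs" "qs = concat (map snd zs)"
    "\<forall>z\<in>set zs. length (snd z) = length (lb (fst z))" by (rule split_lengths)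
  have lbz: "\<forall>z\<in>set zs. map ?v (snd z) = lb (fst z)"
  proof (rule concat_eq_pointwise)
    show "concat (map (\<lambda>z. map ?v (snd z)) zs) = concat (map (\<lambda>z. lb (fst z)) zs)"
      using ct_Node.prems(2) by (simp add: zs(1,2) map_concat o_def)
  qed (use zs(3) in simp)
  have inp: "fst z \<in> set ps" if "z \<in> set zs" for z using that zs(1) by simp
  have cQ: "\<forall>q\<in>set (snd z). ct (tr q) (?tg q) (lb q) (ar q)" if "z \<in> set zs" for z
    using ct_Node.prems(1) that zs(2) by auto
  have Q: "okt n (tr q)" "okt n (?tg q)" "ob (lb q)" "length (lb q) = leaves (tr q)" "length (lb q) = leaves (?tg q)"
    "hom (ar q) (tval M (tr q) (lb q)) (?v q)"
    if "z \<in> set zs" "q \<in> set (snd z)" for z q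
    using ct_ctt[OF cQ[OF that(1), rule_format, OF that(2)]] by (auto simp: ctt_def)
  have Pz: "length (snd z) = leaves (tr (fst z))" "length (snd z) = total_leaves (sg (fst z))"
    "okt n (tr (fst z))" "\<forall>t\<in>set (sg (fst z)). okt n t" "bnd (length (sg (fst z)))" "sg (fst z) \<noteq> []"
    if z: "z \<in> set zs" for z
  proof -
    have c: "ct (tr (fst z)) (mk_node (sg (fst z))) (lb (fst z)) (ar (fst z))"
      using cp inp[OF z] by blast
    show "length (snd z) = leaves (tr (fst z))" "length (snd z) = total_leaves (sg (fst z))"
      using ct_leaves[OF c] zs(3) z by simp_all
    show "okt n (tr (fst z))" using ct_ctt[OF c] by (simp add: ctt_def)
    show "\<forall>t\<in>set (sg (fst z)). okt n t" "sg (fst z) \<noteq> []" using cp inp[OF z] by blast+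
    show "bnd (length (sg (fst z)))"
      using length_le_concat_map[OF inp[OF z], of sg] ct_Node.hyps(2) by (rule bnd_mono[rotated])
  qed
  define r :: "('o, 'm) piece \<times> ('o, 'm) piece list \<Rightarrow> ('o, 'm) piece" where
    "r = (\<lambda>z. Piece (tval mk_node (tr (fst z)) (map tr (snd z))) (tvals mk_node (sg (fst z)) (map ?tg (snd z)))
       (concat (map lb (snd z))) (ar (fst z) \<bullet> tval Mf (tr (fst z)) (map ar (snd z))))"
  have R: "ct (mk_node (map tr (map r zs))) (mk_node (concat (map sg (map r zs)))) (concat (map lb (map r zs)))
      (gamma (map vals (map r zs)) \<bullet> Mf (map ar (map r zs)))"
  proof (rule ct_mk)
    have "length (concat (map sg (map r zs))) = length (concat (map sg ps))"
      by (simp add: length_concat r_def zs(1) o_def)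
    then show "bnd (length (concat (map sg (map r zs))))" using ct_Node.hyps(2) by simp
    show "\<forall>p\<in>set (map r zs). sg p \<noteq> [] \<and> (\<forall>t\<in>set (sg p). okt n t) \<and> ct (tr p) (mk_node (sg p)) (lb p) (ar p)"
    proof
      fix p assume "p \<in> set (map r zs)"
      then obtain z where z: "z \<in> set zs" and p: "p = r z" by auto
      have ne: "tvals mk_node (sg (fst z)) (map ?tg (snd z)) \<noteq> []"
        using Pz(6)[OF z] by (metis length_0_conv length_tvals)
      have ok: "\<forall>T\<in>set (map ?tg (snd z)). okt n T" using Q(2)[OF z] by simp
      have ok2: "\<forall>t\<in>set (tvals mk_node (sg (fst z)) (map ?tg (snd z))). okt n t"
        using Pz[OF z] ok by (intro okt_tval(2)) auto
      have "tval mk_node (mk_node (sg (fst z))) (map ?tg (snd z)) =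
          mk_node (tvals mk_node (sg (fst z)) (map ?tg (snd z)))"
        using Pz[OF z] ok by (intro nary.tval_mk_node[OF nary_mk_node[of n]]) (auto simp: bnd_def)
      moreover have "ct (tval mk_node (tr (fst z)) (map tr (snd z)))
          (tval mk_node (mk_node (sg (fst z))) (map ?tg (snd z))) (concat (map lb (snd z)))
          (ar (fst z) \<bullet> tval Mf (tr (fst z)) (map ar (snd z)))"
      proof -
        have "lb (fst z) = map ?v (snd z)" using lbz z by simp
        then show ?thesis using bspec[OF ct_Node.IH inp[OF z]] cQ[OF z] by blast
      qed
      ultimately show "sg p \<noteq> [] \<and> (\<forall>t\<in>set (sg p). okt n t) \<and> ct (tr p) (mk_node (sg p)) (lb p) (ar p)"
        using ne ok2 by (simp add: p r_def)
    qed
  qed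
  have 1: "mk_node (map tr (map r zs)) = tval mk_node (Node (map tr ps)) (map tr qs)"
    using tvals_map_concat[of zs "\<lambda>z. map tr (snd z)" "\<lambda>z. tr (fst z)" mk_node] Pz(1)
    by (simp add: r_def zs(1,2) o_def map_concat)
  have 2: "mk_node (concat (map sg (map r zs))) = tval mk_node (Node (concat (map sg ps))) (map ?tg qs)"
    using tvals_concat_concat[of zs "\<lambda>z. map ?tg (snd z)" "\<lambda>z. sg (fst z)" mk_node] Pz(2)
    by (simp add: r_def zs(1,2) o_def map_concat)
  have 3: "concat (map lb (map r zs)) = concat (map lb qs)"
    unfolding zs(2) r_def by (induction zs) auto
  \<comment> \<open>By \<open>tvals_graft\<close>, a segment has the same values whether its labels
    are objects or the trees having these objects as values. Hence the factor \<open>gamma\<close>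
    is the same before and after grafting.\<close>
  have 4: "map vals (map r zs) = map vals ps"
  proof -
    have "vals (r z) = vals (fst z)" if z: "z \<in> set zs" for z
    proof -
      have "vals (r z) = tvals M (sg (fst z)) (map ?v (snd z))"
        unfolding r_def vals_def piece.sel
        by (rule M.tvals_graft) (use Pz[OF z] Q[OF z] in auto)
      then show ?thesis using lbz z by (simp add: vals_def)
    qed
    then show ?thesis by (simp add: zs(1))
  qed
  let ?A = "\<lambda>z. tval Mf (tr (fst z)) (map ar (snd z))"
  have hA: "hom (?A z) (tval M (tr (fst z)) (map (\<lambda>q. tval M (tr q) (lb q)) (snd z)))
      (tval M (tr (fst z)) (lb (fst z)))" if z: "z \<in> set zs" for z
  proof -
    have "homs (map ar (snd z)) (map (\<lambda>q. tval M (tr q) (lb q)) (snd z)) (map ?v (snd z))"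
      using Q(6)[OF z] by (intro homs_map) auto
    then have h: "set (map ar (snd z)) \<subseteq> Arr C"
      "map (Src C) (map ar (snd z)) = map (\<lambda>q. tval M (tr q) (lb q)) (snd z)"
      "map (Tgt C) (map ar (snd z)) = lb (fst z)" using lbz z by (simp_all add: homs_iff)
    have "length (map ar (snd z)) = leaves (tr (fst z))" using Pz(1)[OF z] by simp
    from hom_tval[OF Pz(3)[OF z] h(1) this] show ?thesis unfolding h(2,3) .
  qed
  have ha: "hom (ar (fst z)) (tval M (tr (fst z)) (lb (fst z))) (M (vals (fst z)))" if "z \<in> set zs" for z
    using P(2) ct_pieces_typing[OF cp] inp[OF that] by (auto simp: ctt_def)
  have bz: "bnd (length zs)" using P(8) ct_Node.hyps(2) zs(1) by (auto elim!: bnd_mono)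
  have e1: "Mf (map ar ps) \<bullet> Mf (map ?A zs) = Mf (map (\<lambda>z. ar (fst z) \<bullet> ?A z) zs)"
    unfolding zs(1) map_map o_def
    using hA ha bz by (intro Mf_comp_map[where x = "\<lambda>z. tval M (tr (fst z)) (map (\<lambda>q. tval M (tr q) (lb q)) (snd z))"
          and y = "\<lambda>z. tval M (tr (fst z)) (lb (fst z))" and w = "\<lambda>z. M (vals (fst z))"]) auto
  have e2: "tval Mf (Node (map tr ps)) (map ar qs) = Mf (map ?A zs)"
    using tvals_map_concat[of zs "\<lambda>z. map ar (snd z)" "\<lambda>z. tr (fst z)" Mf] Pz(1)
    by (simp add: zs(1,2) o_def map_concat)
  have e3: "map ar (map r zs) = map (\<lambda>z. ar (fst z) \<bullet> ?A z) zs" by (simp add: r_def)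
  have h1: "hom (Mf (map ?A zs)) (M (map (\<lambda>z. tval M (tr (fst z)) (map (\<lambda>q. tval M (tr q) (lb q)) (snd z))) zs))
      (M (map (\<lambda>z. tval M (tr (fst z)) (lb (fst z))) zs))"
    by (rule hom_Mf[OF homs_map]) (use hA bz in simp_all)
  have h2: "hom (Mf (map ar ps)) (M (map (\<lambda>z. tval M (tr (fst z)) (lb (fst z))) zs))
      (M (map (\<lambda>z. M (vals (fst z))) zs))"
    unfolding zs(1) map_map o_def by (rule hom_Mf[OF homs_map]) (use ha bz in simp_all)
  have h3: "hom (gamma (map vals ps)) (M (map (\<lambda>z. M (vals (fst z))) zs)) (M (concat (map vals ps)))"
    using hom_G[OF P(1)] by (simp add: gamma_def zs(1) o_def)
  have "gamma (map vals ps) \<bullet> Mf (map ar (map r zs)) =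
      (gamma (map vals ps) \<bullet> Mf (map ar ps)) \<bullet> tval Mf (Node (map tr ps)) (map ar qs)"
    unfolding e3 e1[symmetric] e2 by (rule comp_assoc[OF h1 h2 h3, symmetric])
  then show ?case using R unfolding 1 2 3 4 by simp
qed

end

section \<open>The action of the operad on a monoidal category\<close>

lemma K_cat_simps [simp]:
  "Obj (K_cat n m) = K n m" "Arr (K_cat n m) = {(x, y). x \<in> K n m \<and> y \<in> K n m \<and> tree_le x y}"
  "Src (K_cat n m) = fst" "Tgt (K_cat n m) = snd" "Idt (K_cat n m) = (\<lambda>x. (x, x))"
  "Cmp (K_cat n m) = (\<lambda>g f. (fst f, snd g))"
  by (simp_all add: K_cat_def poset_cat_def)

lemma prod_cat_simps [simp]:
  "Obj (prod_cat A B) = Obj A \<times> Obj B" "Arr (prod_cat A B) = Arr A \<times> Arr B"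
  "Src (prod_cat A B) = map_prod (Src A) (Src B)" "Tgt (prod_cat A B) = map_prod (Tgt A) (Tgt B)"
  "Idt (prod_cat A B) = map_prod (Idt A) (Idt B)"
  "Cmp (prod_cat A B) = (\<lambda>(g, g') (f, f'). (Cmp A g f, Cmp B g' f'))"
  by (simp_all add: prod_cat_def)

lemma K_iff: "T \<in> K n m \<longleftrightarrow> okt n T \<and> leaves T = m"
  by (auto simp: K_def)

section \<open>Paths of contractions within the suboperad\<close>

lemma stable_Node_iff: "stable n (Node ts) \<longleftrightarrow>
    2 \<le> length ts \<and> enat (length ts) \<le> n \<and> (\<forall>t\<in>set ts. stable n t)"
  using okt_Node[of ts n] by auto

lemma stable_infinity: "stable n T \<Longrightarrow> stable \<infinity> T"
  by (induction rule: stable.induct) (auto intro: stable.intros)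

lemma shrink_stable_infinity: "shrink T T' \<Longrightarrow> stable \<infinity> T \<Longrightarrow> stable \<infinity> T'"
  by (induction rule: shrink.induct) (auto simp: stable_Node_iff)

text \<open>Contraction merges nodes of arities \<open>k + 1\<close> and \<open>j\<close>, with
  \<open>2 \<le> j\<close> and \<open>1 \<le> k\<close>, into one of arity \<open>k + j\<close>,
  which is at least as large as either. A bound on the arities of the target therefore holds for the
  source.\<close>

lemma shrink_stable: "shrink T T' \<Longrightarrow> stable \<infinity> T \<Longrightarrow> stable n T' \<Longrightarrow> stable n T"
proof (induction rule: shrink.induct)
  case (shrink_root us ts vs)
  have l: "enat (length us + length ts + length vs) \<le> n" "2 \<le> length ts"
    using shrink_root by (auto simp: stable_Node_iff add.assoc)
  then have "enat (length ts) \<le> n" "enat (length us + 1 + length vs) \<le> n"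
    by (auto elim!: order_trans[rotated])
  then show ?case using shrink_root by (auto simp: stable_Node_iff)
qed (auto simp: stable_Node_iff)

lemma shrink_leaves: "shrink T T' \<Longrightarrow> leaves T' = leaves T"
  by (induction rule: shrink.induct) auto

lemma shrink_not_Zero: "shrink T T' \<Longrightarrow> T \<noteq> Zero \<and> T' \<noteq> Zero"
  by (induction rule: shrink.induct) auto

lemma tree_le_refl: "tree_le T T"
  by (simp add: tree_le_def)

text \<open>Stability passes along a path of contractions from its beginning, the arity bound passes
  backwards from its end. So the whole path consists of trees within the bound.\<close>

lemma tree_le_induct [consumes 3, case_names refl shrink]:
  assumes "tree_le T T'" "okt n T" "okt n T'"
    and refl: "\<And>T. okt n T \<Longrightarrow> P T T"
    and shrink: "\<And>T T' T''. shrink T T' \<Longrightarrow> stable n T \<Longrightarrow> stable n T' \<Longrightarrow> tree_le T' T'' \<Longrightarrow>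
      stable n T'' \<Longrightarrow> P T' T'' \<Longrightarrow> P T T''"
  shows "P T T'"
proof (cases "T = T'")
  case True then show ?thesis using refl assms by simp
next
  case False
  have "T \<noteq> Zero \<and> T' \<noteq> Zero"
    using assms(1) False unfolding tree_le_def
    by (metis converse_rtranclpE rtranclp.cases shrink_not_Zero)
  then have s: "stable \<infinity> T" "stable n T'" using assms(2,3) stable_infinity by auto
  have "stable n T \<and> P T T'"
    using assms(1)[unfolded tree_le_def] s
  proof (induction rule: converse_rtranclp_induct)
    case base then show ?case using refl by simp
  next
    case (step T T1)
    have 1: "stable \<infinity> T1" by (rule shrink_stable_infinity[OF step(1,4)])
    then have 2: "stable n T1" "P T1 T'" using step by auto
    then have 3: "stable n T" by (intro shrink_stable[OF step(1,4)])
    show ?case using shrink[OF step(1) 3 2(1) _ step(5) 2(2)] step(2) 3 by (simp add: tree_le_def)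
  qed
  then show ?thesis by simp
qed

text \<open>The rules of \<open>shrink\<close> expressed by \<open>mk_node\<close>, the form in
  which \<open>ct_root\<close>, \<open>ct_above\<close> and the corresponding facts about an algebra
  are stated.\<close>

lemma shrink_stable_induct [consumes 3, case_names root above]:
  assumes "shrink T T'" "stable n T" "stable n T'"
    and root: "\<And>us ts vs. \<forall>t\<in>set (us @ ts @ vs). stable n t \<Longrightarrow>
      2 \<le> length ts \<Longrightarrow> 1 \<le> length us + length vs \<Longrightarrow>
      enat (length us + length ts + length vs) \<le> n \<Longrightarrow> enat (length us + 1 + length vs) \<le> n \<Longrightarrow>
      P (mk_node (us @ mk_node ts # vs)) (mk_node (us @ ts @ vs))"
    and above: "\<And>us t t' vs. \<forall>t\<in>set (us @ vs). stable n t \<Longrightarrow> shrink t t' \<Longrightarrow> stable n t \<Longrightarrow>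
      stable n t' \<Longrightarrow> P t t' \<Longrightarrow> enat (length us + 1 + length vs) \<le> n \<Longrightarrow>
      P (mk_node (us @ t # vs)) (mk_node (us @ t' # vs))"
  shows "P T T'"
  using assms(1-3)
proof (induction rule: shrink.induct)
  case (shrink_root us ts vs)
  then have T: "2 \<le> length ts" "1 \<le> length us + length vs" "\<forall>t\<in>set (us @ ts @ vs). stable n t"
    "enat (length us + 1 + length vs) \<le> n" "enat (length us + length ts + length vs) \<le> n"
    by (auto simp: stable_Node_iff add.assoc)
  then have z: "Zero \<notin> set (us @ ts @ vs)" using stable_Zero by blast
  have "mk_node ts = Node ts" using z T by (intro mk_node_Node) auto
  moreover have "mk_node (us @ Node ts # vs) = Node (us @ Node ts # vs)"
    using z T by (intro mk_node_Node) auto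
  moreover have "mk_node (us @ ts @ vs) = Node (us @ ts @ vs)"
    using z T by (intro mk_node_Node) auto
  ultimately show ?case using root[of us ts vs] T by simp
next
  case (shrink_above t t' us vs)
  then have T: "2 \<le> length us + length vs + 1" "\<forall>t\<in>set (us @ vs). stable n t" "stable n t" "stable n t'"
    "enat (length us + 1 + length vs) \<le> n"
    by (auto simp: stable_Node_iff)
  then have z: "Zero \<notin> set (us @ vs)" using stable_Zero by blast
  have "mk_node (us @ t # vs) = Node (us @ t # vs)" "mk_node (us @ t' # vs) = Node (us @ t' # vs)"
    using z T shrink_not_Zero[OF shrink_above(1)] by (auto intro!: mk_node_Node)
  then show ?case using above[of us vs t t'] shrink_above T by simp
qed

lemma split_labels3:
  assumes "length xs = total_leaves us + total_leaves ts + total_leaves vs"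
  obtains xu xt xv where "xs = xu @ xt @ xv" "length xu = total_leaves us"
    "length xt = total_leaves ts" "length xv = total_leaves vs"
proof -
  let ?u = "total_leaves us" and ?t = "total_leaves ts"
  have "xs = take ?u xs @ take ?t (drop ?u xs) @ drop ?t (drop ?u xs)"
    by (metis append_take_drop_id)
  then show thesis using that assms by (metis (no_types, lifting) add_diff_cancel_left'
    add_leD1 append_eq_conv_conj append_take_drop_id diff_diff_left length_drop length_take min.absorb2
      add.assoc le_add1)
qed

section \<open>The action on arrows by canonical morphisms\<close>

context monoidal begin

lemma ct_shrink:
  assumes "shrink T T'" "stable n T" "stable n T'" "ob xs" "length xs = leaves T"
  shows "\<exists>f. ct T T' xs f"
  using assms
proof (induction arbitrary: xs rule: shrink_stable_induct)
  case (root us ts vs)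
  obtain xu xt xv where x: "xs = xu @ xt @ xv" "length xu = total_leaves us"
    "length xt = total_leaves ts" "length xv = total_leaves vs"
    using root.prems by (auto simp: add.assoc intro: split_labels3[of xs us ts vs])
  show ?case unfolding x(1)
    by (rule exI, rule ct_root) (use root x in \<open>auto simp: bnd_def\<close>)
next
  case (above us t t' vs)
  obtain xu xt xv where x: "xs = xu @ xt @ xv" "length xu = total_leaves us"
    "length xt = total_leaves [t]" "length xv = total_leaves vs"
    using above.prems by (auto simp: add.assoc intro: split_labels3[of xs us "[t]" vs])
  obtain f where "ct t t' xt f" using above.IH[of xt] above.prems x by auto
  then show ?case unfolding x(1)
    by (intro exI, rule ct_above[rotated]) (use above x in \<open>auto simp: bnd_def\<close>)
qed

text \<open>A path of contractions serves only to establish existence; by \<open>ct_unique\<close>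
  the morphism does not depend on it.\<close>

lemma ct_exists:
  "tree_le T T' \<Longrightarrow> okt n T \<Longrightarrow> okt n T' \<Longrightarrow> ob xs \<Longrightarrow> length xs = leaves T \<Longrightarrow> \<exists>f. ct T T' xs f"
proof (induction arbitrary: xs rule: tree_le_induct)
  case (refl T)
  then show ?case using ct_refl by blast
next
  case (shrink T T' T'')
  obtain f where f: "ct T T' xs f" using ct_shrink shrink by blast
  moreover obtain g where "ct T' T'' xs g" using shrink ct_leaves[OF f] by auto
  ultimately show ?case using ct_trans by blast
qed

definition can where "can T T' xs = (THE f. ct T T' xs f)"

lemma can_eq: "ct T T' xs f \<Longrightarrow> can T T' xs = f"
  unfolding can_def using ct_unique by blast

lemma ct_can: "tree_le T T' \<Longrightarrow> okt n T \<Longrightarrow> okt n T' \<Longrightarrow> ob xs \<Longrightarrow> length xs = leaves T \<Longrightarrow> ct T T' xs (can T T' xs)"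
  using ct_exists can_eq by metis

text \<open>An arrow of the product category factors as an arrow of labels at the source tree
  followed by a contraction at the target labels, and the action is defined through this
  factorization.\<close>

definition action :: "nat \<Rightarrow> (tree \<times> 'o list, (tree \<times> tree) \<times> 'm list, 'o, 'm) ftor" where
  "action i = \<lparr> omap = (\<lambda>(T, xs). tval M T xs),
    amap = (\<lambda>((T, T'), fs). can T T' (map (Tgt C) fs) \<bullet> tval Mf T fs) \<rparr>"

lemma action_simps [simp]:
  "omap (action i) (T, xs) = tval M T xs"
  "amap (action i) ((T, T'), fs) = can T T' (map (Tgt C) fs) \<bullet> tval Mf T fs"
  by (simp_all add: action_def)

lemma hom_can:
  assumes "tree_le T T'" "okt n T" "okt n T'" "ob xs" "length xs = leaves T"
  shows "hom (can T T' xs) (tval M T xs) (tval M T' xs)"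
  using ct_ctt[OF ct_can[OF assms]] by (simp add: ctt_def)

lemma hom_action:
  assumes "tree_le T T'" "okt n T" "okt n T'" "set fs \<subseteq> Arr C" "length fs = leaves T"
  shows "hom (amap (action i) ((T, T'), fs)) (tval M T (map (Src C) fs)) (tval M T' (map (Tgt C) fs))"
proof -
  have "ob (map (Tgt C) fs)" using homs_Obj[of fs] assms(4) by (auto simp: homs_iff)
  then have "hom (can T T' (map (Tgt C) fs)) (tval M T (map (Tgt C) fs)) (tval M T' (map (Tgt C) fs))"
    using assms by (intro hom_can) auto
  then show ?thesis using hom_tval[OF assms(2,4,5)] by auto
qed

lemma can_refl: "okt n T \<Longrightarrow> ob xs \<Longrightarrow> length xs = leaves T \<Longrightarrow> can T T xs = Idt C (tval M T xs)"
  by (rule can_eq[OF ct_refl])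

lemma can_nat:
  assumes "tree_le T T'" "okt n T" "okt n T'" "homs fs xs ys" "length xs = leaves T"
  shows "can T T' ys \<bullet> tval Mf T fs = tval Mf T' fs \<bullet> can T T' xs"
proof -
  have "ct T T' xs (can T T' xs)" using assms homs_Obj[OF assms(4)] by (intro ct_can) auto
  from ct_nat[OF this assms(4)] obtain g where "ct T T' ys g"
    "g \<bullet> tval Mf T fs = tval Mf T' fs \<bullet> can T T' xs" by blast
  then show ?thesis using can_eq by simp
qed

lemma can_trans:
  assumes "tree_le T T'" "tree_le T' T''" "okt n T" "okt n T'" "okt n T''" "ob xs" "length xs = leaves T"
  shows "can T T'' xs = can T' T'' xs \<bullet> can T T' xs"
proof -
  have f: "ct T T' xs (can T T' xs)" using assms by (intro ct_can)
  then have "ct T' T'' xs (can T' T'' xs)" using assms ct_leaves[OF f] by (intro ct_can) auto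
  from can_eq[OF ct_trans[OF f this]] show ?thesis .
qed

text \<open>Naturality exchanges the first contraction with the second arrow of labels; each kind of
  arrow then composes by itself.\<close>

lemma action_comp:
  assumes "tree_le T T'" "tree_le T' T''" "okt n T" "okt n T'" "okt n T''"
    "homs fs xs ys" "homs gs ys zs" "length fs = leaves T"
  shows "amap (action i) ((T, T''), map2 comp gs fs) =
    amap (action i) ((T', T''), gs) \<bullet> amap (action i) ((T, T'), fs)"
proof -
  have l: "length xs = leaves T" "length ys = leaves T" "length zs = leaves T" "length gs = leaves T"
    using homs_length[OF assms(6)] homs_length[OF assms(7)] assms(8) by auto
  have ob: "ob xs" "ob ys" "ob zs" using homs_Obj assms(6,7) by blast+
  have lT: "leaves T' = leaves T" using ct_leaves[OF ct_can[OF assms(1,3,4) ob(1) l(1)]] by simp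
  have t: "map (Tgt C) fs = ys" "map (Tgt C) gs = zs" "map (Tgt C) (map2 comp gs fs) = zs"
    "map (Src C) fs = xs" "map (Src C) gs = ys" "set fs \<subseteq> Arr C" "set gs \<subseteq> Arr C"
    using assms(6,7) homs_comp[OF assms(6,7)] by (simp_all add: homs_iff)
  have h: "hom (can T T' ys) (tval M T ys) (tval M T' ys)" "hom (can T T' zs) (tval M T zs) (tval M T' zs)"
    "hom (can T' T'' zs) (tval M T' zs) (tval M T'' zs)"
    "hom (tval Mf T fs) (tval M T xs) (tval M T ys)" "hom (tval Mf T gs) (tval M T ys) (tval M T zs)"
    "hom (tval Mf T' gs) (tval M T' ys) (tval M T' zs)"
  proof -
    show "hom (can T T' ys) (tval M T ys) (tval M T' ys)" "hom (can T T' zs) (tval M T zs) (tval M T' zs)"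
      by (rule hom_can[OF assms(1,3,4)], use ob l in simp_all)+
    show "hom (can T' T'' zs) (tval M T' zs) (tval M T'' zs)"
      by (rule hom_can[OF assms(2,4,5)], use ob l lT in simp_all)
    show "hom (tval Mf T fs) (tval M T xs) (tval M T ys)"
      using hom_tval[OF assms(3) t(6) assms(8)] t by simp
    show "hom (tval Mf T gs) (tval M T ys) (tval M T zs)"
      using hom_tval[OF assms(3) t(7) l(4)] t by simp
    show "hom (tval Mf T' gs) (tval M T' ys) (tval M T' zs)"
      using hom_tval[OF assms(4) t(7)] t l lT by simp
  qed
  let ?c = "can T T' zs" and ?d = "can T' T'' zs" and ?f = "tval Mf T fs" and ?g = "tval Mf T gs"
  have "can T T'' zs \<bullet> tval Mf T (map2 comp gs fs) = (?d \<bullet> ?c) \<bullet> ?g \<bullet> ?f"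
    using can_trans[OF assms(1-5) ob(3) l(3)] tval_comp(1)[OF assms(3,6,7,8)] by simp
  also have "\<dots> = ?d \<bullet> (?c \<bullet> ?g) \<bullet> ?f" using h by (simp add: cat_simps)
  also have "?c \<bullet> ?g = tval Mf T' gs \<bullet> can T T' ys"
    using assms l by (intro can_nat) auto
  also have "?d \<bullet> (tval Mf T' gs \<bullet> can T T' ys) \<bullet> ?f = (?d \<bullet> tval Mf T' gs) \<bullet> can T T' ys \<bullet> ?f"
    using h by (simp add: cat_simps)
  finally show ?thesis unfolding action_simps t(1-3) .
qed

lemma is_functor_action: "is_functor (prod_cat (K_cat n i) (power_cat C i)) C (action i)"
proof
  fix x assume "x \<in> Obj (prod_cat (K_cat n i) (power_cat C i))"
  then obtain T xs where x: "x = (T, xs)" "okt n T" "leaves T = i" "length xs = i" "ob xs"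
    by (cases x) (auto simp: K_iff)
  then show "omap (action i) x \<in> Obj C" using M.tval_closed[OF x(2,5)] by simp
  have "amap (action i) ((T, T), ids xs) = Idt C (tval M T xs) \<bullet> Idt C (tval M T xs)"
    using x by (simp add: can_refl tval_ids Tgt_Idt map_idI subset_iff)
  also have "\<dots> = Idt C (tval M T xs)"
    using M.tval_closed[OF x(2,5)] x by (intro comp_Idt(1)[OF hom_Idt]) simp
  finally show "amap (action i) (Idt (prod_cat (K_cat n i) (power_cat C i)) x) = Idt C (omap (action i) x)"
    by (simp add: x(1))
next
  fix f assume "f \<in> Arr (prod_cat (K_cat n i) (power_cat C i))"
  then obtain T T' fs where f: "f = ((T, T'), fs)" "okt n T" "leaves T = i" "okt n T'" "leaves T' = i"
     "tree_le T T'" "length fs = i" "set fs \<subseteq> Arr C"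
    by (cases f) (auto simp: K_iff)
  then have "hom (amap (action i) f) (tval M T (map (Src C) fs)) (tval M T' (map (Tgt C) fs))"
    unfolding f(1) by (intro hom_action) auto
  then show "amap (action i) f \<in> Arr C" "Src C (amap (action i) f) = omap (action i) (Src (prod_cat (K_cat n i) (power_cat C i)) f)"
    "Tgt C (amap (action i) f) = omap (action i) (Tgt (prod_cat (K_cat n i) (power_cat C i)) f)"
    by (simp_all add: hom_def f(1))
next
  fix f g assume fg: "f \<in> Arr (prod_cat (K_cat n i) (power_cat C i))"
    "g \<in> Arr (prod_cat (K_cat n i) (power_cat C i))"
    "Tgt (prod_cat (K_cat n i) (power_cat C i)) f = Src (prod_cat (K_cat n i) (power_cat C i)) g"
  from fg(1) obtain T T' fs where f: "f = ((T, T'), fs)" "okt n T" "leaves T = i" "okt n T'" "leaves T' = i"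
     "tree_le T T'" "length fs = i" "set fs \<subseteq> Arr C"
    by (cases f) (auto simp: K_iff)
  from fg(2,3) obtain T'' gs where g: "g = ((T', T''), gs)" "okt n T''" "tree_le T' T''"
     "set gs \<subseteq> Arr C" "map (Src C) gs = map (Tgt C) fs"
    unfolding f(1) by (cases g) (auto simp: K_iff)
  show "amap (action i) (Cmp (prod_cat (K_cat n i) (power_cat C i)) g f) = amap (action i) g \<bullet> amap (action i) f"
    using action_comp[OF f(6) g(3) f(2,4) g(2), of fs _ _ gs] f g
    by (simp add: homs_iff)
qed

lemma K_algebra_action: "K_algebra n C action"
proof (rule K_algebra.intro)
  show "is_functor (prod_cat (K_cat n i) (power_cat C i)) C (action i)" for i
    by (rule is_functor_action)
  show "omap (action 1) (Leaf, [x]) = x" for x by simp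
  show "amap (action 1) ((Leaf, Leaf), [f]) = f" if "f \<in> Arr C" for f
    using that can_refl[of Leaf "[Tgt C f]"] by (simp add: stable_Leaf Tgt_Obj Cmp_Idt_left)
next
  fix S :: tree and Ts and Xs :: "'o list list"
  assume S: "S \<in> Obj (K_cat n (length Ts))"
    and T: "list_all2 (\<lambda>T xs. T \<in> Obj (K_cat n (length xs)) \<and> set xs \<subseteq> Obj C) Ts Xs"
  let ?qs = "zip Ts Xs"
  have l: "length Ts = length Xs" using T by (rule list_all2_lengthD)
  have q: "\<forall>q\<in>set ?qs. okt n (fst q) \<and> ob (snd q) \<and> length (snd q) = leaves (fst q)"
  proof
    fix q assume "q \<in> set ?qs"
    then have "fst q \<in> Obj (K_cat n (length (snd q))) \<and> ob (snd q)"
      using T by (simp add: list_all2_iff case_prod_beta del: K_cat_simps)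
    then show "okt n (fst q) \<and> ob (snd q) \<and> length (snd q) = leaves (fst q)" by (auto simp: K_iff)
  qed
  have "tval M (tval mk_node S (map fst ?qs)) (concat (map snd ?qs)) =
      tval M S (map (\<lambda>q. tval M (fst q) (snd q)) ?qs)"
    using S l q by (intro M.tval_graft) (auto simp: K_iff)
  then show "omap (action (length (concat Xs))) (graft S Ts, concat Xs) =
      omap (action (length Ts)) (S, map2 (\<lambda>T xs. omap (action (length xs)) (T, xs)) Ts Xs)"
    using l by (simp add: graft_tval split_def)
next
  fix S S' and ts :: "(tree \<times> tree) list" and Fs :: "'m list list"
  assume S: "(S, S') \<in> Arr (K_cat n (length ts))"
    and T: "list_all2 (\<lambda>t fs. t \<in> Arr (K_cat n (length fs)) \<and> set fs \<subseteq> Arr C) ts Fs"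
  have S': "okt n S" "okt n S'" "tree_le S S'" "leaves S = length ts" using S by (auto simp: K_iff)
  let ?zs = "zip ts Fs"
  have l: "length ts = length Fs" using T by (rule list_all2_lengthD)
  have zf: "map (\<lambda>z. fst (fst z)) ?zs = map fst ts" "map (\<lambda>z. snd (fst z)) ?zs = map snd ts"
    "map snd ?zs = Fs"
    using l by (induction ts Fs rule: list_induct2) auto
  have z: "okt n (fst (fst z))" "okt n (snd (fst z))" "tree_le (fst (fst z)) (snd (fst z))"
    "set (snd z) \<subseteq> Arr C" "length (snd z) = leaves (fst (fst z))" if "z \<in> set ?zs" for z
    using T that by (simp_all add: list_all2_iff K_iff case_prod_beta)
  \<comment> \<open>The grafted arrows of trees as pieces. Each segment is a single tree, on which
    \<open>mk_node\<close> is the identity.\<close>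
  define q :: "(tree \<times> tree) \<times> 'm list \<Rightarrow> ('o, 'm) piece" where
    "q = (\<lambda>z. Piece (fst (fst z)) [snd (fst z)] (map (Tgt C) (snd z))
       (can (fst (fst z)) (snd (fst z)) (map (Tgt C) (snd z))))"
  have tg: "ob (map (Tgt C) (snd z))" if "z \<in> set ?zs" for z
    using z(4)[OF that] homs_Obj[of "snd z"] by (auto simp: homs_iff)
  have cq: "\<forall>p\<in>set (map q ?zs). ct (tr p) (mk_node (sg p)) (lb p) (ar p)"
  proof
    fix p assume "p \<in> set (map q ?zs)"
    then obtain y where y: "y \<in> set ?zs" "p = q y" by auto
    show "ct (tr p) (mk_node (sg p)) (lb p) (ar p)"
      unfolding y(2) q_def using z[OF y(1)] tg[OF y(1)] by (auto intro!: ct_can)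
  qed
  let ?v = "\<lambda>z. tval M (snd (fst z)) (map (Tgt C) (snd z))"
  let ?u = "\<lambda>z. tval M (fst (fst z)) (map (Tgt C) (snd z))"
  let ?w = "\<lambda>z. tval M (fst (fst z)) (map (Src C) (snd z))"
  let ?c = "\<lambda>z. can (fst (fst z)) (snd (fst z)) (map (Tgt C) (snd z))"
  let ?f = "\<lambda>z. tval Mf (fst (fst z)) (snd z)"
  have hc: "\<forall>z\<in>set ?zs. hom (?c z) (?u z) (?v z)"
  proof
    fix y assume y: "y \<in> set ?zs"
    show "hom (?c y) (?u y) (?v y)"
      by (rule hom_can[OF z(3,1,2)[OF y] tg[OF y]]) (use z(5)[OF y] in simp)
  qed
  have hf: "\<forall>z\<in>set ?zs. hom (?f z) (?w z) (?u z)"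
  proof
    fix y assume y: "y \<in> set ?zs"
    show "hom (?f y) (?w y) (?u y)" by (rule hom_tval[OF z(1,4,5)[OF y]])
  qed
  have lz: "length ?zs = leaves S" using l S'(4) by simp
  have ov: "ob (map ?v ?zs)" using homs_Obj[OF homs_map[OF hc]] by simp
  have mv: "map (\<lambda>p. tval M (mk_node (sg p)) (lb p)) (map q ?zs) = map ?v ?zs"
    by (simp add: q_def)
  have "ct S S' (map ?v ?zs) (can S S' (map ?v ?zs))"
    using S' lz ov by (intro ct_can) auto
  note gr = ct_graft[OF this cq mv[symmetric]]
  have "map tr (map q ?zs) = map fst ts" "map (\<lambda>p. mk_node (sg p)) (map q ?zs) = map snd ts"
    using zf by (simp_all add: q_def o_def)
  moreover have "map lb (map q ?zs) = map (\<lambda>z. map (Tgt C) (snd z)) ?zs" "map ar (map q ?zs) = map ?c ?zs"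
    by (simp_all add: q_def)
  ultimately have c: "ct (tval mk_node S (map fst ts)) (tval mk_node S' (map snd ts))
      (concat (map (\<lambda>z. map (Tgt C) (snd z)) ?zs)) (can S S' (map ?v ?zs) \<bullet> tval Mf S (map ?c ?zs))"
    using gr by (simp only:)
  \<comment> \<open>The contraction is treated by \<open>ct_graft\<close>, the arrows of labels by
    \<open>tval_graft\<close> in equation 2; equation 3 is functoriality of evaluation at
    \<open>S\<close>.\<close>
  have 1: "can (tval mk_node S (map fst ts)) (tval mk_node S' (map snd ts)) (map (Tgt C) (concat Fs)) =
      can S S' (map ?v ?zs) \<bullet> tval Mf S (map ?c ?zs)"
  proof -
    have "map (Tgt C) (concat Fs) = concat (map (\<lambda>z. map (Tgt C) (snd z)) ?zs)"
      by (subst zf(3)[symmetric]) (simp only: map_concat map_map o_def)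
    then show ?thesis using can_eq[OF c] by simp
  qed
  have 2: "tval Mf (tval mk_node S (map fst ts)) (concat Fs) = tval Mf S (map ?f ?zs)"
  proof -
    have "tval Mf (tval mk_node S (map (\<lambda>z. fst (fst z)) ?zs)) (concat (map snd ?zs)) = tval Mf S (map ?f ?zs)"
      using S' lz z by (intro Mf.tval_graft) auto
    then show ?thesis by (simp only: zf)
  qed
  have 3: "tval Mf S (map ?c ?zs) \<bullet> tval Mf S (map ?f ?zs) = tval Mf S (map (\<lambda>z. ?c z \<bullet> ?f z) ?zs)"
  proof -
    have "map2 comp (map ?c ?zs) (map ?f ?zs) = map (\<lambda>z. ?c z \<bullet> ?f z) ?zs"
      by (rule map2_map_map)
    then show ?thesis using tval_comp(1)[OF S'(1) homs_map[OF hf] homs_map[OF hc]] lz by simp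
  qed
  have hh: "hom (tval Mf S (map ?c ?zs)) (tval M S (map ?u ?zs)) (tval M S (map ?v ?zs))"
    "hom (tval Mf S (map ?f ?zs)) (tval M S (map ?w ?zs)) (tval M S (map ?u ?zs))"
  proof -
    have c: "set (map ?c ?zs) \<subseteq> Arr C" "map (Src C) (map ?c ?zs) = map ?u ?zs" "map (Tgt C) (map ?c ?zs) = map ?v ?zs"
      using homs_map[OF hc] by (auto simp only: homs_iff)
    have f: "set (map ?f ?zs) \<subseteq> Arr C" "map (Src C) (map ?f ?zs) = map ?w ?zs" "map (Tgt C) (map ?f ?zs) = map ?u ?zs"
      using homs_map[OF hf] by (auto simp only: homs_iff)
    show "hom (tval Mf S (map ?c ?zs)) (tval M S (map ?u ?zs)) (tval M S (map ?v ?zs))"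
      using hom_tval[OF S'(1) c(1)] lz unfolding c(2,3) by simp
    show "hom (tval Mf S (map ?f ?zs)) (tval M S (map ?w ?zs)) (tval M S (map ?u ?zs))"
      using hom_tval[OF S'(1) f(1)] lz unfolding f(2,3) by simp
  qed
  have hS: "hom (can S S' (map ?v ?zs)) (tval M S (map ?v ?zs)) (tval M S' (map ?v ?zs))"
    using S' lz ov by (intro hom_can) auto
  have tgt: "map (Tgt C) (map (\<lambda>z. ?c z \<bullet> ?f z) ?zs) = map ?v ?zs"
  proof -
    have "\<forall>z\<in>set ?zs. hom (?c z \<bullet> ?f z) (?w z) (?v z)" using hc hf hom_comp by blast
    from homs_map[OF this] show ?thesis by (simp only: homs_iff)
  qed
  have "amap (action (length (concat Fs))) ((graft S (map fst ts), graft S' (map snd ts)), concat Fs) =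
      (can S S' (map ?v ?zs) \<bullet> tval Mf S (map ?c ?zs)) \<bullet> tval Mf S (map ?f ?zs)"
    by (simp only: action_simps graft_tval 1 2)
  also have "\<dots> = can S S' (map ?v ?zs) \<bullet> tval Mf S (map (\<lambda>z. ?c z \<bullet> ?f z) ?zs)"
    unfolding 3[symmetric] by (rule comp_assoc[OF hh(2,1) hS])
  also have "\<dots> = amap (action (length ts)) ((S, S'), map (\<lambda>z. ?c z \<bullet> ?f z) ?zs)"
    by (simp only: action_simps tgt)
  also have "map (\<lambda>z. ?c z \<bullet> ?f z) ?zs = map2 (\<lambda>t fs. amap (action (length fs)) (t, fs)) ts Fs"
    by (simp add: split_def action_def)
  finally show "amap (action (length (concat Fs))) ((graft S (map fst ts), graft S' (map snd ts)), concat Fs) =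
      amap (action (length ts)) ((S, S'), map2 (\<lambda>t fs. amap (action (length fs)) (t, fs)) ts Fs)" .
qed

end

section \<open>The monoidal structure of an algebra over the operad\<close>

lemma mk_node_cong: "filter (\<lambda>t. t \<noteq> Zero) ts = filter (\<lambda>t. t \<noteq> Zero) us \<Longrightarrow> mk_node ts = mk_node us"
  by (simp add: mk_node_def)

lemma mk_node_Zero: "mk_node (us @ Zero # vs) = mk_node (us @ vs)"
  by (rule mk_node_cong) simp

text \<open>If at most one nonempty tree occurs in \<open>ts\<close>, or none beside it, there is no
  edge to contract and both sides are equal. Otherwise the relation is a single step of
  \<open>shrink\<close>.\<close>

lemma tree_le_root: "tree_le (mk_node (us @ mk_node ts # vs)) (mk_node (us @ ts @ vs))"
proof (cases ts rule: mk_node_cases)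
  case none
  then have "mk_node (us @ mk_node ts # vs) = mk_node (us @ ts @ vs)" by (intro mk_node_cong) simp
  then show ?thesis by (simp add: tree_le_refl)
next
  case (single t)
  then have "mk_node (us @ mk_node ts # vs) = mk_node (us @ ts @ vs)" by (intro mk_node_cong) simp
  then show ?thesis by (simp add: tree_le_refl)
next
  case many
  let ?f = "filter (\<lambda>t. t \<noteq> Zero)"
  show ?thesis
  proof (cases "?f (us @ vs) = []")
    case True
    have "mk_node (us @ Node (?f ts) # vs) = mk_node [Node (?f ts)]"
      using True by (intro mk_node_cong) simp
    moreover have "mk_node (us @ ts @ vs) = mk_node ts" using True by (intro mk_node_cong) simp
    ultimately show ?thesis by (simp add: many(2) tree_le_refl)
  next
    case False
    then have l: "1 \<le> length (?f us) + length (?f vs)" by (cases "?f us"; cases "?f vs") auto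
    have "mk_node (us @ Node (?f ts) # vs) = mk_node (?f us @ Node (?f ts) # ?f vs)"
      by (rule mk_node_cong) simp
    also have "\<dots> = Node (?f us @ Node (?f ts) # ?f vs)" using l by (intro mk_node_Node) auto
    finally have 1: "mk_node (us @ Node (?f ts) # vs) = Node (?f us @ Node (?f ts) # ?f vs)" .
    have "mk_node (us @ ts @ vs) = mk_node (?f us @ ?f ts @ ?f vs)"
      by (rule mk_node_cong) simp
    also have "\<dots> = Node (?f us @ ?f ts @ ?f vs)" using l many by (intro mk_node_Node) auto
    finally show ?thesis unfolding many(2) 1 tree_le_def using shrink_root by auto
  qed
qed

lemma tree_le_mk_node:
  assumes "tree_le t t'"
  shows "tree_le (mk_node (us @ t # vs)) (mk_node (us @ t' # vs))"
  using assms[unfolded tree_le_def]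
proof (induction rule: rtranclp_induct)
  case base then show ?case by (rule tree_le_refl)
next
  case (step t t')
  let ?f = "filter (\<lambda>t. t \<noteq> Zero)"
  have nz: "t \<noteq> Zero" "t' \<noteq> Zero" using shrink_not_Zero step(2) by auto
  have e: "mk_node (us @ t # vs) = mk_node (?f us @ t # ?f vs)"
    "mk_node (us @ t' # vs) = mk_node (?f us @ t' # ?f vs)" using nz by (auto intro!: mk_node_cong)
  have "shrink (mk_node (us @ t # vs)) (mk_node (us @ t' # vs))"
  proof (cases "?f (us @ vs) = []")
    case True
    then show ?thesis using step(2) unfolding e by simp
  next
    case False
    then have l: "1 \<le> length (?f us) + length (?f vs)" by (cases "?f us"; cases "?f vs") auto
    have "mk_node (?f us @ t # ?f vs) = Node (?f us @ t # ?f vs)"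
      "mk_node (?f us @ t' # ?f vs) = Node (?f us @ t' # ?f vs)"
      using l nz by (auto intro!: mk_node_Node)
    then show ?thesis unfolding e using shrink_above[OF step(2)] by simp
  qed
  then show ?case using step(3) unfolding tree_le_def by simp
qed

section \<open>Corollas and the trees of the associators\<close>

lemma corolla_mk: "corolla k = mk_node (replicate k Leaf)"
proof -
  consider "k = 0" | "k = 1" | "2 \<le> k" by linarith
  then show ?thesis by cases (auto simp: corolla_def mk_node_Node)
qed

lemma sum_list_replicate_1 [simp]: "sum_list (replicate k (Suc 0)) = k"
  by (simp add: sum_list_replicate)

lemma leaves_corolla [simp]: "leaves (corolla k) = k"
  by (simp add: corolla_mk)

lemma okt_corolla: "enat k \<le> n \<Longrightarrow> okt n (corolla k)"
  unfolding corolla_mk by (intro okt_mk_node) (auto simp: stable_Leaf)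

lemma tvals_replicate_Leaf: "length xs = k \<Longrightarrow> tvals F (replicate k Leaf) xs = xs"
proof (induction k arbitrary: xs)
  case (Suc k)
  then show ?case by (cases xs) auto
qed simp

lemma tval_corolla:
  assumes "length xs = k" "k = 1 \<Longrightarrow> F [hd xs] = hd xs"
  shows "tval F (corolla k) xs = F xs"
proof -
  consider "k = 0" | "k = 1" | "2 \<le> k" by linarith
  then show ?thesis
  proof cases
    case 2
    then obtain x where "xs = [x]" using assms(1) by (cases xs) auto
    then show ?thesis using 2 assms(2) by (simp add: corolla_def)
  qed (use assms(1) in \<open>auto simp: corolla_def tvals_replicate_Leaf\<close>)
qed

lemma graft_corolla: "length Ts = k \<Longrightarrow> tval mk_node (corolla k) Ts = mk_node Ts"
  by (rule tval_corolla) auto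

text \<open>The tree of the source of the associator \<open>\<alpha>\<^sup>i\<^sup>,\<^sup>j\<^sup>,\<^sup>k\<close>.\<close>

definition bush where
  "bush i j k = mk_node (replicate i Leaf @ mk_node (replicate j Leaf) # replicate k Leaf)"

lemma bush_graft:
  "graft (corolla (i + 1 + k)) (replicate i Leaf @ [corolla j] @ replicate k Leaf) = bush i j k"
  using graft_corolla[of "replicate i Leaf @ [corolla j] @ replicate k Leaf" "i + 1 + k"]
  by (simp add: graft_tval bush_def corolla_mk)

lemma leaves_bush [simp]: "leaves (bush i j k) = i + j + k"
  by (simp add: bush_def)

lemma okt_bush:
  assumes "enat (i + j + k) \<le> n" "enat (i + 1 + k) \<le> n"
  shows "okt n (bush i j k)"
proof -
  have "enat j \<le> n" using assms(1) by (auto elim!: order_trans[rotated])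
  then have "okt n (mk_node (replicate j Leaf))" using okt_corolla by (simp add: corolla_mk)
  then show ?thesis unfolding bush_def using assms(2) by (intro okt_mk_node) (auto simp: stable_Leaf)
qed

lemma tree_le_bush: "tree_le (bush i j k) (corolla (i + j + k))"
  unfolding bush_def corolla_mk using tree_le_root[of "replicate i Leaf" "replicate j Leaf" "replicate k Leaf"]
  by (simp add: replicate_add)

text \<open>Every contraction of an edge at the root arises by grafting onto the contraction of a
  bush. Its action is therefore given by an associator.\<close>

lemma graft_bush:
  assumes "\<forall>t\<in>set (us @ ts @ vs). okt n t" "enat (length us + length ts + length vs) \<le> n"
    "enat (length us + 1 + length vs) \<le> n"
  shows "tval mk_node (bush (length us) (length ts) (length vs)) (us @ ts @ vs) = mk_node (us @ mk_node ts # vs)"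
proof -
  let ?l = "replicate (length us) Leaf @ mk_node (replicate (length ts) Leaf) # replicate (length vs) Leaf"
  have "enat (length ts) \<le> n" using assms(2) by (auto elim!: order_trans[rotated])
  then have "okt n (corolla (length ts))" by (rule okt_corolla)
  then have "tval mk_node (mk_node ?l) (us @ ts @ vs) = mk_node (tvals mk_node ?l (us @ ts @ vs))"
    using assms by (intro nary.tval_mk_node[OF nary_mk_node[of n]]) (auto simp: stable_Leaf corolla_mk)
  moreover have "tvals mk_node ?l (us @ ts @ vs) = us @ mk_node ts # vs"
    using graft_corolla[of ts]
    by (simp add: tvals_append tvals_replicate_Leaf corolla_mk)
  ultimately show ?thesis by (simp add: bush_def)
qed

section \<open>Algebras over the operad in terms of labelled trees\<close>

locale k_action = category C + K_algebra n C \<theta>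
  for n :: enat and C :: "('o, 'm) cat"
    and \<theta> :: "nat \<Rightarrow> (tree \<times> 'o list, (tree \<times> tree) \<times> 'm list, 'o, 'm) ftor"
begin

definition obj where "obj z = omap (\<theta> (length (snd z))) z"
definition arr where "arr z = amap (\<theta> (length (snd z))) z"

definition okz where "okz z \<longleftrightarrow> okt n (fst z) \<and> length (snd z) = leaves (fst z) \<and> set (snd z) \<subseteq> Obj C"
definition oka where "oka z \<longleftrightarrow> okt n (fst (fst z)) \<and> okt n (snd (fst z)) \<and> tree_le (fst (fst z)) (snd (fst z)) \<and>
  length (snd z) = leaves (fst (fst z)) \<and> leaves (snd (fst z)) = leaves (fst (fst z)) \<and> set (snd z) \<subseteq> Arr C"

lemma obj_Obj: "okz z \<Longrightarrow> obj z \<in> Obj C"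
  using is_functor.omap_Obj[OF action_functor, of z "length (snd z)"]
  by (cases z) (simp add: okz_def obj_def K_iff)

lemma hom_arr:
  assumes "oka ((T, T'), fs)"
  shows "hom (arr ((T, T'), fs)) (obj (T, map (Src C) fs)) (obj (T', map (Tgt C) fs))"
proof -
  have a: "((T, T'), fs) \<in> Arr (prod_cat (K_cat n (length fs)) (power_cat C (length fs)))"
    using assms by (simp add: oka_def K_iff)
  show ?thesis
    using is_functor.amap_Arr[OF action_functor a] is_functor.Src_amap[OF action_functor a]
      is_functor.Tgt_amap[OF action_functor a]
    by (simp add: hom_def arr_def obj_def)
qed

lemma arr_comp:
  assumes "oka ((T, T'), fs)" "oka ((T', T''), gs)" "map (Tgt C) fs = map (Src C) gs"
  shows "arr ((T', T''), gs) \<bullet> arr ((T, T'), fs) = arr ((T, T''), map2 comp gs fs)"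
proof -
  have l: "length gs = length fs" using assms(3) by (metis length_map)
  have a: "((T, T'), fs) \<in> Arr (prod_cat (K_cat n (length fs)) (power_cat C (length fs)))"
    "((T', T''), gs) \<in> Arr (prod_cat (K_cat n (length fs)) (power_cat C (length fs)))"
    using assms l by (simp_all add: oka_def K_iff)
  show ?thesis
    using is_functor.amap_Cmp[OF action_functor a] assms(3) l by (simp add: arr_def)
qed

lemma arr_ids:
  assumes "okz (T, xs)"
  shows "arr ((T, T), ids xs) = Idt C (obj (T, xs))"
proof -
  have a: "(T, xs) \<in> Obj (prod_cat (K_cat n (length xs)) (power_cat C (length xs)))"
    using assms by (simp add: okz_def K_iff)
  show ?thesis using is_functor.amap_Idt[OF action_functor a] by (simp add: arr_def obj_def)
qed

lemma oka_ids: "okz (T, xs) \<Longrightarrow> oka ((T, T), ids xs)"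
  using homs_ids[of xs] by (auto simp: okz_def oka_def tree_le_refl homs_iff)

lemma obj_Leaf: "x \<in> Obj C \<Longrightarrow> obj (Leaf, [x]) = x"
  using unit_obj by (simp add: obj_def)

lemma arr_Leaf: "f \<in> Arr C \<Longrightarrow> arr ((Leaf, Leaf), [f]) = f"
  using unit_arr by (simp add: arr_def)

lemma obj_graft:
  assumes "okt n S" "leaves S = length Z" "\<forall>z\<in>set Z. okz z"
  shows "obj (tval mk_node S (map fst Z), concat (map snd Z)) = obj (S, map obj Z)"
proof -
  have "list_all2 (\<lambda>T xs. T \<in> Obj (K_cat n (length xs)) \<and> set xs \<subseteq> Obj C) (map fst Z) (map snd Z)"
    using assms(3) by (simp add: list_all2_map1 list_all2_map2 list.rel_refl_strong okz_def K_iff)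
  moreover have "S \<in> Obj (K_cat n (length (map fst Z)))" using assms by (simp add: K_iff)
  ultimately show ?thesis
    using assoc_obj[of S "map fst Z" "map snd Z"] by (simp add: map2_map_map obj_def[abs_def] graft_tval)
qed

lemma arr_graft:
  assumes "okt n S" "leaves S = length Z" "okt n S'" "leaves S' = length Z" "tree_le S S'" "\<forall>z\<in>set Z. oka z"
  shows "arr ((tval mk_node S (map (\<lambda>z. fst (fst z)) Z), tval mk_node S' (map (\<lambda>z. snd (fst z)) Z)),
      concat (map snd Z)) = arr ((S, S'), map arr Z)"
proof -
  have "list_all2 (\<lambda>t fs. t \<in> Arr (K_cat n (length fs)) \<and> set fs \<subseteq> Arr C) (map fst Z) (map snd Z)"
    unfolding list_all2_map1 list_all2_map2
    by (rule list.rel_refl_strong) (use assms(6) in \<open>simp add: oka_def K_iff case_prod_beta\<close>)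
  moreover have "(S, S') \<in> Arr (K_cat n (length (map fst Z)))" using assms by (simp add: K_iff)
  ultimately show ?thesis
    using assoc_arr[of S S' "map fst Z" "map snd Z"] by (simp add: map2_map_map arr_def[abs_def] graft_tval o_def)
qed

definition mu :: "nat \<Rightarrow> ('o list, 'm list, 'o, 'm) ftor" where
  "mu k = \<lparr> omap = (\<lambda>xs. omap (\<theta> k) (corolla k, xs)),
            amap = (\<lambda>fs. amap (\<theta> k) ((corolla k, corolla k), fs)) \<rparr>"

definition as :: "nat \<Rightarrow> nat \<Rightarrow> nat \<Rightarrow> 'o list \<Rightarrow> 'm" where
  "as i j k xs = amap (\<theta> (i + j + k)) ((bush i j k, corolla (i + j + k)), ids xs)"

lemma corresponds_mu_as: "corresponds n C \<theta> mu as"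
  unfolding corresponds_def bush_graft by (simp add: functor_eq_def mu_def as_def)

lemma omap_mu: "length xs = k \<Longrightarrow> omap (mu k) xs = obj (corolla k, xs)"
  by (simp add: mu_def obj_def)

lemma amap_mu: "length fs = k \<Longrightarrow> amap (mu k) fs = arr ((corolla k, corolla k), fs)"
  by (simp add: mu_def arr_def)

lemma as_eq: "length xs = i + j + k \<Longrightarrow> as i j k xs = arr ((bush i j k, corolla (i + j + k)), ids xs)"
  by (simp add: as_def arr_def)

lemma mu_graft_obj:
  "enat (length Z) \<le> n \<Longrightarrow> \<forall>z\<in>set Z. okz z \<Longrightarrow> k = length Z \<Longrightarrow>
    omap (mu k) (map obj Z) = obj (mk_node (map fst Z), concat (map snd Z))"
  using obj_graft[of "corolla (length Z)" Z] okt_corolla[of "length Z" n]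
  by (simp add: omap_mu graft_corolla)

lemma mu_graft_arr:
  "enat (length Z) \<le> n \<Longrightarrow> \<forall>z\<in>set Z. oka z \<Longrightarrow> k = length Z \<Longrightarrow>
    amap (mu k) (map arr Z) =
    arr ((mk_node (map (\<lambda>z. fst (fst z)) Z), mk_node (map (\<lambda>z. snd (fst z)) Z)), concat (map snd Z))"
  using arr_graft[of "corolla (length Z)" Z "corolla (length Z)"] okt_corolla[of "length Z" n]
  by (simp add: amap_mu graft_corolla tree_le_refl)

text \<open>Computes associators at objects that are themselves values of trees. Terms of the
  monoidal axioms thereby become actions of arrows of trees with identity labels.\<close>

lemma as_graft:
  assumes "enat (length U + length Z + length V) \<le> n" "enat (length U + 1 + length V) \<le> n"
    "\<forall>z\<in>set (U @ Z @ V). okz z" "i = length U" "j = length Z" "k = length V"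
  shows "as i j k (map obj U @ map obj Z @ map obj V) =
    arr ((mk_node (map fst U @ mk_node (map fst Z) # map fst V), mk_node (map fst U @ map fst Z @ map fst V)),
      ids (concat (map snd (U @ Z @ V))))"
proof -
  let ?W = "map (\<lambda>z. ((fst z, fst z), ids (snd z))) (U @ Z @ V)"
  have W: "\<forall>z\<in>set ?W. oka z" using assms(3) by (auto intro!: oka_ids)
  have i: "map arr ?W = ids (map obj (U @ Z @ V))"
    using assms(3) arr_ids by (auto simp: image_Un)
  have t: "map (\<lambda>z. fst (fst z)) ?W = map fst U @ map fst Z @ map fst V"
    "map (\<lambda>z. snd (fst z)) ?W = map fst U @ map fst Z @ map fst V"
    "concat (map snd ?W) = ids (concat (map snd (U @ Z @ V)))"
    by (simp_all add: map_concat o_def)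
  have "okt n (bush i j k)" "okt n (corolla (i + j + k))"
    using okt_bush[of i j k n] okt_corolla[of "i + j + k" n] assms by simp_all
  moreover have "okt n t" if "t \<in> set (map fst U @ map fst Z @ map fst V)" for t
    using that assms(3) by (auto simp: okz_def)
  then have "tval mk_node (bush i j k) (map fst U @ map fst Z @ map fst V) =
      mk_node (map fst U @ mk_node (map fst Z) # map fst V)"
    using graft_bush[of "map fst U" "map fst Z" "map fst V" n] assms by simp
  moreover have "tval mk_node (corolla (i + j + k)) (map fst U @ map fst Z @ map fst V) =
     mk_node (map fst U @ map fst Z @ map fst V)"
    using assms by (intro graft_corolla) simp
  ultimately show ?thesis
    using arr_graft[of "bush i j k" ?W "corolla (i + j + k)"] assms W tree_le_bush
    unfolding i t by (simp add: as_eq)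
qed

text \<open>Every object is the value of the tree with one edge. In this form plain objects and
  products can stand side by side in \<open>as_graft\<close>.\<close>

definition leafs where "leafs xs = map (\<lambda>x. (Leaf, [x])) xs"

lemma leafs_simps [simp]:
  "map fst (leafs xs) = replicate (length xs) Leaf" "concat (map snd (leafs xs)) = xs"
  "length (leafs xs) = length xs"
  by (induction xs) (auto simp: leafs_def)

lemma obj_leafs [simp]: "set xs \<subseteq> Obj C \<Longrightarrow> map obj (leafs xs) = xs"
  by (induction xs) (auto simp: leafs_def obj_Leaf)

lemma okz_leafs: "set xs \<subseteq> Obj C \<Longrightarrow> \<forall>z\<in>set (leafs xs). okz z"
  by (auto simp: leafs_def okz_def stable_Leaf)

definition leafs_arr where "leafs_arr fs = map (\<lambda>f. ((Leaf, Leaf), [f])) fs"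

lemma leafs_arr_simps [simp]:
  "map (\<lambda>z. fst (fst z)) (leafs_arr fs) = replicate (length fs) Leaf"
  "map (\<lambda>z. snd (fst z)) (leafs_arr fs) = replicate (length fs) Leaf"
  "concat (map snd (leafs_arr fs)) = fs" "length (leafs_arr fs) = length fs"
  by (induction fs) (auto simp: leafs_arr_def)

lemma arr_leafs [simp]: "set fs \<subseteq> Arr C \<Longrightarrow> map arr (leafs_arr fs) = fs"
  by (induction fs) (auto simp: leafs_arr_def arr_Leaf)

lemma oka_leafs: "set fs \<subseteq> Arr C \<Longrightarrow> \<forall>z\<in>set (leafs_arr fs). oka z"
  by (auto simp: leafs_arr_def oka_def stable_Leaf tree_le_refl)

lemma okz_mk_node:
  assumes "\<forall>z\<in>set Z. okz z" "enat (length Z) \<le> n"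
  shows "okz (mk_node (map fst Z), concat (map snd Z))"
proof -
  have "okt n (mk_node (map fst Z))" using assms by (intro okt_mk_node) (auto simp: okz_def)
  moreover have "length (concat (map snd Z)) = total_leaves (map fst Z)"
    using assms(1) by (induction Z) (auto simp: okz_def)
  moreover have "set (concat (map snd Z)) \<subseteq> Obj C" using assms(1) by (auto simp: okz_def)
  ultimately show ?thesis by (simp add: okz_def)
qed

lemma okz_corolla: "set xs \<subseteq> Obj C \<Longrightarrow> enat (length xs) \<le> n \<Longrightarrow> okz (corolla (length xs), xs)"
  using okz_mk_node[OF okz_leafs, of xs] by (simp add: corolla_mk)

lemma oka_le:
  assumes "okz (T, xs)" "okz (T', xs)" "tree_le T T'"
  shows "oka ((T, T'), ids xs)"
  using assms homs_ids[of xs] by (auto simp: oka_def okz_def homs_iff)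

text \<open>The source of all coherence: in a poset the composite depends on the ends
  \<open>T\<close> and \<open>T''\<close> only, not on the intermediate tree.\<close>

lemma arr_comp_ids:
  assumes "okz (T, xs)" "okz (T', xs)" "okz (T'', xs)" "tree_le T T'" "tree_le T' T''"
  shows "arr ((T', T''), ids xs) \<bullet> arr ((T, T'), ids xs) = arr ((T, T''), ids xs)"
proof -
  have "homs (ids xs) xs xs" using assms(1) by (intro homs_ids) (simp add: okz_def)
  then show ?thesis
    using arr_comp[OF oka_le[OF assms(1,2,4)] oka_le[OF assms(2,3,5)]] map2_ids_left[of "ids xs" xs xs]
    by (simp add: homs_iff)
qed

lemma enat_mono: "enat k \<le> n \<Longrightarrow> j \<le> k \<Longrightarrow> enat j \<le> n"
  by (meson enat_ord_simps(1) order_trans)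

lemma range_iff: "assoc_range n i j k \<longleftrightarrow> enat (i + j + k) \<le> n \<and> enat (i + 1 + k) \<le> n"
  unfolding assoc_range_def enat_less_add_1 ..

lemma obj_Zero: "omap (mu 0) [] = obj (Zero, [])"
  by (simp add: omap_mu corolla_def)

lemma okz_Zero: "okz (Zero, [])"
  by (simp add: okz_def)

section \<open>Verification of the monoidal axioms\<close>

lemma functor_mu: "enat k \<le> n \<Longrightarrow> is_functor (power_cat C k) C (mu k)"
proof
  assume k: "enat k \<le> n"
  fix x assume x: "x \<in> Obj (power_cat C k)"
  then have "okz (corolla k, x)" using okz_corolla[of x] k by auto
  then show "omap (mu k) x \<in> Obj C" "amap (mu k) (Idt (power_cat C k) x) = Idt C (omap (mu k) x)"
    using obj_Obj arr_ids x by (simp_all add: omap_mu amap_mu)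
next
  assume k: "enat k \<le> n"
  fix f assume f: "f \<in> Arr (power_cat C k)"
  then have "oka ((corolla k, corolla k), f)"
    using okt_corolla[OF k] by (simp add: oka_def tree_le_refl)
  from hom_arr[OF this]
  show "amap (mu k) f \<in> Arr C" "Src C (amap (mu k) f) = omap (mu k) (Src (power_cat C k) f)"
    "Tgt C (amap (mu k) f) = omap (mu k) (Tgt (power_cat C k) f)"
    using f by (simp_all add: hom_def omap_mu amap_mu)
next
  assume k: "enat k \<le> n"
  fix f g assume fg: "f \<in> Arr (power_cat C k)" "g \<in> Arr (power_cat C k)" "Tgt (power_cat C k) f = Src (power_cat C k) g"
  then have "oka ((corolla k, corolla k), f)" "oka ((corolla k, corolla k), g)"
    using okt_corolla[OF k] by (simp_all add: oka_def tree_le_refl)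
  from arr_comp[OF this] show "amap (mu k) (Cmp (power_cat C k) g f) = amap (mu k) g \<bullet> amap (mu k) f"
    using fg by (simp add: amap_mu)
qed

lemma natural_as:
  assumes "assoc_range n i j k"
  shows "nat_transf (power_cat C (i + j + k)) C
    (functor_comp (mu (i + 1 + k)) (whisker i j (mu j))) (mu (i + j + k)) (as i j k)"
proof -
  have r: "enat (i + j + k) \<le> n" "enat (i + 1 + k) \<le> n" "enat j \<le> n"
    using assms enat_mono[of "i + j + k" j] by (auto simp: range_iff)
  have oka_b: "oka ((bush i j k, bush i j k), fs)" "oka ((bush i j k, corolla (i + j + k)), fs)"
    "oka ((corolla (i + j + k), corolla (i + j + k)), fs)"
    if "length fs = i + j + k" "set fs \<subseteq> Arr C" for fs
    using that okt_bush[OF r(1,2)] okt_corolla[OF r(1)] tree_le_bush by (auto simp: oka_def tree_le_refl)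
  \<comment> \<open>Grafting a corolla onto a leaf of a corolla gives a bush, so the source functor
    of the associator is the action of the bush.\<close>
  have wo: "omap (functor_comp (mu (i + 1 + k)) (whisker i j (mu j))) xs = obj (bush i j k, xs)"
    if xs: "length xs = i + j + k" "set xs \<subseteq> Obj C" for xs
  proof -
    define A B D where "A = take i xs" and "B = take j (drop i xs)" and "D = drop (i + j) xs"
    have e: "xs = A @ B @ D" unfolding A_def B_def D_def by (metis append_take_drop_id drop_drop add.commute)
    have l: "length A = i" "length B = j" "length D = k" using xs(1) by (auto simp: A_def B_def D_def)
    have s: "set A \<subseteq> Obj C" "set B \<subseteq> Obj C" "set D \<subseteq> Obj C" using xs(2) e by auto
    let ?Z = "leafs A @ (corolla j, B) # leafs D"
    have "\<forall>z\<in>set ?Z. okz z" using okz_leafs s okz_corolla[OF s(2)] r(3) l by auto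
    from mu_graft_obj[OF _ this, of "i + 1 + k"] show ?thesis using s l r(2)
      by (simp add: functor_comp_def whisker_def e bush_def corolla_mk[symmetric] omap_mu)
  qed
  have wa: "amap (functor_comp (mu (i + 1 + k)) (whisker i j (mu j))) fs = arr ((bush i j k, bush i j k), fs)"
    if fs: "length fs = i + j + k" "set fs \<subseteq> Arr C" for fs
  proof -
    define A B D where "A = take i fs" and "B = take j (drop i fs)" and "D = drop (i + j) fs"
    have e: "fs = A @ B @ D" unfolding A_def B_def D_def by (metis append_take_drop_id drop_drop add.commute)
    have l: "length A = i" "length B = j" "length D = k" using fs(1) by (auto simp: A_def B_def D_def)
    have s: "set A \<subseteq> Arr C" "set B \<subseteq> Arr C" "set D \<subseteq> Arr C" using fs(2) e by auto
    let ?Z = "leafs_arr A @ ((corolla j, corolla j), B) # leafs_arr D"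
    have "oka ((corolla j, corolla j), B)" using s(2) l(2) okt_corolla[OF r(3)] by (simp add: oka_def tree_le_refl)
    then have "\<forall>z\<in>set ?Z. oka z" using oka_leafs s by auto
    from mu_graft_arr[OF _ this, of "i + 1 + k"] show ?thesis using s l r(2)
      by (simp add: functor_comp_def whisker_def e bush_def corolla_mk[symmetric] amap_mu)
  qed
  show ?thesis
  proof
    fix xs assume "xs \<in> Obj (power_cat C (i + j + k))"
    then have xs: "length xs = i + j + k" "set xs \<subseteq> Obj C" by auto
    have "homs (ids xs) xs xs" using xs(2) by (rule homs_ids)
    then have i: "map (Src C) (ids xs) = xs" "map (Tgt C) (ids xs) = xs" "set (ids xs) \<subseteq> Arr C"
      by (simp_all only: homs_iff)
    have "hom (as i j k xs) (obj (bush i j k, xs)) (obj (corolla (i + j + k), xs))"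
      using hom_arr[OF oka_b(2)[of "ids xs"]] xs(1) i(3) unfolding i(1,2) by (simp add: as_eq)
    then show "as i j k xs \<in> Arr C"
      "Src C (as i j k xs) = omap (functor_comp (mu (i + 1 + k)) (whisker i j (mu j))) xs"
      "Tgt C (as i j k xs) = omap (mu (i + j + k)) xs"
      unfolding wo[OF xs] omap_mu[OF xs(1)] by (simp_all add: hom_def)
  next
    fix fs assume "fs \<in> Arr (power_cat C (i + j + k))"
    then have fs: "length fs = i + j + k" "set fs \<subseteq> Arr C" by auto
    have h: "homs fs (map (Src C) fs) (map (Tgt C) fs)" using fs(2) by (simp add: homs_iff)
    note ob = homs_Obj[OF h]
    have t: "map (Src C) (ids (map (Tgt C) fs)) = map (Tgt C) fs" "set (ids (map (Tgt C) fs)) \<subseteq> Arr C"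
      "map (Tgt C) (ids (map (Src C) fs)) = map (Src C) fs" "set (ids (map (Src C) fs)) \<subseteq> Arr C"
      using homs_ids[of "map (Tgt C) fs"] homs_ids[of "map (Src C) fs"] ob by (simp_all only: homs_iff)
    have "as i j k (map (Tgt C) fs) \<bullet> arr ((bush i j k, bush i j k), fs) =
        arr ((bush i j k, corolla (i + j + k)), map2 comp (ids (map (Tgt C) fs)) fs)"
      using arr_comp[OF oka_b(1)[OF fs] oka_b(2)[of "ids (map (Tgt C) fs)"] t(1)[symmetric]] fs(1) t(2)
      by (simp only: as_eq length_map)
    \<comment> \<open>Both sides of the naturality square are the action of the arrow that contracts
      the bush and has \<open>fs\<close> as labels.\<close>
    also have "map2 comp (ids (map (Tgt C) fs)) fs = map2 comp fs (ids (map (Src C) fs))"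
      using map2_ids_left[OF h] map2_ids_right[OF h] by simp
    also have "arr ((bush i j k, corolla (i + j + k)), map2 comp fs (ids (map (Src C) fs))) =
        arr ((corolla (i + j + k), corolla (i + j + k)), fs) \<bullet> as i j k (map (Src C) fs)"
      using arr_comp[OF oka_b(2)[of "ids (map (Src C) fs)"] oka_b(3)[OF fs] t(3)] fs(1) t(4)
      by (simp only: as_eq length_map)
    finally show "as i j k (Tgt (power_cat C (i + j + k)) fs) \<bullet>
        amap (functor_comp (mu (i + 1 + k)) (whisker i j (mu j))) fs =
        amap (mu (i + j + k)) fs \<bullet> as i j k (Src (power_cat C (i + j + k)) fs)"
      unfolding wa[OF fs] amap_mu[OF fs(1)] by simp
  qed
qed

lemma as_refl:
  assumes "bush i j k = corolla (i + j + k)" "length xs = i + j + k" "set xs \<subseteq> Obj C" "enat (i + j + k) \<le> n"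
  shows "as i j k xs = Idt C (omap (mu (i + j + k)) xs)"
  using arr_ids[OF okz_corolla[OF assms(3)]] assms by (simp add: as_eq omap_mu)

text \<open>Axiom (i): in these cases the bush is already a corolla, and the associator is the
  action of an identity.\<close>

lemma bush_unit: "bush i 0 k = corolla (i + k)" "bush i 1 k = corolla (i + 1 + k)" "bush 0 j 0 = corolla j"
proof -
  show "bush i 0 k = corolla (i + k)" by (simp add: bush_def corolla_mk mk_node_Zero replicate_add)
  have "replicate i Leaf @ Leaf # replicate k Leaf = replicate (i + 1 + k) Leaf"
    by (simp add: replicate_add replicate_app_Cons_same)
  then show "bush i 1 k = corolla (i + 1 + k)" unfolding bush_def corolla_mk by simp
  show "bush 0 j 0 = corolla j" by (simp add: bush_def corolla_mk)
qed

text \<open>The four associators are the sides of a square in the poset. In general,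
  \<open>?T0\<close> has two edges side by side, \<open>?T1\<close> and \<open>?T2\<close> arise by
  contracting one of them, and \<open>?T3\<close> by contracting both.\<close>

lemma as_parallel:
  assumes r: "assoc_range n (a + b + c) d e" "assoc_range n a b (c + e + 1)"
    "assoc_range n a b (c + d + e)" "assoc_range n (a + c + 1) d e"
    and o: "A \<in> Obj (power_cat C a)" "B \<in> Obj (power_cat C b)" "X \<in> Obj (power_cat C c)"
      "D \<in> Obj (power_cat C d)" "E \<in> Obj (power_cat C e)"
  shows "as (a + b + c) d e ((A @ B @ X) @ D @ E) \<bullet> as a b (c + e + 1) (A @ B @ (X @ [omap (mu d) D] @ E)) =
      as a b (c + d + e) (A @ B @ (X @ D @ E)) \<bullet> as (a + c + 1) d e ((A @ [omap (mu b) B] @ X) @ D @ E)"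
proof -
  have len: "length A = a" "length B = b" "length X = c" "length D = d" "length E = e" using o by auto
  have sub: "set A \<subseteq> Obj C" "set B \<subseteq> Obj C" "set X \<subseteq> Obj C" "set D \<subseteq> Obj C" "set E \<subseteq> Obj C" using o by auto
  have rr: "enat (a + b + c + d + e) \<le> n" "enat (a + b + c + 1 + e) \<le> n" "enat (a + 1 + c + 1 + e) \<le> n"
    "enat (a + 1 + c + d + e) \<le> n" "enat d \<le> n" "enat b \<le> n"
  proof -
    show 1: "enat (a + b + c + d + e) \<le> n" "enat (a + b + c + 1 + e) \<le> n" "enat (a + 1 + c + 1 + e) \<le> n"
      "enat (a + 1 + c + d + e) \<le> n" using r by (simp_all add: range_iff ac_simps)
    show "enat d \<le> n" "enat b \<le> n" by (rule enat_mono[OF 1(1)]; simp)+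
  qed
  let ?TA = "replicate a Leaf" and ?TB = "replicate b Leaf" and ?TX = "replicate c Leaf"
    and ?TD = "replicate d Leaf" and ?TE = "replicate e Leaf"
  let ?L = "A @ B @ X @ D @ E"
  let ?T0 = "mk_node (?TA @ mk_node ?TB # ?TX @ mk_node ?TD # ?TE)"
  let ?T1 = "mk_node (?TA @ ?TB @ ?TX @ mk_node ?TD # ?TE)"
  let ?T2 = "mk_node (?TA @ mk_node ?TB # ?TX @ ?TD @ ?TE)"
  let ?T3 = "mk_node (?TA @ ?TB @ ?TX @ ?TD @ ?TE)"
  have okB: "okz (mk_node ?TB, B)" and okD: "okz (mk_node ?TD, D)"
    using okz_corolla[OF sub(2)] okz_corolla[OF sub(4)] rr len by (simp_all add: corolla_mk)
  note lf = okz_leafs[OF sub(1)] okz_leafs[OF sub(2)] okz_leafs[OF sub(3)] okz_leafs[OF sub(4)] okz_leafs[OF sub(5)]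
  have vB: "omap (mu b) B = obj (mk_node ?TB, B)" and vD: "omap (mu d) D = obj (mk_node ?TD, D)"
    using len by (simp_all add: omap_mu corolla_mk)
  have 1: "as (a + b + c) d e ((A @ B @ X) @ D @ E) = arr ((?T1, ?T3), ids ?L)"
  proof -
    have z: "\<forall>z\<in>set ((leafs A @ leafs B @ leafs X) @ (leafs D) @ (leafs E)). okz z" using lf by (simp add: ball_Un)
    have "enat (length (leafs A @ leafs B @ leafs X) + length (leafs D) + length (leafs E)) \<le> n"
      "enat (length (leafs A @ leafs B @ leafs X) + 1 + length (leafs E)) \<le> n" using rr by (simp_all add: len add.assoc)
    note as_graft[OF this z refl refl refl]
    then show ?thesis using len sub by (simp add: add.assoc)
  qed
  have 2: "as a b (c + e + 1) (A @ B @ (X @ [omap (mu d) D] @ E)) = arr ((?T0, ?T1), ids ?L)"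
  proof -
    have z: "\<forall>z\<in>set ((leafs A) @ (leafs B) @ (leafs X @ (mk_node ?TD, D) # leafs E)). okz z" using lf okD by (simp add: ball_Un)
    have "enat (length (leafs A) + length (leafs B) + length (leafs X @ (mk_node ?TD, D) # leafs E)) \<le> n"
      "enat (length (leafs A) + 1 + length (leafs X @ (mk_node ?TD, D) # leafs E)) \<le> n" using rr by (simp_all add: len add.assoc)
    note as_graft[OF this z refl refl refl]
    then show ?thesis using len sub vD by (simp add: add.assoc)
  qed
  have 3: "as a b (c + d + e) (A @ B @ (X @ D @ E)) = arr ((?T2, ?T3), ids ?L)"
  proof -
    have z: "\<forall>z\<in>set ((leafs A) @ (leafs B) @ (leafs X @ leafs D @ leafs E)). okz z" using lf by (simp add: ball_Un)
    have "enat (length (leafs A) + length (leafs B) + length (leafs X @ leafs D @ leafs E)) \<le> n"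
      "enat (length (leafs A) + 1 + length (leafs X @ leafs D @ leafs E)) \<le> n" using rr by (simp_all add: len add.assoc)
    note as_graft[OF this z refl refl refl]
    then show ?thesis using len sub by (simp add: add.assoc)
  qed
  have 4: "as (a + c + 1) d e ((A @ [omap (mu b) B] @ X) @ D @ E) = arr ((?T0, ?T2), ids ?L)"
  proof -
    have z: "\<forall>z\<in>set ((leafs A @ (mk_node ?TB, B) # leafs X) @ (leafs D) @ (leafs E)). okz z" using lf okB by (simp add: ball_Un)
    have "enat (length (leafs A @ (mk_node ?TB, B) # leafs X) + length (leafs D) + length (leafs E)) \<le> n"
      "enat (length (leafs A @ (mk_node ?TB, B) # leafs X) + 1 + length (leafs E)) \<le> n" using rr by (simp_all add: len add.assoc)
    note as_graft[OF this z refl refl refl]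
    then show ?thesis using len sub vB by (simp add: add.assoc)
  qed
  have ok: "okz (?T0, ?L)" "okz (?T1, ?L)" "okz (?T2, ?L)" "okz (?T3, ?L)"
  proof -
    have "\<forall>z\<in>set (leafs A @ (mk_node ?TB, B) # leafs X @ (mk_node ?TD, D) # leafs E). okz z" using lf okB okD by (simp add: ball_Un)
    from okz_mk_node[OF this] show "okz (?T0, ?L)" using rr len by (simp add: add.assoc)
    have "\<forall>z\<in>set (leafs A @ leafs B @ leafs X @ (mk_node ?TD, D) # leafs E). okz z" using lf okB okD by (simp add: ball_Un)
    from okz_mk_node[OF this] show "okz (?T1, ?L)" using rr len by (simp add: add.assoc)
    have "\<forall>z\<in>set (leafs A @ (mk_node ?TB, B) # leafs X @ leafs D @ leafs E). okz z" using lf okB okD by (simp add: ball_Un)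
    from okz_mk_node[OF this] show "okz (?T2, ?L)" using rr len by (simp add: add.assoc)
    have "\<forall>z\<in>set (leafs A @ leafs B @ leafs X @ leafs D @ leafs E). okz z" using lf okB okD by (simp add: ball_Un)
    from okz_mk_node[OF this] show "okz (?T3, ?L)" using rr len by (simp add: add.assoc)
  qed
  have le: "tree_le ?T0 ?T1" "tree_le ?T0 ?T2" "tree_le ?T1 ?T3" "tree_le ?T2 ?T3"
    using tree_le_root[of ?TA ?TB "?TX @ mk_node ?TD # ?TE"] tree_le_root[of "?TA @ mk_node ?TB # ?TX" ?TD ?TE]
      tree_le_root[of "?TA @ ?TB @ ?TX" ?TD ?TE] tree_le_root[of ?TA ?TB "?TX @ ?TD @ ?TE"] by simp_all
  show ?thesis
    unfolding 1 2 3 4 arr_comp_ids[OF ok(1,2,4) le(1,3)] arr_comp_ids[OF ok(1,3,4) le(2,4)] ..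
qed

text \<open>Again a square in the poset, now with one edge above the other. The product of an
  associator with identities contracts the upper edge, so that this side is obtained from
  \<open>mu_graft_arr\<close> rather than \<open>as_graft\<close>.\<close>

lemma as_nested:
  assumes r: "assoc_range n a (b + c + d) e" "assoc_range n b c d"
    "assoc_range n (a + b) c (d + e)" "assoc_range n a (b + d + 1) e"
    and o: "A \<in> Obj (power_cat C a)" "B \<in> Obj (power_cat C b)" "X \<in> Obj (power_cat C c)"
      "D \<in> Obj (power_cat C d)" "E \<in> Obj (power_cat C e)"
  shows "as a (b + c + d) e (A @ (B @ X @ D) @ E) \<bullet>
      amap (mu (a + e + 1)) (ids A @ [as b c d (B @ X @ D)] @ ids E) =
      as (a + b) c (d + e) ((A @ B) @ X @ (D @ E)) \<bullet> as a (b + d + 1) e (A @ (B @ [omap (mu c) X] @ D) @ E)"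
proof -
  have len: "length A = a" "length B = b" "length X = c" "length D = d" "length E = e" using o by auto
  have sub: "set A \<subseteq> Obj C" "set B \<subseteq> Obj C" "set X \<subseteq> Obj C" "set D \<subseteq> Obj C" "set E \<subseteq> Obj C" using o by auto
  have rr: "enat (a + b + c + d + e) \<le> n" "enat (a + b + 1 + d + e) \<le> n" "enat (a + 1 + e) \<le> n"
    "enat (b + 1 + d) \<le> n" "enat (b + c + d) \<le> n" "enat c \<le> n"
  proof -
    show "enat (a + b + c + d + e) \<le> n" "enat (a + b + 1 + d + e) \<le> n" "enat (a + 1 + e) \<le> n"
      "enat (b + 1 + d) \<le> n" and 1: "enat (b + c + d) \<le> n" using r by (simp_all add: range_iff ac_simps)
    show "enat c \<le> n" by (rule enat_mono[OF 1]) simp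
  qed
  let ?TA = "replicate a Leaf" and ?TB = "replicate b Leaf" and ?TX = "replicate c Leaf"
    and ?TD = "replicate d Leaf" and ?TE = "replicate e Leaf"
  let ?L = "A @ B @ X @ D @ E"
  let ?I = "mk_node (?TB @ mk_node ?TX # ?TD)" and ?J = "mk_node (?TB @ ?TX @ ?TD)"
  let ?T0 = "mk_node (?TA @ ?I # ?TE)"
  let ?T1 = "mk_node (?TA @ ?J # ?TE)"
  let ?T2 = "mk_node (?TA @ ?TB @ mk_node ?TX # ?TD @ ?TE)"
  let ?T3 = "mk_node (?TA @ ?TB @ ?TX @ ?TD @ ?TE)"
  note lf = okz_leafs[OF sub(1)] okz_leafs[OF sub(2)] okz_leafs[OF sub(3)] okz_leafs[OF sub(4)] okz_leafs[OF sub(5)]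
  have okX: "okz (mk_node ?TX, X)" using okz_corolla[OF sub(3)] rr len by (simp add: corolla_mk)
  have okI: "okz (?I, B @ X @ D)"
    using okz_mk_node[of "leafs B @ (mk_node ?TX, X) # leafs D"] lf okX rr len by (simp add: ball_Un)
  have okJ: "okz (?J, B @ X @ D)"
    using okz_mk_node[of "leafs B @ leafs X @ leafs D"] lf rr len by (simp_all add: add.assoc ball_Un)
  have vX: "omap (mu c) X = obj (mk_node ?TX, X)" using len by (simp add: omap_mu corolla_mk)
  have leIJ: "tree_le ?I ?J" by (rule tree_le_root)
  have 1: "as a (b + c + d) e (A @ (B @ X @ D) @ E) = arr ((?T1, ?T3), ids ?L)"
  proof -
    have z: "\<forall>z\<in>set ((leafs A) @ (leafs B @ leafs X @ leafs D) @ (leafs E)). okz z" using lf by (simp add: ball_Un)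
    have "enat (length (leafs A) + length (leafs B @ leafs X @ leafs D) + length (leafs E)) \<le> n"
      "enat (length (leafs A) + 1 + length (leafs E)) \<le> n" using rr by (simp_all add: len add.assoc)
    note as_graft[OF this z refl refl refl]
    then show ?thesis using len sub by (simp add: add.assoc)
  qed
  have 2: "amap (mu (a + e + 1)) (ids A @ [as b c d (B @ X @ D)] @ ids E) = arr ((?T0, ?T1), ids ?L)"
  proof -
    have i: "set (ids A) \<subseteq> Arr C" "set (ids E) \<subseteq> Arr C"
      using homs_ids[OF sub(1)] homs_ids[OF sub(5)] by (simp_all only: homs_iff)
    have "as b c d (B @ X @ D) = arr ((?I, ?J), ids (B @ X @ D))"
      proof -
    have z: "\<forall>z\<in>set ((leafs B) @ (leafs X) @ (leafs D)). okz z" using lf by (simp add: ball_Un)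
    have "enat (length (leafs B) + length (leafs X) + length (leafs D)) \<le> n"
      "enat (length (leafs B) + 1 + length (leafs D)) \<le> n" using rr by (simp_all add: len add.assoc)
    note as_graft[OF this z refl refl refl]
    then show ?thesis using len sub by (simp add: add.assoc)
  qed
    moreover have "\<forall>z\<in>set (leafs_arr (ids A) @ ((?I, ?J), ids (B @ X @ D)) # leafs_arr (ids E)). oka z"
      using oka_leafs[OF i(1)] oka_leafs[OF i(2)] oka_le[OF okI okJ leIJ] by (simp add: ball_Un)
    ultimately show ?thesis
      using mu_graft_arr[of "leafs_arr (ids A) @ ((?I, ?J), ids (B @ X @ D)) # leafs_arr (ids E)" "a + e + 1"]
        rr len i by simp
  qed
  have 3: "as (a + b) c (d + e) ((A @ B) @ X @ (D @ E)) = arr ((?T2, ?T3), ids ?L)"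
  proof -
    have z: "\<forall>z\<in>set ((leafs A @ leafs B) @ (leafs X) @ (leafs D @ leafs E)). okz z" using lf by (simp add: ball_Un)
    have "enat (length (leafs A @ leafs B) + length (leafs X) + length (leafs D @ leafs E)) \<le> n"
      "enat (length (leafs A @ leafs B) + 1 + length (leafs D @ leafs E)) \<le> n" using rr by (simp_all add: len add.assoc)
    note as_graft[OF this z refl refl refl]
    then show ?thesis using len sub by (simp add: add.assoc)
  qed
  have 4: "as a (b + d + 1) e (A @ (B @ [omap (mu c) X] @ D) @ E) = arr ((?T0, ?T2), ids ?L)"
  proof -
    have z: "\<forall>z\<in>set ((leafs A) @ (leafs B @ (mk_node ?TX, X) # leafs D) @ (leafs E)). okz z" using lf okX by (simp add: ball_Un)
    have "enat (length (leafs A) + length (leafs B @ (mk_node ?TX, X) # leafs D) + length (leafs E)) \<le> n"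
      "enat (length (leafs A) + 1 + length (leafs E)) \<le> n" using rr by (simp_all add: len add.assoc)
    note as_graft[OF this z refl refl refl]
    then show ?thesis using len sub vX by (simp add: add.assoc)
  qed
  have ok: "okz (?T0, ?L)" "okz (?T1, ?L)" "okz (?T2, ?L)" "okz (?T3, ?L)"
  proof -
    have "\<forall>z\<in>set (leafs A @ (?I, B @ X @ D) # leafs E). okz z" using lf okI okJ okX by (simp add: ball_Un)
    from okz_mk_node[OF this] show "okz (?T0, ?L)" using rr len by (simp add: add.assoc)
    have "\<forall>z\<in>set (leafs A @ (?J, B @ X @ D) # leafs E). okz z" using lf okI okJ okX by (simp add: ball_Un)
    from okz_mk_node[OF this] show "okz (?T1, ?L)" using rr len by (simp add: add.assoc)
    have "\<forall>z\<in>set (leafs A @ leafs B @ (mk_node ?TX, X) # leafs D @ leafs E). okz z" using lf okI okJ okX by (simp add: ball_Un)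
    from okz_mk_node[OF this] show "okz (?T2, ?L)" using rr len by (simp add: add.assoc)
    have "\<forall>z\<in>set (leafs A @ leafs B @ leafs X @ leafs D @ leafs E). okz z" using lf okI okJ okX by (simp add: ball_Un)
    from okz_mk_node[OF this] show "okz (?T3, ?L)" using rr len by (simp add: add.assoc)
  qed
  have le: "tree_le ?T0 ?T1" "tree_le ?T0 ?T2" "tree_le ?T1 ?T3" "tree_le ?T2 ?T3"
    using tree_le_mk_node[OF leIJ, of ?TA ?TE] tree_le_root[of ?TA "?TB @ mk_node ?TX # ?TD" ?TE]
      tree_le_root[of ?TA "?TB @ ?TX @ ?TD" ?TE] tree_le_root[of "?TA @ ?TB" ?TX "?TD @ ?TE"] by simp_all
  show ?thesis
    unfolding 1 2 3 4 arr_comp_ids[OF ok(1,2,4) le(1,3)] arr_comp_ids[OF ok(1,3,4) le(2,4)] ..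
qed

lemma A_monoidal_mu: "A_monoidal n C mu as"
proof (rule A_monoidal.intro)
  show "is_functor (power_cat C k) C (mu k)" if "enat k < n + 1" for k
    using that functor_mu by (simp add: enat_less_add_1)
  show "omap (mu 1) [x] = x" if "x \<in> Obj C" for x
    using obj_Leaf[OF that] by (simp add: omap_mu corolla_def)
  show "amap (mu 1) [f] = f" if "f \<in> Arr C" for f
    using arr_Leaf[OF that] by (simp add: amap_mu corolla_def)
next
  fix i j k xs ys
  assume a: "i + j + 1 = k" "enat k < n + 1" "xs \<in> Obj (power_cat C i)" "ys \<in> Obj (power_cat C j)"
  then have l: "length xs = i" "length ys = j" "k = i + 1 + j" and s: "set xs \<subseteq> Obj C" "set ys \<subseteq> Obj C"
    by auto
  \<comment> \<open>The unit object is the value of the empty tree, and grafting the empty tree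
    deletes a leaf of the corolla.\<close>
  let ?Z = "leafs xs @ (Zero, []) # leafs ys"
  have z: "\<forall>z\<in>set ?Z. okz z" using okz_leafs[OF s(1)] okz_leafs[OF s(2)] okz_Zero by (simp add: ball_Un)
  have e: "enat (length ?Z) \<le> n" using a(2) by (simp add: enat_less_add_1 l)
  show "omap (mu k) (xs @ [omap (mu 0) []] @ ys) = omap (mu (k - 1)) (xs @ ys)"
    using mu_graft_obj[OF e z refl] s by (simp add: obj_Zero mk_node_Zero l omap_mu corolla_mk replicate_add)
next
  fix i j k fs gs
  assume a: "i + j + 1 = k" "enat k < n + 1" "fs \<in> Arr (power_cat C i)" "gs \<in> Arr (power_cat C j)"
  then have l: "length fs = i" "length gs = j" "k = i + 1 + j" and s: "set fs \<subseteq> Arr C" "set gs \<subseteq> Arr C"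
    by auto
  let ?Z = "leafs_arr fs @ ((Zero, Zero), []) # leafs_arr gs"
  have z: "\<forall>z\<in>set ?Z. oka z"
    using oka_leafs[OF s(1)] oka_leafs[OF s(2)] oka_ids[OF okz_Zero] by (simp add: ball_Un)
  have e: "enat (length ?Z) \<le> n" using a(2) by (simp add: enat_less_add_1 l)
  have "arr ((Zero, Zero), []) = Idt C (obj (Zero, []))" using arr_ids[OF okz_Zero] by simp
  then show "amap (mu k) (fs @ [Idt C (omap (mu 0) [])] @ gs) = amap (mu (k - 1)) (fs @ gs)"
    using mu_graft_arr[OF e z refl] s by (simp add: obj_Zero mk_node_Zero l amap_mu corolla_mk replicate_add)
next
  fix i j k assume "assoc_range n i j k"
  then show "nat_transf (power_cat C (i + j + k)) C
    (functor_comp (mu (i + 1 + k)) (whisker i j (mu j))) (mu (i + j + k)) (as i j k)" by (rule natural_as)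
next
  fix i k xs assume "assoc_range n i 0 k" "xs \<in> Obj (power_cat C (i + k))"
  then show "as i 0 k xs = Idt C (omap (mu (i + k)) xs)"
    using as_refl[of i 0 k xs] bush_unit(1) by (simp add: range_iff)
next
  fix i k xs assume "assoc_range n i 1 k" "xs \<in> Obj (power_cat C (i + 1 + k))"
  then show "as i 1 k xs = Idt C (omap (mu (i + 1 + k)) xs)"
    using as_refl[of i 1 k xs] bush_unit(2) by (simp add: range_iff)
next
  fix j xs assume "assoc_range n 0 j 0" "xs \<in> Obj (power_cat C j)"
  then show "as 0 j 0 xs = Idt C (omap (mu j) xs)"
    using as_refl[of 0 j 0 xs] bush_unit(3) by (simp add: range_iff)
next
  fix a b c d A B X D
  assume r: "assoc_range n (a + b + 1) c d" "assoc_range n (a + b) c d"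
    and o: "A \<in> Obj (power_cat C a)" "B \<in> Obj (power_cat C b)" "X \<in> Obj (power_cat C c)" "D \<in> Obj (power_cat C d)"
  then have len: "length A = a" "length B = b" "length X = c" "length D = d"
    and sub: "set A \<subseteq> Obj C" "set B \<subseteq> Obj C" "set X \<subseteq> Obj C" "set D \<subseteq> Obj C" by auto
  \<comment> \<open>Axiom (ii): an additional empty tree changes neither the source nor the target
    in \<open>as_graft\<close>, so both sides are the action of the same arrow. Axioms (iii) and
    (iv) follow in the same way.\<close>
  have ok: "\<forall>z\<in>set ((leafs A @ (Zero, []) # leafs B) @ leafs X @ leafs D). okz z"
    using okz_leafs[OF sub(1)] okz_leafs[OF sub(2)] okz_leafs[OF sub(3)] okz_leafs[OF sub(4)] okz_Zero
    by (simp add: ball_Un)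
  then have ok': "\<forall>z\<in>set (leafs (A @ B) @ leafs X @ leafs D). okz z"
    by (simp add: leafs_def)
  have e: "enat (length ((leafs A @ (Zero, []) # leafs B)) + length (leafs X) + length (leafs D)) \<le> n"
    "enat (length ((leafs A @ (Zero, []) # leafs B)) + 1 + length (leafs D)) \<le> n" using r(1) by (simp_all add: len range_iff add.assoc)
  have e': "enat (length (leafs (A @ B)) + length (leafs X) + length (leafs D)) \<le> n"
    "enat (length (leafs (A @ B)) + 1 + length (leafs D)) \<le> n" using r(2) by (simp_all add: len range_iff add.assoc)
  show "as (a + b + 1) c d ((A @ [omap (mu 0) []] @ B) @ X @ D) = as (a + b) c d ((A @ B) @ X @ D)"
    using as_graft[OF e ok refl refl refl] as_graft[OF e' ok' refl refl refl] sub
    by (simp add: len obj_Zero mk_node_Zero replicate_add add.assoc)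
next
  fix a b c d A B X D
  assume r: "assoc_range n a b (c + d + 1)" "assoc_range n a b (c + d)"
    and o: "A \<in> Obj (power_cat C a)" "B \<in> Obj (power_cat C b)" "X \<in> Obj (power_cat C c)" "D \<in> Obj (power_cat C d)"
  then have len: "length A = a" "length B = b" "length X = c" "length D = d"
    and sub: "set A \<subseteq> Obj C" "set B \<subseteq> Obj C" "set X \<subseteq> Obj C" "set D \<subseteq> Obj C" by auto
  have ok: "\<forall>z\<in>set (leafs A @ leafs B @ (leafs X @ (Zero, []) # leafs D)). okz z"
    using okz_leafs[OF sub(1)] okz_leafs[OF sub(2)] okz_leafs[OF sub(3)] okz_leafs[OF sub(4)] okz_Zero
    by (simp add: ball_Un)
  then have ok': "\<forall>z\<in>set (leafs A @ leafs B @ leafs (X @ D)). okz z"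
    by (simp add: leafs_def)
  have z: "mk_node (us @ mk_node ts # vs @ Zero # ws) = mk_node (us @ mk_node ts # vs @ ws)"
    "mk_node (us @ ts @ vs @ Zero # ws) = mk_node (us @ ts @ vs @ ws)" for us ts vs ws
    using mk_node_Zero[of "us @ mk_node ts # vs" ws] mk_node_Zero[of "us @ ts @ vs" ws] by simp_all
  have e: "enat (length (leafs A) + length (leafs B) + length ((leafs X @ (Zero, []) # leafs D))) \<le> n"
    "enat (length (leafs A) + 1 + length ((leafs X @ (Zero, []) # leafs D))) \<le> n" using r(1) by (simp_all add: len range_iff add.assoc)
  have e': "enat (length (leafs A) + length (leafs B) + length (leafs (X @ D))) \<le> n"
    "enat (length (leafs A) + 1 + length (leafs (X @ D))) \<le> n" using r(2) by (simp_all add: len range_iff add.assoc)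
  show "as a b (c + d + 1) (A @ B @ (X @ [omap (mu 0) []] @ D)) = as a b (c + d) (A @ B @ (X @ D))"
    using as_graft[OF e ok refl refl refl] as_graft[OF e' ok' refl refl refl] sub
    by (simp add: len obj_Zero z replicate_add add.assoc)
next
  fix a b c d A B X D
  assume r: "assoc_range n a (b + c + 1) d" "assoc_range n a (b + c) d"
    and o: "A \<in> Obj (power_cat C a)" "B \<in> Obj (power_cat C b)" "X \<in> Obj (power_cat C c)" "D \<in> Obj (power_cat C d)"
  then have len: "length A = a" "length B = b" "length X = c" "length D = d"
    and sub: "set A \<subseteq> Obj C" "set B \<subseteq> Obj C" "set X \<subseteq> Obj C" "set D \<subseteq> Obj C" by auto
  have ok: "\<forall>z\<in>set (leafs A @ (leafs B @ (Zero, []) # leafs X) @ leafs D). okz z"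
    using okz_leafs[OF sub(1)] okz_leafs[OF sub(2)] okz_leafs[OF sub(3)] okz_leafs[OF sub(4)] okz_Zero
    by (simp add: ball_Un)
  then have ok': "\<forall>z\<in>set (leafs A @ leafs (B @ X) @ leafs D). okz z"
    by (simp add: leafs_def)
  have z: "mk_node (us @ ts @ Zero # vs @ ws) = mk_node (us @ ts @ vs @ ws)" for us ts vs ws
    using mk_node_Zero[of "us @ ts" "vs @ ws"] by simp
  have e: "enat (length (leafs A) + length ((leafs B @ (Zero, []) # leafs X)) + length (leafs D)) \<le> n"
    "enat (length (leafs A) + 1 + length (leafs D)) \<le> n" using r(1) by (simp_all add: len range_iff add.assoc)
  have e': "enat (length (leafs A) + length (leafs (B @ X)) + length (leafs D)) \<le> n"
    "enat (length (leafs A) + 1 + length (leafs D)) \<le> n" using r(2) by (simp_all add: len range_iff add.assoc)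
  show "as a (b + c + 1) d (A @ (B @ [omap (mu 0) []] @ X) @ D) = as a (b + c) d (A @ (B @ X) @ D)"
    using as_graft[OF e ok refl refl refl] as_graft[OF e' ok' refl refl refl] sub
    by (simp add: len obj_Zero z mk_node_Zero replicate_add add.assoc)
qed (use as_parallel as_nested in simp_all)

end

section \<open>Uniqueness of the action\<close>

context monoidal begin

lemma tval_M_corolla: "length xs = k \<Longrightarrow> ob xs \<Longrightarrow> tval M (corolla k) xs = M xs"
  by (rule tval_corolla) (cases xs; auto simp: M_single)+

lemma tval_Mf_corolla: "length fs = k \<Longrightarrow> set fs \<subseteq> Arr C \<Longrightarrow> tval Mf (corolla k) fs = Mf fs"
  by (rule tval_corolla) (cases fs; auto simp: Mf_single)+

text \<open>A bush is contracted at its root, so \<open>ct_root\<close> identifies its canonical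
  morphism with the given associator.\<close>

lemma can_bush:
  assumes "assoc_range n i j k" "length xs = i + j + k" "ob xs"
  shows "can (bush i j k) (corolla (i + j + k)) xs = \<alpha> i j k xs"
proof -
  define A B D where "A = take i xs" and "B = take j (drop i xs)" and "D = drop (i + j) xs"
  have e: "xs = A @ B @ D" unfolding A_def B_def D_def by (metis append_take_drop_id drop_drop add.commute)
  have l: "length A = i" "length B = j" "length D = k" using assms(2) by (auto simp: A_def B_def D_def)
  have "ct (mk_node (replicate i Leaf @ mk_node (replicate j Leaf) # replicate k Leaf))
    (mk_node (replicate i Leaf @ replicate j Leaf @ replicate k Leaf)) (A @ B @ D)
    (al (tvals M (replicate i Leaf) A) (tvals M (replicate j Leaf) B) (tvals M (replicate k Leaf) D))"
    using assms l e by (intro ct_root) (auto simp: range_iff stable_Leaf)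
  then have "ct (bush i j k) (corolla (i + j + k)) xs (\<alpha> i j k xs)"
    by (simp add: bush_def corolla_mk replicate_add tvals_replicate_Leaf l al_def e)
  then show ?thesis by (rule can_eq)
qed

lemma corresponds_action: "corresponds n C action \<mu> \<alpha>"
  unfolding corresponds_def bush_graft
proof (intro conjI allI impI ballI)
  fix k assume k: "enat k < n + 1"
  have ok: "okt n (corolla k)" using k okt_corolla by (simp add: enat_less_add_1)
  have "can (corolla k) (corolla k) (map (Tgt C) fs) \<bullet> tval Mf (corolla k) fs = Mf fs"
    if fs: "length fs = k" "set fs \<subseteq> Arr C" for fs
  proof -
    have h: "homs fs (map (Src C) fs) (map (Tgt C) fs)" using fs by (simp add: homs_iff)
    have "hom (Mf fs) (M (map (Src C) fs)) (M (map (Tgt C) fs))"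
      using hom_Mf[OF h] k fs by (simp add: bnd_def enat_less_add_1)
    then show ?thesis
      using can_refl[OF ok] homs_Obj[OF h] fs by (simp add: tval_M_corolla tval_Mf_corolla comp_Idt)
  qed
  then show "functor_eq (power_cat C k) (\<mu> k)
      \<lparr>omap = \<lambda>xs. omap (action k) (corolla k, xs), amap = \<lambda>fs. amap (action k) ((corolla k, corolla k), fs)\<rparr>"
    by (auto simp: functor_eq_def tval_M_corolla M_def Mf_def)
next
  fix i j k xs assume r: "assoc_range n i j k" and x: "xs \<in> Obj (power_cat C (i + j + k))"
  then have xs: "length xs = i + j + k" "ob xs" by auto
  have i: "map (Tgt C) (ids xs) = xs" using homs_ids[OF xs(2)] by (simp only: homs_iff)
  have ok: "okt n (bush i j k)" "okt n (corolla (i + j + k))"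
    using r okt_bush[of i j k n] okt_corolla[of "i + j + k" n] by (simp_all add: range_iff bnd_def)
  have "hom (can (bush i j k) (corolla (i + j + k)) xs) (tval M (bush i j k) xs) (tval M (corolla (i + j + k)) xs)"
    using tree_le_bush ok xs by (intro hom_can) auto
  then show "\<alpha> i j k xs = amap (action (i + j + k)) ((bush i j k, corolla (i + j + k)), ids xs)"
    using tval_ids(1)[OF ok(1) xs(2)] xs unfolding action_simps i can_bush[OF r xs]
    by (simp add: comp_Idt)
qed

end

text \<open>The algebra structure is arbitrary except that it induces the given \<open>\<mu>\<close>
  and \<open>\<alpha>\<close>. It is compared with \<open>action\<close> step by step: on objects,
  on arrows of labels, and on contractions.\<close>

locale compatible = monoidal n C \<mu> \<alpha> + k: k_action n C \<theta>
  for n :: enat and C :: "('o, 'm) cat" and \<mu> \<alpha> \<theta> +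
  assumes corr: "corresponds n C \<theta> \<mu> \<alpha>"
begin

lemma mu_eq:
  "enat k \<le> n \<Longrightarrow> length xs = k \<Longrightarrow> ob xs \<Longrightarrow> omap (k.mu k) xs = M xs"
  "enat k \<le> n \<Longrightarrow> length fs = k \<Longrightarrow> set fs \<subseteq> Arr C \<Longrightarrow> amap (k.mu k) fs = Mf fs"
  using corr by (auto simp: corresponds_def functor_eq_def k.mu_def M_def Mf_def enat_less_add_1)

lemma as_eq_al:
  assumes "enat (length us + length ts + length vs) \<le> n" "enat (length us + 1 + length vs) \<le> n" "ob (us @ ts @ vs)"
  shows "k.as (length us) (length ts) (length vs) (us @ ts @ vs) = al us ts vs"
  using corr assms unfolding corresponds_def bush_graft k.as_def al_def
  by (simp add: k.range_iff)

lemma okz_split: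
  assumes "length xs = total_leaves ts" "\<forall>t\<in>set ts. okt n t" "ob xs"
  obtains Z where "map fst Z = ts" "concat (map snd Z) = xs" "\<forall>z\<in>set Z. k.okz z"
    "tvals M ts xs = map (\<lambda>z. tval M (fst z) (snd z)) Z"
proof -
  obtain Z where Z: "ts = map fst Z" "xs = concat (map snd Z)" "\<forall>z\<in>set Z. length (snd z) = leaves (fst z)"
    using split_lengths[OF assms(1)] by blast
  have "\<forall>z\<in>set Z. k.okz z"
    using Z assms(2,3) by (auto simp: k.okz_def)
  then show thesis using that[of Z] Z tvals_map_concat[OF Z(3)] by simp
qed

text \<open>A tree with a root node is a corolla with the trees above the root grafted onto it.
  Associativity of the action thus computes its value recursively from \<open>\<mu>\<close>.\<close>

lemma obj_eq: "okt n T \<Longrightarrow> ob xs \<Longrightarrow> length xs = leaves T \<Longrightarrow> k.obj (T, xs) = tval M T xs"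
proof (induction T arbitrary: xs)
  case Zero
  then show ?case using mu_eq(1)[of 0 "[]"] by (simp add: k.omap_mu corolla_def zero_enat_def[symmetric])
next
  case Leaf
  then obtain x where "xs = [x]" by (cases xs) auto
  then show ?case using Leaf by (simp add: k.obj_Leaf)
next
  case (Node ts)
  have ts: "2 \<le> length ts" "enat (length ts) \<le> n" "\<forall>t\<in>set ts. stable n t"
    using Node.prems(1) unfolding okt_Node by auto
  have l: "length xs = total_leaves ts" using Node.prems by simp
  obtain Z where Z: "map fst Z = ts" "concat (map snd Z) = xs" "\<forall>z\<in>set Z. k.okz z"
    "tvals M ts xs = map (\<lambda>z. tval M (fst z) (snd z)) Z"
    using okz_split[OF l _ Node.prems(2)] ts(3) by blast
  have lZ: "length Z = length ts" using Z(1) by auto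
  have "mk_node ts = Node ts" using ts stable_Zero by (intro mk_node_Node) auto
  then have "k.obj (Node ts, xs) = omap (k.mu (length Z)) (map k.obj Z)"
    using k.mu_graft_obj[OF _ Z(3) refl] ts(2) lZ Z(1,2) by simp
  also have "\<dots> = M (map k.obj Z)"
    using Z(3) k.obj_Obj ts(2) lZ by (intro mu_eq(1)) auto
  also have "map k.obj Z = tvals M ts xs"
  proof -
    have "k.obj z = tval M (fst z) (snd z)" if z: "z \<in> set Z" for z
    proof -
      have "k.okz z" "fst z \<in> set ts" using Z z by auto
      then show ?thesis using Node.IH[of "fst z" "snd z"] by (simp add: k.okz_def)
    qed
    then show ?thesis unfolding Z(4) by simp
  qed
  finally show ?case by simp
qed

lemma map_obj_eq: "\<forall>z\<in>set Z. k.okz z \<Longrightarrow> map k.obj Z = map (\<lambda>z. tval M (fst z) (snd z)) Z"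
  using obj_eq by (auto simp: k.okz_def)

lemma arr_eq: "okt n T \<Longrightarrow> set fs \<subseteq> Arr C \<Longrightarrow> length fs = leaves T \<Longrightarrow> k.arr ((T, T), fs) = tval Mf T fs"
proof (induction T arbitrary: fs)
  case Zero
  then show ?case using k.arr_ids[OF k.okz_Zero] obj_eq[of Zero "[]"] by (simp add: Mf_Nil)
next
  case Leaf
  then obtain f where "fs = [f]" by (cases fs) auto
  then show ?case using Leaf by (simp add: k.arr_Leaf)
next
  case (Node ts)
  have ts: "2 \<le> length ts" "enat (length ts) \<le> n" "\<forall>t\<in>set ts. stable n t"
    using Node.prems(1) unfolding okt_Node by auto
  have l: "length fs = total_leaves ts" using Node.prems by simp
  obtain Z where Z: "ts = map fst Z" "fs = concat (map snd Z)" "\<forall>z\<in>set Z. length (snd z) = leaves (fst z)"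
    using split_lengths[OF l] by blast
  let ?W = "map (\<lambda>z. ((fst z, fst z), snd z)) Z"
  have W: "\<forall>z\<in>set ?W. k.oka z"
    using Z ts(3) Node.prems(2) by (auto simp: k.oka_def tree_le_refl)
  have W': "map (\<lambda>z. fst (fst z)) ?W = ts" "map (\<lambda>z. snd (fst z)) ?W = ts" "concat (map snd ?W) = fs"
    "length ?W = length ts"
    using Z by (simp_all add: o_def)
  have "mk_node ts = Node ts" using ts stable_Zero by (intro mk_node_Node) auto
  then have "k.arr ((Node ts, Node ts), fs) = amap (k.mu (length ?W)) (map k.arr ?W)"
    using k.mu_graft_arr[OF _ W refl] ts(2) unfolding W' by simp
  also have "\<dots> = Mf (map k.arr ?W)"
  proof (rule mu_eq(2))
    have "k.arr z \<in> Arr C" if "k.oka z" for z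
      using k.hom_arr[of "fst (fst z)" "snd (fst z)" "snd z"] that by (simp add: hom_def)
    then show "set (map k.arr ?W) \<subseteq> Arr C" using W by auto
  qed (use ts W' in simp_all)
  also have "map k.arr ?W = tvals Mf ts fs"
  proof -
    have "k.arr ((fst z, fst z), snd z) = tval Mf (fst z) (snd z)" if z: "z \<in> set Z" for z
    proof -
      have "k.oka ((fst z, fst z), snd z)" "fst z \<in> set ts" using W Z z by auto
      then show ?thesis using Node.IH[of "fst z" "snd z"] by (simp add: k.oka_def)
    qed
    then show ?thesis using tvals_map_concat[OF Z(3), of Mf] Z(1,2) by simp
  qed
  finally show ?case by simp
qed

text \<open>A contraction at the root comes from a bush by grafting and acts as an associator.
  Further up, it is a corolla applied to a smaller contraction and identities, so induction
  applies.\<close>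

lemma arr_shrink:
  assumes "shrink T T'" "stable n T" "stable n T'" "ob xs" "length xs = leaves T"
  shows "k.arr ((T, T'), ids xs) = can T T' xs"
  using assms
proof (induction arbitrary: xs rule: shrink_stable_induct)
  case (root us ts vs)
  obtain xu xt xv where x: "xs = xu @ xt @ xv" "length xu = total_leaves us"
    "length xt = total_leaves ts" "length xv = total_leaves vs"
    using root.prems by (auto simp: add.assoc intro: split_labels3[of xs us ts vs])
  have ob: "ob xu" "ob xt" "ob xv" using root.prems x by auto
  have ok: "\<forall>t\<in>set us. okt n t" "\<forall>t\<in>set ts. okt n t" "\<forall>t\<in>set vs. okt n t" using root by auto
  obtain U where U: "map fst U = us" "concat (map snd U) = xu" "\<forall>z\<in>set U. k.okz z"
    "tvals M us xu = map (\<lambda>z. tval M (fst z) (snd z)) U" by (rule okz_split[OF x(2) ok(1) ob(1)])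
  obtain Z where Z: "map fst Z = ts" "concat (map snd Z) = xt" "\<forall>z\<in>set Z. k.okz z"
    "tvals M ts xt = map (\<lambda>z. tval M (fst z) (snd z)) Z" by (rule okz_split[OF x(3) ok(2) ob(2)])
  obtain V where V: "map fst V = vs" "concat (map snd V) = xv" "\<forall>z\<in>set V. k.okz z"
    "tvals M vs xv = map (\<lambda>z. tval M (fst z) (snd z)) V" by (rule okz_split[OF x(4) ok(3) ob(3)])
  have l: "length U = length us" "length Z = length ts" "length V = length vs"
    using U(1) Z(1) V(1) by auto
  have b: "enat (length U + length Z + length V) \<le> n" "enat (length U + 1 + length V) \<le> n"
    using root by (simp_all add: l)
  have okA: "\<forall>z\<in>set (U @ Z @ V). k.okz z" using U(3) Z(3) V(3) by (simp add: ball_Un)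
  have "k.arr ((mk_node (us @ mk_node ts # vs), mk_node (us @ ts @ vs)), ids xs) =
      k.as (length U) (length Z) (length V) (map k.obj U @ map k.obj Z @ map k.obj V)"
    using k.as_graft[OF b okA refl refl refl] U(1,2) Z(1,2) V(1,2) x(1) by simp
  also have "\<dots> = al (tvals M us xu) (tvals M ts xt) (tvals M vs xv)"
    unfolding map_obj_eq[OF U(3)] map_obj_eq[OF Z(3)] map_obj_eq[OF V(3)] U(4)[symmetric] Z(4)[symmetric] V(4)[symmetric]
    using as_eq_al[of "tvals M us xu" "tvals M ts xt" "tvals M vs xv"] root ob ok x
    by (simp add: l M.tvals_closed)
  also have "\<dots> = can (mk_node (us @ mk_node ts # vs)) (mk_node (us @ ts @ vs)) xs"
    unfolding x(1)
    by (rule can_eq[symmetric], rule ct_root) (use root x in \<open>auto simp: bnd_def\<close>)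
  finally show ?case .
next
  case (above us t t' vs)
  obtain xu xt xv where x: "xs = xu @ xt @ xv" "length xu = total_leaves us"
    "length xt = total_leaves [t]" "length xv = total_leaves vs"
    using above.prems by (auto simp: add.assoc intro: split_labels3[of xs us "[t]" vs])
  have ob: "ob xu" "ob xt" "ob xv" using above.prems x by auto
  have ok: "\<forall>t\<in>set us. okt n t" "\<forall>t\<in>set vs. okt n t" using above by auto
  obtain U where U: "map fst U = us" "concat (map snd U) = xu" "\<forall>z\<in>set U. k.okz z"
    "tvals M us xu = map (\<lambda>z. tval M (fst z) (snd z)) U" by (rule okz_split[OF x(2) ok(1) ob(1)])
  obtain V where V: "map fst V = vs" "concat (map snd V) = xv" "\<forall>z\<in>set V. k.okz z"
    "tvals M vs xv = map (\<lambda>z. tval M (fst z) (snd z)) V" by (rule okz_split[OF x(4) ok(2) ob(3)])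
  have l: "length U = length us" "length V = length vs" using U(1) V(1) by auto
  let ?i = "map (\<lambda>z. ((fst z, fst z), ids (snd z)))"
  let ?W = "?i U @ ((t, t'), ids xt) # ?i V"
  have b: "enat (length ?W) \<le> n" using above by (simp add: l)
  have le: "tree_le t t'" using above by (simp add: tree_le_def)
  have xt: "length xt = leaves t" using x(3) by simp
  have ct: "ct t t' xt (can t t' xt)" using above le ob xt by (intro ct_can) auto
  have "leaves t' = leaves t" using ct_leaves(1)[OF ct] .
  then have "k.oka ((t, t'), ids xt)" using above le ob xt by (intro k.oka_le) (auto simp: k.okz_def)
  then have W: "\<forall>z\<in>set ?W. k.oka z" using U(3) V(3) k.oka_ids by auto
  have i: "map k.arr (?i Y) = ids (map (\<lambda>z. tval M (fst z) (snd z)) Y)" if "\<forall>z\<in>set Y. k.okz z" for Y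
    unfolding map_obj_eq[OF that, symmetric] using that k.arr_ids by auto
  have a: "map k.arr ?W = ids (tvals M us xu) @ can t t' xt # ids (tvals M vs xv)"
    using i[OF U(3)] i[OF V(3)] above.IH[OF ob(2) xt] unfolding U(4) V(4) by simp
  have "homs (ids (tvals M us xu) @ can t t' xt # ids (tvals M vs xv))
      (tvals M us xu @ tval M t xt # tvals M vs xv) (tvals M us xu @ tval M t' xt # tvals M vs xv)"
    using ct_ctt[OF ct] ok x ob
    by (intro homs_append homs_ids) (simp_all add: M.tvals_closed homs_ids ctt_def)
  then have s: "set (map k.arr ?W) \<subseteq> Arr C" unfolding a by (simp only: homs_iff)
  have "k.arr ((mk_node (us @ t # vs), mk_node (us @ t' # vs)), ids xs) = amap (k.mu (length ?W)) (map k.arr ?W)"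
  proof -
    have 1: "map (\<lambda>z. fst (fst z)) ?W = us @ t # vs" "map (\<lambda>z. snd (fst z)) ?W = us @ t' # vs"
      using U(1) V(1) by (simp_all add: o_def)
    have "concat (map snd (?i Y)) = ids (concat (map snd Y))" for Y :: "(tree \<times> 'o list) list"
      by (induction Y) auto
    then have 2: "concat (map snd ?W) = ids xs" using U(2) V(2) x(1) by simp
    show ?thesis using k.mu_graft_arr[OF b W refl] unfolding 1 2 by simp
  qed
  also have "\<dots> = Mf (map k.arr ?W)" using b s by (intro mu_eq(2)) simp_all
  also have "\<dots> = can (mk_node (us @ t # vs)) (mk_node (us @ t' # vs)) xs"
    unfolding x(1) a
    by (rule can_eq[symmetric], rule ct_above[OF _ ct]) (use above x ob in \<open>auto simp: bnd_def\<close>)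
  finally show ?case .
qed

text \<open>Both sides respect composition, so the equality for single contractions extends along a
  path within the arity bound.\<close>

lemma arr_can:
  "tree_le T T' \<Longrightarrow> okt n T \<Longrightarrow> okt n T' \<Longrightarrow> ob xs \<Longrightarrow> length xs = leaves T \<Longrightarrow>
    k.arr ((T, T'), ids xs) = can T T' xs"
proof (induction arbitrary: xs rule: tree_le_induct)
  case (refl T)
  then show ?case using k.arr_ids[of T xs] obj_eq can_refl by (simp add: k.okz_def)
next
  case (shrink T T' T'')
  have le: "tree_le T T'" using shrink(1) by (simp add: tree_le_def)
  have l1: "leaves T' = leaves T" by (rule shrink_leaves[OF shrink(1)])
  have l: "leaves T'' = leaves T"
  proof -
    have "ct T' T'' xs (can T' T'' xs)" using shrink l1 by (intro ct_can) auto
    then show ?thesis using ct_leaves(1) l1 by simp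
  qed
  have "k.arr ((T, T''), ids xs) = k.arr ((T', T''), ids xs) \<bullet> k.arr ((T, T'), ids xs)"
    using shrink le l l1 by (intro k.arr_comp_ids[symmetric]) (auto simp: k.okz_def)
  also have "\<dots> = can T' T'' xs \<bullet> can T T' xs"
    using shrink l1 arr_shrink by simp
  also have "\<dots> = can T T'' xs" using shrink le by (intro can_trans[symmetric]) auto
  finally show ?case .
qed

lemma action_unique: "functor_eq (prod_cat (K_cat n i) (power_cat C i)) (\<theta> i) (action i)"
proof -
  have "omap (\<theta> i) (T, xs) = tval M T xs" if "okt n T" "leaves T = i" "length xs = i" "ob xs" for T xs
    using obj_eq[of T xs] that by (simp add: k.obj_def)
  moreover have "amap (\<theta> i) ((T, T'), fs) = can T T' (map (Tgt C) fs) \<bullet> tval Mf T fs"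
    if a: "okt n T" "leaves T = i" "okt n T'" "leaves T' = i" "tree_le T T'" "length fs = i" "set fs \<subseteq> Arr C"
    for T T' fs
  proof -
    have h: "homs fs (map (Src C) fs) (map (Tgt C) fs)" using a(7) by (simp add: homs_iff)
    have ob: "ob (map (Tgt C) fs)" using homs_Obj[OF h] by simp
    have t: "map (Src C) (ids (map (Tgt C) fs)) = map (Tgt C) fs"
      using homs_ids[OF ob] by (simp only: homs_iff)
    have "k.oka ((T, T), fs)" using a by (simp add: k.oka_def tree_le_refl)
    moreover have "k.oka ((T, T'), ids (map (Tgt C) fs))"
      using a ob by (intro k.oka_le) (auto simp: k.okz_def)
    \<comment> \<open>The factorization used to define \<open>action\<close> holds in every algebra
      by functoriality, and both factors are already known.\<close>
    ultimately have "k.arr ((T, T'), ids (map (Tgt C) fs)) \<bullet> k.arr ((T, T), fs) =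
        k.arr ((T, T'), map2 comp (ids (map (Tgt C) fs)) fs)"
      using t by (intro k.arr_comp) (simp_all only:)
    then show ?thesis
      using arr_can[OF a(5,1,3) ob] arr_eq[OF a(1,7)] a map2_ids_left[OF h] by (simp add: k.arr_def)
  qed
  ultimately show ?thesis by (auto simp: functor_eq_def K_iff)
qed

end

theorem theorem2p3:
  fixes n :: enat and C :: "('o, 'm) cat"
  assumes "2 \<le> n" and "category C"
  shows "((\<exists>\<theta>. K_algebra n C \<theta>) \<longleftrightarrow> (\<exists>\<mu> \<alpha>. A_monoidal n C \<mu> \<alpha>)) \<and>
    (\<forall>\<theta>. K_algebra n C \<theta> \<longrightarrow> (\<exists>\<mu> \<alpha>. A_monoidal n C \<mu> \<alpha> \<and> corresponds n C \<theta> \<mu> \<alpha>)) \<and>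
    (\<forall>\<mu> \<alpha>. A_monoidal n C \<mu> \<alpha> \<longrightarrow>
      (\<exists>\<theta>. K_algebra n C \<theta> \<and> corresponds n C \<theta> \<mu> \<alpha> \<and>
        (\<forall>\<theta>'. K_algebra n C \<theta>' \<and> corresponds n C \<theta>' \<mu> \<alpha> \<longrightarrow>
          (\<forall>i. functor_eq (prod_cat (K_cat n i) (power_cat C i)) (\<theta>' i) (\<theta> i)))))"
proof -
  have 1: "\<exists>\<mu> \<alpha>. A_monoidal n C \<mu> \<alpha> \<and> corresponds n C \<theta> \<mu> \<alpha>" if "K_algebra n C \<theta>" for \<theta>
  proof -
    interpret k_action n C \<theta> using that assms(2) by (intro k_action.intro)
    show ?thesis using A_monoidal_mu corresponds_mu_as by blast
  qed
  have 2: "\<exists>\<theta>. K_algebra n C \<theta> \<and> corresponds n C \<theta> \<mu> \<alpha> \<and>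
        (\<forall>\<theta>'. K_algebra n C \<theta>' \<and> corresponds n C \<theta>' \<mu> \<alpha> \<longrightarrow>
          (\<forall>i. functor_eq (prod_cat (K_cat n i) (power_cat C i)) (\<theta>' i) (\<theta> i)))"
    if "A_monoidal n C \<mu> \<alpha>" for \<mu> \<alpha>
  proof -
    interpret m: monoidal n C \<mu> \<alpha> using that assms(2) by (intro monoidal.intro)
    have "functor_eq (prod_cat (K_cat n i) (power_cat C i)) (\<theta>' i) (m.action i)"
      if "K_algebra n C \<theta>'" "corresponds n C \<theta>' \<mu> \<alpha>" for \<theta>' i
    proof -
      interpret compatible n C \<mu> \<alpha> \<theta>'
        using that assms(2) m.monoidal_axioms
        by (intro compatible.intro compatible_axioms.intro k_action.intro)
      show ?thesis by (rule action_unique)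
    qed
    then show ?thesis using m.K_algebra_action m.corresponds_action by blast
  qed
  show ?thesis using 1 2 by blast
qed

end
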